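(* Let $\mathcal{B}$ be a Hopf algebra with antipode $S$, let $L:\mathcal{B}\otimes\mathcal{B}\to\mathbb{C}$ be the generator of an additive deformation, and let $\sigma:=L\circ(\mathrm{id}\otimes S)\circ\Delta$. If $\sigma=\sigma\circ S$, then $$\widetilde{L}=L-\tfrac12\partial\sigma$$ is the generator of a Hopf deformation $\widetilde\mu_t=\mu\star e_\star^{t\widetilde L}$ ($t\in\mathbb{R}$) with constant antipodes, i.e. $$\widetilde{\mu}_t\circ(S\otimes\mathrm{id})\circ\Delta=\mathbf 1\delta=\widetilde{\mu}_t\circ(\mathrm{id}\otimes S)\circ\Delta\qquad\text{for all }t\in\mathbb{R}.$$
   Context: All vector spaces are over $\mathbb{C}$. $(\mathcal{B},\mu,\mathbf 1,\Delta,\delta)$: multiplication, unit, comultiplication, counit; $\tau$ is the flip; $\mathbf 1\delta$ is the map $a\mapsto\delta(a)\mathbf 1$. $\mathcal{B}\otimes\mathcal{B}$ is a coalgebra with comultiplication $(\mathrm{id}\otimes\tau\otimes\mathrm{id})\circ(\Delta\otimes\Delta)$ and counit $\delta\otimes\delta$. Convolution: $(\mu\star L)(a\otimes b)=a_{(1)}b_{(1)}L(a_{(2)}\otimes b_{(2)})$, $(L\star\mu)(a\otimes b)=L(a_{(1)}\otimes b_{(1)})a_{(2)}b_{(2)}$, $(L\star L')(a\otimes b)=L(a_{(1)}\otimes b_{(1)})L'(a_{(2)}\otimes b_{(2)})$; $e_\star^{tL}=\sum_{n\ge0}t^nL^{\star n}/n!$ (pointwise convergent), with $L^{\star0}=\delta\otimes\delta$.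 For linear $\sigma:\mathcal{B}\to\mathbb{C}$: $\partial\sigma(a\otimes b)=\delta(a)\sigma(b)-\sigma(ab)+\sigma(a)\delta(b)$. An additive deformation of a bialgebra $\mathcal{B}$ is a family $(\mu_t)_{t\ge0}$ of linear maps $\mathcal{B}\otimes\mathcal{B}\to\mathcal{B}$ with $(\mathcal{B},\mu_t,\mathbf 1)$ a unital algebra, $\mu_0=\mu$, $\Delta\circ\mu_{t+s}=(\mu_t\otimes\mu_s)\circ(\mathrm{id}\otimes\tau\otimes\mathrm{id})\circ(\Delta\otimes\Delta)$, and $\delta\circ\mu_t\to\delta\otimes\delta$ pointwise as $t\to0$. Its generator is $L=\frac{\mathrm d}{\mathrm dt}(\delta\circ\mu_t)|_{t=0}$. By a theorem of Wirth (known), $\mu_t=\mu\star e_\star^{tL}$, and the generators are exactly the linear maps $L:\mathcal{B}\otimes\mathcal{B}\to\mathbb{C}$ with $\mu\star L=L\star\mu$, $L(\mathbf 1\otimes\mathbf 1)=0$, and $\delta(a)L(b\otimes c)-L(ab\otimes c)+L(a\otimes bc)-L(a\otimes b)\delta(c)=0$ for all $a,b,c$. Additive deformations are viewed as indexed by all $t\in\mathbb{R}$ via $\mu_t=\mu\star e_\star^{tL}$. An additive deformation is a Hopf deformation if for all $t\in\mathbb{R}$ there is a linear $S_t:\mathcal{B}\to\mathcal{B}$ (deformed antipode) with $\mu_t\circ(S_t\otimes\mathrm{id})\circ\Delta=\mu_t\circ(\mathrm{id}\otimes S_t)\circ\Delta=\mathbf 1\delta$; it has constant antipodes if $S_t=S$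 for all $t$. *)

theory Defs
  imports "HOL-Analysis.Analysis" "HOL-Library.Poly_Mapping"
begin

section \<open>Complex vector spaces\<close>

class complex_vector = ab_group_add +
  fixes scaleC :: "complex \<Rightarrow> 'a \<Rightarrow> 'a"  (infixr "*\<^sub>C" 75)
  assumes scaleC_add_right: "c *\<^sub>C (x + y) = c *\<^sub>C x + c *\<^sub>C y"
    and scaleC_add_left: "(c + d) *\<^sub>C x = c *\<^sub>C x + d *\<^sub>C x"
    and scaleC_scaleC: "c *\<^sub>C d *\<^sub>C x = (c * d) *\<^sub>C x"
    and scaleC_one: "1 *\<^sub>C x = x"

global_interpretation complex_vector: vector_space "scaleC :: complex \<Rightarrow> 'a \<Rightarrow> 'a::complex_vector"
  by unfold_locales (simp_all add: scaleC_add_right scaleC_add_left scaleC_scaleC scaleC_one)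

abbreviation clinear :: "('a::complex_vector \<Rightarrow> 'b::complex_vector) \<Rightarrow> bool" where
  "clinear \<equiv> Vector_Spaces.linear scaleC scaleC"

definition cbilinear :: "('a::complex_vector \<Rightarrow> 'b::complex_vector \<Rightarrow> 'c::complex_vector) \<Rightarrow> bool" where
  "cbilinear f \<longleftrightarrow> (\<forall>x. clinear (f x)) \<and> (\<forall>y. clinear (\<lambda>x. f x y))"

lemma clinear_iff:
  "clinear f \<longleftrightarrow> (\<forall>x y. f (x + y) = f x + f y) \<and> (\<forall>c x. f (c *\<^sub>C x) = c *\<^sub>C f x)"
  by (simp add: Vector_Spaces.linear_def module_hom_def module_hom_axioms_def
      complex_vector.module_axioms complex_vector.vector_space_axioms)

lemma clinear_add: "clinear f \<Longrightarrow> f (x + y) = f x + f y"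
  and clinear_scaleC: "clinear f \<Longrightarrow> f (c *\<^sub>C x) = c *\<^sub>C f x"
  by (simp_all add: clinear_iff)

lemma clinear_zero: "clinear f \<Longrightarrow> f 0 = 0"
  using clinear_scaleC[of f 0 0] by simp

lemma clinear_sum: "clinear f \<Longrightarrow> f (sum g A) = (\<Sum>x\<in>A. f (g x))"
  by (induction A rule: infinite_finite_induct) (simp_all add: clinear_zero clinear_add)

lemma clinear_compose: "clinear f \<Longrightarrow> clinear g \<Longrightarrow> clinear (\<lambda>x. f (g x))"
  by (simp add: clinear_iff)

lemma cbilinearD: "cbilinear f \<Longrightarrow> clinear (\<lambda>x. f x y)"
  by (simp add: cbilinear_def)

lemma cbilinear_iff:
  "cbilinear f \<longleftrightarrow> (\<forall>x y z. f x (y + z) = f x y + f x z) \<and> (\<forall>x c y. f x (c *\<^sub>C y) = c *\<^sub>C f x y) \<and>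
     (\<forall>x y z. f (x + y) z = f x z + f y z) \<and> (\<forall>c x y. f (c *\<^sub>C x) y = c *\<^sub>C f x y)"
  by (auto simp: cbilinear_def clinear_iff)

instantiation complex :: complex_vector
begin
definition scaleC_complex :: "complex \<Rightarrow> complex \<Rightarrow> complex" where
  "scaleC_complex c z = c * z"
instance by standard (simp_all add: scaleC_complex_def algebra_simps)
end

instantiation poly_mapping :: (type, complex_vector) complex_vector
begin
definition scaleC_poly_mapping :: "complex \<Rightarrow> ('a \<Rightarrow>\<^sub>0 'b) \<Rightarrow> ('a \<Rightarrow>\<^sub>0 'b)" where
  "scaleC_poly_mapping c p = Poly_Mapping.map (scaleC c) p"

lemma lookup_scaleC [simp]:
  "Poly_Mapping.lookup (c *\<^sub>C p) k = c *\<^sub>C Poly_Mapping.lookup p k"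
  by (auto simp: scaleC_poly_mapping_def Poly_Mapping.map.rep_eq when_def)

instance
  by standard (auto intro!: poly_mapping_eqI
      simp: lookup_add scaleC_add_right scaleC_add_left scaleC_scaleC scaleC_one)
end


section \<open>The algebraic tensor product\<close>

text \<open>The space of all finitely supported functions \<^typ>\<open>'a \<times> 'b \<Rightarrow>\<^sub>0 complex\<close> is the free vector
  space on \<^typ>\<open>'a \<times> 'b\<close>; the tensor product is its quotient by the bilinearity relations.\<close>

abbreviation free_pair :: "'a \<Rightarrow> 'b \<Rightarrow> ('a \<times> 'b \<Rightarrow>\<^sub>0 complex)" where
  "free_pair a b \<equiv> Poly_Mapping.single (a, b) 1"

definition tensor_relators :: "('a::complex_vector \<times> 'b::complex_vector \<Rightarrow>\<^sub>0 complex) set" where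
  "tensor_relators =
     {free_pair (a + a') b - free_pair a b - free_pair a' b | a a' b. True} \<union>
     {free_pair a (b + b') - free_pair a b - free_pair a b' | a b b'. True} \<union>
     {free_pair (c *\<^sub>C a) b - c *\<^sub>C free_pair a b | c a b. True} \<union>
     {free_pair a (c *\<^sub>C b) - c *\<^sub>C free_pair a b | c a b. True}"

definition tensor_rel ::
  "('a::complex_vector \<times> 'b::complex_vector \<Rightarrow>\<^sub>0 complex) \<Rightarrow> ('a \<times> 'b \<Rightarrow>\<^sub>0 complex) \<Rightarrow> bool" where
  "tensor_rel p q \<longleftrightarrow> p - q \<in> complex_vector.span tensor_relators"

lemma equivp_tensor_rel: "equivp tensor_rel"
proof (rule equivpI)
  show "reflp tensor_rel"
    by (auto simp: reflp_def tensor_rel_def complex_vector.span_zero)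
  show "symp tensor_rel"
    unfolding symp_def tensor_rel_def by (metis complex_vector.span_neg minus_diff_eq)
  show "transp tensor_rel"
    unfolding transp_def tensor_rel_def by (auto dest: complex_vector.span_add)
qed

quotient_type (overloaded) ('a, 'b) tensor =
  "'a::complex_vector \<times> 'b::complex_vector \<Rightarrow>\<^sub>0 complex" / tensor_rel
  by (rule equivp_tensor_rel)

instantiation tensor :: (complex_vector, complex_vector) complex_vector
begin

lift_definition zero_tensor :: "('a, 'b) tensor" is 0 .

lift_definition plus_tensor :: "('a, 'b) tensor \<Rightarrow> ('a, 'b) tensor \<Rightarrow> ('a, 'b) tensor" is "(+)"
  unfolding tensor_rel_def add_diff_add by (rule complex_vector.span_add)

lift_definition minus_tensor :: "('a, 'b) tensor \<Rightarrow> ('a, 'b) tensor \<Rightarrow> ('a, 'b) tensor" is "(-)"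
proof -
  fix p p' q q' :: "'a \<times> 'b \<Rightarrow>\<^sub>0 complex"
  assume "tensor_rel p p'" "tensor_rel q q'"
  then have "(p - p') - (q - q') \<in> complex_vector.span tensor_relators"
    unfolding tensor_rel_def by (rule complex_vector.span_diff)
  then show "tensor_rel (p - q) (p' - q')"
    by (simp add: tensor_rel_def algebra_simps)
qed

lift_definition uminus_tensor :: "('a, 'b) tensor \<Rightarrow> ('a, 'b) tensor" is uminus
  unfolding tensor_rel_def minus_diff_minus by (rule complex_vector.span_neg)

lift_definition scaleC_tensor :: "complex \<Rightarrow> ('a, 'b) tensor \<Rightarrow> ('a, 'b) tensor" is scaleC
  unfolding tensor_rel_def complex_vector.scale_right_diff_distrib[symmetric]
  by (rule complex_vector.span_scale)

lemma tensor_relI: "p = q \<Longrightarrow> tensor_rel p q"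
  by (simp add: tensor_rel_def complex_vector.span_zero)

instance
  by standard (transfer, rule tensor_relI,
      simp add: algebra_simps scaleC_add_right scaleC_add_left scaleC_scaleC scaleC_one)+

end

lift_definition tensor_pure :: "'a::complex_vector \<Rightarrow> 'b::complex_vector \<Rightarrow> ('a, 'b) tensor"
  (infixr "\<otimes>" 72) is free_pair .

definition free_lift ::
  "('a \<Rightarrow> 'b \<Rightarrow> 'c::complex_vector) \<Rightarrow> ('a \<times> 'b \<Rightarrow>\<^sub>0 complex) \<Rightarrow> 'c" where
  "free_lift f p = (\<Sum>x \<in> Poly_Mapping.keys p. Poly_Mapping.lookup p x *\<^sub>C f (fst x) (snd x))"

text \<open>The linear map induced by a bilinear map \<open>f\<close>. It is read off from an arbitrarily chosen
  representative, hence meaningful for bilinear \<open>f\<close> only; see \<open>tensor_lift_pure\<close> and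
  \<open>clinear_tensor_lift\<close> below.\<close>

definition tensor_lift ::
  "('a::complex_vector \<Rightarrow> 'b::complex_vector \<Rightarrow> 'c::complex_vector) \<Rightarrow> ('a, 'b) tensor \<Rightarrow> 'c" where
  "tensor_lift f t = free_lift f (rep_tensor t)"

lemma free_lift_superset:
  assumes "finite A" "Poly_Mapping.keys p \<subseteq> A"
  shows "free_lift f p = (\<Sum>x\<in>A. Poly_Mapping.lookup p x *\<^sub>C f (fst x) (snd x))"
  unfolding free_lift_def
  by (rule sum.mono_neutral_left) (use assms in \<open>auto simp: in_keys_iff\<close>)

lemma clinear_free_lift:
  fixes f :: "'a \<Rightarrow> 'b \<Rightarrow> 'c::complex_vector"
  shows "clinear (free_lift f)"
  unfolding clinear_iff
proof (intro conjI allI)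
  fix p q :: "'a \<times> 'b \<Rightarrow>\<^sub>0 complex"
  let ?A = "Poly_Mapping.keys p \<union> Poly_Mapping.keys q"
  have "Poly_Mapping.keys (p + q) \<subseteq> ?A" by (rule Poly_Mapping.keys_add)
  then show "free_lift f (p + q) = free_lift f p + free_lift f q"
    by (simp add: free_lift_superset[of ?A] lookup_add scaleC_add_left sum.distrib)
next
  fix c and p :: "'a \<times> 'b \<Rightarrow>\<^sub>0 complex"
  have "Poly_Mapping.keys (c *\<^sub>C p) \<subseteq> Poly_Mapping.keys p"
    by (auto simp: in_keys_iff)
  then show "free_lift f (c *\<^sub>C p) = c *\<^sub>C free_lift f p"
    by (simp add: free_lift_superset[of "Poly_Mapping.keys p"] complex_vector.scale_sum_right
        scaleC_scaleC scaleC_complex_def)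
qed

lemma free_lift_pair [simp]: "free_lift f (free_pair a b) = f a b"
  by (simp add: free_lift_def scaleC_one)

lemma clinear_diff: "clinear f \<Longrightarrow> f (x - y) = f x - f y"
  using clinear_add[of f "x - y" y] by simp

lemma free_lift_cong_rel:
  assumes "cbilinear f" "tensor_rel p q"
  shows "free_lift f p = free_lift f q"
proof -
  note lin = clinear_diff[OF clinear_free_lift] clinear_scaleC[OF clinear_free_lift]
  have "free_lift f r = 0" if "r \<in> tensor_relators" for r
    using that assms(1) by (auto simp: tensor_relators_def lin cbilinear_iff)
  then have "tensor_relators \<subseteq> {r. free_lift f r = 0}"
    by blast
  moreover have "complex_vector.subspace {r. free_lift f r = 0}"
    by (simp add: complex_vector.subspace_def clinear_zero clinear_add clinear_scaleC clinear_free_lift)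
  ultimately have "complex_vector.span tensor_relators \<subseteq> {r. free_lift f r = 0}"
    by (rule complex_vector.span_minimal)
  then show ?thesis
    using assms(2) by (auto simp: tensor_rel_def lin)
qed

lemma tensor_lift_abs: "cbilinear f \<Longrightarrow> tensor_lift f (abs_tensor p) = free_lift f p"
  unfolding tensor_lift_def
  by (metis free_lift_cong_rel Quotient3_tensor rep_abs_rsp_left equivp_reflp equivp_tensor_rel)

lemma tensor_lift_pure [simp]: "cbilinear f \<Longrightarrow> tensor_lift f (a \<otimes> b) = f a b"
  by (simp add: tensor_pure.abs_eq tensor_lift_abs)

lemma clinear_tensor_lift:
  assumes "cbilinear f"
  shows "clinear (tensor_lift f)"
  unfolding clinear_iff
proof (intro conjI allI)
  fix s t :: "('a, 'b) tensor"
  show "tensor_lift f (s + t) = tensor_lift f s + tensor_lift f t"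
    by (induction s, induction t)
      (simp add: plus_tensor.abs_eq tensor_lift_abs assms clinear_add clinear_free_lift)
next
  fix c and t :: "('a, 'b) tensor"
  show "tensor_lift f (c *\<^sub>C t) = c *\<^sub>C tensor_lift f t"
    by (induction t)
      (simp add: scaleC_tensor.abs_eq tensor_lift_abs assms clinear_scaleC clinear_free_lift)
qed

lemma cbilinear_tensor_pure: "cbilinear (\<otimes>)"
  unfolding cbilinear_iff
proof (intro conjI allI)
  fix a a' :: 'a and b b' :: 'b and c
  have *: "tensor_rel p q" if "p - q \<in> tensor_relators" for p q :: "'a \<times> 'b \<Rightarrow>\<^sub>0 complex"
    using that by (simp add: tensor_rel_def complex_vector.span_base)
  show "a \<otimes> (b + b') = a \<otimes> b + a \<otimes> b'"
    by transfer (rule *, unfold tensor_relators_def diff_diff_eq[symmetric], blast)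
  show "(a + a') \<otimes> b = a \<otimes> b + a' \<otimes> b"
    by transfer (rule *, unfold tensor_relators_def diff_diff_eq[symmetric], blast)
  show "a \<otimes> (c *\<^sub>C b) = c *\<^sub>C (a \<otimes> b)"
    by transfer (rule *, unfold tensor_relators_def, blast)
  show "(c *\<^sub>C a) \<otimes> b = c *\<^sub>C (a \<otimes> b)"
    by transfer (rule *, unfold tensor_relators_def, blast)
qed

lemmas tensor_pure_simps =
  cbilinear_tensor_pure[unfolded cbilinear_iff, THEN conjunct1, rule_format]
  cbilinear_tensor_pure[unfolded cbilinear_iff, THEN conjunct2, THEN conjunct1, rule_format]
  cbilinear_tensor_pure[unfolded cbilinear_iff, THEN conjunct2, THEN conjunct2, THEN conjunct1, rule_format]
  cbilinear_tensor_pure[unfolded cbilinear_iff, THEN conjunct2, THEN conjunct2, THEN conjunct2, rule_format]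

lemma tensor_induct [case_names pure add]:
  assumes pure: "\<And>a b. P (a \<otimes> b)" and add: "\<And>s t. P s \<Longrightarrow> P t \<Longrightarrow> P (s + t)"
  shows "P t"
proof (induction t)
  fix p :: "'a \<times> 'b \<Rightarrow>\<^sub>0 complex"
  have single: "P (abs_tensor (Poly_Mapping.single x c))" for x c
  proof -
    obtain a b where x: "x = (a, b)" by (cases x)
    have "Poly_Mapping.single x c = c *\<^sub>C free_pair a b"
      by (rule poly_mapping_eqI) (simp add: x lookup_single when_def scaleC_complex_def)
    then have "abs_tensor (Poly_Mapping.single x c) = (c *\<^sub>C a) \<otimes> b"
      by (simp add: scaleC_tensor.abs_eq[symmetric] tensor_pure.abs_eq[symmetric] tensor_pure_simps)
    then show ?thesis using pure by simp
  qed
  show "P (abs_tensor p)"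
  proof (induction p rule: Poly_Mapping.update_induct)
    case const
    then show ?case using single[of undefined 0] by simp
  next
    case (update p x c)
    have "Poly_Mapping.update x c p = p + Poly_Mapping.single x c"
      using update(1)
      by (intro poly_mapping_eqI) (auto simp: lookup_update lookup_add lookup_single when_def in_keys_iff)
    then show ?case using add update single by (simp add: plus_tensor.abs_eq[symmetric])
  qed
qed

lemma tensor_lift_unique:
  assumes "clinear g" "clinear h" "\<And>a b. g (a \<otimes> b) = h (a \<otimes> b)"
  shows "g = h"
proof
  fix t show "g t = h t"
    by (induction t rule: tensor_induct) (simp_all add: assms clinear_add)
qed

definition tensor_map ::
  "('a::complex_vector \<Rightarrow> 'c::complex_vector) \<Rightarrow> ('b::complex_vector \<Rightarrow> 'd::complex_vector) \<Rightarrow>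
     ('a, 'b) tensor \<Rightarrow> ('c, 'd) tensor" where
  "tensor_map f g = tensor_lift (\<lambda>a b. f a \<otimes> g b)"

definition tensor_assoc ::
  "(('a::complex_vector, 'b::complex_vector) tensor, 'c::complex_vector) tensor \<Rightarrow>
     ('a, ('b, 'c) tensor) tensor" where
  "tensor_assoc = tensor_lift (\<lambda>x c. tensor_lift (\<lambda>a b. a \<otimes> (b \<otimes> c)) x)"

text \<open>The map \<open>id \<otimes> \<tau> \<otimes> id\<close>, with the fourfold tensor product bracketed in pairs:
  \<open>(a \<otimes> b) \<otimes> (c \<otimes> d) \<mapsto> (a \<otimes> c) \<otimes> (b \<otimes> d)\<close>.\<close>

definition tensor_interchange ::
  "(('a::complex_vector, 'b::complex_vector) tensor, ('c::complex_vector, 'd::complex_vector) tensor) tensor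
     \<Rightarrow> (('a, 'c) tensor, ('b, 'd) tensor) tensor" where
  "tensor_interchange =
     tensor_lift (\<lambda>x y. tensor_lift (\<lambda>a b. tensor_lift (\<lambda>c d. (a \<otimes> c) \<otimes> (b \<otimes> d)) y) x)"

lemma cbilinear_tensor_map:
  "clinear f \<Longrightarrow> clinear g \<Longrightarrow> cbilinear (\<lambda>a b. f a \<otimes> g b)"
  by (simp add: cbilinear_iff clinear_iff tensor_pure_simps)

lemma tensor_map_pure [simp]:
  "clinear f \<Longrightarrow> clinear g \<Longrightarrow> tensor_map f g (a \<otimes> b) = f a \<otimes> g b"
  by (simp add: tensor_map_def cbilinear_tensor_map)

lemma clinear_tensor_map: "clinear f \<Longrightarrow> clinear g \<Longrightarrow> clinear (tensor_map f g)"
  by (simp add: tensor_map_def cbilinear_tensor_map clinear_tensor_lift)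

text \<open>Lifts of families of bilinear maps depending linearly on a parameter.\<close>

lemma tensor_lift_param:
  assumes "\<And>y. cbilinear (f y)" "\<And>a b. clinear (\<lambda>y. f y a b)"
  shows "cbilinear (\<lambda>x y. tensor_lift (f y) x)" and "cbilinear (\<lambda>y x. tensor_lift (f y) x)"
proof -
  note lin = assms(2)[unfolded clinear_iff]
  have "tensor_lift (f (y + z)) x = tensor_lift (f y) x + tensor_lift (f z) x" for x y z
  proof (induction x rule: tensor_induct)
    case (pure a b)
    show ?case
      unfolding tensor_lift_pure[OF assms(1)] using lin by blast
  next
    case (add s t)
    have "tensor_lift (f (y + z)) (s + t) = tensor_lift (f (y + z)) s + tensor_lift (f (y + z)) t"
      by (rule clinear_add[OF clinear_tensor_lift[OF assms(1)]])
    then show ?case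
      unfolding add by (simp add: clinear_add[OF clinear_tensor_lift[OF assms(1)]])
  qed
  moreover have "tensor_lift (f (c *\<^sub>C y)) x = c *\<^sub>C tensor_lift (f y) x" for x y c
  proof (induction x rule: tensor_induct)
    case (pure a b)
    show ?case
      unfolding tensor_lift_pure[OF assms(1)] using lin by blast
  next
    case (add s t)
    have "tensor_lift (f (c *\<^sub>C y)) (s + t) = tensor_lift (f (c *\<^sub>C y)) s + tensor_lift (f (c *\<^sub>C y)) t"
      by (rule clinear_add[OF clinear_tensor_lift[OF assms(1)]])
    then show ?case
      unfolding add by (simp add: clinear_add[OF clinear_tensor_lift[OF assms(1)]] scaleC_add_right)
  qed
  ultimately show "cbilinear (\<lambda>x y. tensor_lift (f y) x)" "cbilinear (\<lambda>y x. tensor_lift (f y) x)"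
    using assms(1)[THEN clinear_tensor_lift] by (simp_all add: cbilinear_iff clinear_iff)
qed

lemma
  fixes a :: "'a::complex_vector" and b :: "'b::complex_vector" and c :: "'c::complex_vector"
  shows clinear_tensor_assoc:
      "clinear (tensor_assoc :: (('a, 'b) tensor, 'c) tensor \<Rightarrow> ('a, ('b, 'c) tensor) tensor)"
    and tensor_assoc_pure [simp]: "tensor_assoc ((a \<otimes> b) \<otimes> c) = a \<otimes> (b \<otimes> c)"
proof -
  have 1: "cbilinear (\<lambda>(a::'a) (b::'b). a \<otimes> (b \<otimes> c))" for c :: 'c
    by (simp add: cbilinear_iff tensor_pure_simps)
  have 2: "cbilinear (\<lambda>x (c::'c). tensor_lift (\<lambda>(a::'a) (b::'b). a \<otimes> (b \<otimes> c)) x)"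
    by (rule tensor_lift_param) (simp_all add: 1 clinear_iff tensor_pure_simps)
  show "clinear (tensor_assoc :: (('a, 'b) tensor, 'c) tensor \<Rightarrow> ('a, ('b, 'c) tensor) tensor)"
    "tensor_assoc ((a \<otimes> b) \<otimes> c) = a \<otimes> (b \<otimes> c)"
    by (simp_all add: tensor_assoc_def 1 2 clinear_tensor_lift)
qed

lemma
  fixes a :: "'a::complex_vector" and b :: "'b::complex_vector"
    and c :: "'c::complex_vector" and d :: "'d::complex_vector"
  shows clinear_tensor_interchange:
      "clinear (tensor_interchange :: (('a, 'b) tensor, ('c, 'd) tensor) tensor \<Rightarrow> _)"
    and tensor_interchange_pure [simp]:
      "tensor_interchange ((a \<otimes> b) \<otimes> (c \<otimes> d)) = (a \<otimes> c) \<otimes> (b \<otimes> d)"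
proof -
  have 1: "cbilinear (\<lambda>(c::'c) (d::'d). (a \<otimes> c) \<otimes> (b \<otimes> d))" for a :: 'a and b :: 'b
    by (simp add: cbilinear_iff tensor_pure_simps)
  have 2: "clinear (\<lambda>a::'a. tensor_lift (\<lambda>c d. (a \<otimes> c) \<otimes> (b \<otimes> d)) y)" for b :: 'b and y :: "('c, 'd) tensor"
    by (rule cbilinearD, rule tensor_lift_param) (simp_all add: 1 clinear_iff tensor_pure_simps)
  have 3: "clinear (\<lambda>b::'b. tensor_lift (\<lambda>c d. (a \<otimes> c) \<otimes> (b \<otimes> d)) y)" for a :: 'a and y :: "('c, 'd) tensor"
    by (rule cbilinearD, rule tensor_lift_param) (simp_all add: 1 clinear_iff tensor_pure_simps)
  have 4: "cbilinear (\<lambda>(a::'a) (b::'b). tensor_lift (\<lambda>c d. (a \<otimes> c) \<otimes> (b \<otimes> d)) y)" for y :: "('c, 'd) tensor"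
    by (simp add: cbilinear_def 2 3)
  have 5: "cbilinear (\<lambda>x y. tensor_lift (\<lambda>(a::'a) (b::'b). tensor_lift (\<lambda>(c::'c) (d::'d). (a \<otimes> c) \<otimes> (b \<otimes> d)) y) x)"
    by (rule tensor_lift_param) (simp_all add: 1 4 clinear_tensor_lift)
  show "clinear (tensor_interchange :: (('a, 'b) tensor, ('c, 'd) tensor) tensor \<Rightarrow> _)"
    "tensor_interchange ((a \<otimes> b) \<otimes> (c \<otimes> d)) = (a \<otimes> c) \<otimes> (b \<otimes> d)"
    by (simp_all add: tensor_interchange_def 1 4 5 clinear_tensor_lift)
qed


section \<open>Bialgebras and Hopf algebras\<close>

definition unital_algebra :: "(('b::complex_vector, 'b) tensor \<Rightarrow> 'b) \<Rightarrow> 'b \<Rightarrow> bool" where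
  "unital_algebra m e \<longleftrightarrow> clinear m \<and>
     (\<forall>a b c. m (m (a \<otimes> b) \<otimes> c) = m (a \<otimes> m (b \<otimes> c))) \<and>
     (\<forall>a. m (e \<otimes> a) = a \<and> m (a \<otimes> e) = a)"

definition coalgebra :: "('b::complex_vector \<Rightarrow> ('b, 'b) tensor) \<Rightarrow> ('b \<Rightarrow> complex) \<Rightarrow> bool" where
  "coalgebra D d \<longleftrightarrow> clinear D \<and> clinear d \<and>
     tensor_assoc \<circ> tensor_map D id \<circ> D = tensor_map id D \<circ> D \<and>
     tensor_lift (\<lambda>x y. d x *\<^sub>C y) \<circ> D = id \<and> tensor_lift (\<lambda>x y. d y *\<^sub>C x) \<circ> D = id"

record (overloaded) 'b bialg =
  mult :: "('b::complex_vector, 'b) tensor \<Rightarrow> 'b"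
  unit_elt :: 'b
  comult :: "'b \<Rightarrow> ('b, 'b) tensor"
  counit :: "'b \<Rightarrow> complex"

text \<open>The tensor product coalgebra on \<open>\<B> \<otimes> \<B>\<close>.\<close>

definition comult2 ::
  "'b::complex_vector bialg \<Rightarrow> ('b, 'b) tensor \<Rightarrow> (('b, 'b) tensor, ('b, 'b) tensor) tensor" where
  "comult2 H = tensor_interchange \<circ> tensor_map (comult H) (comult H)"

definition counit2 :: "'b::complex_vector bialg \<Rightarrow> ('b, 'b) tensor \<Rightarrow> complex" where
  "counit2 H = tensor_lift (\<lambda>a b. counit H a * counit H b)"

definition bialgebra :: "'b::complex_vector bialg \<Rightarrow> bool" where
  "bialgebra H \<longleftrightarrow>
     unital_algebra (mult H) (unit_elt H) \<and> coalgebra (comult H) (counit H) \<and>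
     comult H \<circ> mult H = tensor_map (mult H) (mult H) \<circ> comult2 H \<and>
     comult H (unit_elt H) = unit_elt H \<otimes> unit_elt H \<and>
     counit H \<circ> mult H = counit2 H \<and>
     counit H (unit_elt H) = 1"

definition unit_counit :: "'b::complex_vector bialg \<Rightarrow> 'b \<Rightarrow> 'b" where
  "unit_counit H a = counit H a *\<^sub>C unit_elt H"

text \<open>\<open>T\<close> is an antipode for the (possibly deformed) multiplication \<open>m\<close>, with respect to the
  undeformed unit, comultiplication and counit of \<open>H\<close>.\<close>

definition is_antipode ::
  "'b::complex_vector bialg \<Rightarrow> (('b, 'b) tensor \<Rightarrow> 'b) \<Rightarrow> ('b \<Rightarrow> 'b) \<Rightarrow> bool" where
  "is_antipode H m T \<longleftrightarrow> clinear T \<and>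
     m \<circ> tensor_map T id \<circ> comult H = unit_counit H \<and>
     m \<circ> tensor_map id T \<circ> comult H = unit_counit H"

definition hopf_algebra :: "'b::complex_vector bialg \<Rightarrow> ('b \<Rightarrow> 'b) \<Rightarrow> bool" where
  "hopf_algebra H S \<longleftrightarrow> bialgebra H \<and> is_antipode H (mult H) S"


section \<open>Convolution\<close>

definition conv ::
  "'b::complex_vector bialg \<Rightarrow> (('b, 'b) tensor \<Rightarrow> complex) \<Rightarrow> (('b, 'b) tensor \<Rightarrow> complex) \<Rightarrow>
     ('b, 'b) tensor \<Rightarrow> complex" where
  "conv H L L' = tensor_lift (\<lambda>x y. L x * L' y) \<circ> comult2 H"

definition mult_conv ::
  "'b::complex_vector bialg \<Rightarrow> (('b, 'b) tensor \<Rightarrow> complex) \<Rightarrow> ('b, 'b) tensor \<Rightarrow> 'b" where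
  "mult_conv H L = tensor_lift (\<lambda>x y. L y *\<^sub>C mult H x) \<circ> comult2 H"

fun conv_power ::
  "'b::complex_vector bialg \<Rightarrow> (('b, 'b) tensor \<Rightarrow> complex) \<Rightarrow> nat \<Rightarrow> ('b, 'b) tensor \<Rightarrow> complex" where
  "conv_power H L 0 = counit2 H"
| "conv_power H L (Suc n) = conv H L (conv_power H L n)"

text \<open>For linear \<open>L\<close> the series converges at every \<open>x\<close>, since \<open>x\<close> lies in a finite-dimensional
  subcoalgebra of \<open>\<B> \<otimes> \<B>\<close>.\<close>

definition conv_exp ::
  "'b::complex_vector bialg \<Rightarrow> real \<Rightarrow> (('b, 'b) tensor \<Rightarrow> complex) \<Rightarrow> ('b, 'b) tensor \<Rightarrow> complex" where
  "conv_exp H t L x = suminf (\<lambda>n. of_real t ^ n * conv_power H L n x / fact n)"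

definition coboundary ::
  "'b::complex_vector bialg \<Rightarrow> ('b \<Rightarrow> complex) \<Rightarrow> ('b, 'b) tensor \<Rightarrow> complex" where
  "coboundary H \<sigma> =
     tensor_lift (\<lambda>a b. counit H a * \<sigma> b - \<sigma> (mult H (a \<otimes> b)) + \<sigma> a * counit H b)"


section \<open>Additive deformations\<close>

text \<open>Families are indexed by all reals; being an additive deformation only constrains the
  members with \<open>t \<ge> 0\<close>.\<close>

definition additive_deformation ::
  "'b::complex_vector bialg \<Rightarrow> (real \<Rightarrow> ('b, 'b) tensor \<Rightarrow> 'b) \<Rightarrow> bool" where
  "additive_deformation H M \<longleftrightarrow>
     (\<forall>t\<ge>0. unital_algebra (M t) (unit_elt H)) \<and>
     M 0 = mult H \<and>
     (\<forall>t\<ge>0. \<forall>s\<ge>0. comult H \<circ> M (t + s) = tensor_map (M t) (M s) \<circ> comult2 H) \<and>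
     (\<forall>x. ((\<lambda>t. counit H (M t x)) \<longlongrightarrow> counit2 H x) (at_right 0))"

definition has_generator ::
  "'b::complex_vector bialg \<Rightarrow> (real \<Rightarrow> ('b, 'b) tensor \<Rightarrow> 'b) \<Rightarrow> (('b, 'b) tensor \<Rightarrow> complex) \<Rightarrow> bool" where
  "has_generator H M L \<longleftrightarrow>
     (\<forall>x. ((\<lambda>t. counit H (M t x)) has_vector_derivative L x) (at 0 within {0..}))"

text \<open>A Hopf deformation is an additive deformation, continued to all \<open>t \<in> \<real>\<close> by
  \<open>\<mu>\<^sub>t = \<mu> \<star> e\<^sub>\<star>\<^bsup>tL\<^esup>\<close> with \<open>L\<close> its generator, that has a deformed antipode for every \<open>t \<in> \<real>\<close>.\<close>

definition hopf_deformation ::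
  "'b::complex_vector bialg \<Rightarrow> (real \<Rightarrow> ('b, 'b) tensor \<Rightarrow> 'b) \<Rightarrow> bool" where
  "hopf_deformation H M \<longleftrightarrow>
     additive_deformation H M \<and>
     (\<exists>L. has_generator H M L \<and> (\<forall>t. M t = mult_conv H (conv_exp H t L))) \<and>
     (\<forall>t. \<exists>T. is_antipode H (M t) T)"

end

theory Submission
  imports Defs
begin

text \<open>Write \<open>F\<^sub>t = e\<^sub>\<star>\<^bsup>tL'\<^esup>\<close>, so that \<open>M'\<^sub>t = \<mu> \<star> F\<^sub>t\<close>. Two things have to be shown: that \<open>L'\<close> is again the
generator of an additive deformation, and that \<open>S\<close> is an antipode for every \<open>M'\<^sub>t\<close>.

Generators are characterised by Wirth's conditions: \<open>L\<close> is linear, commutes with \<open>\<mu>\<close> under convolution,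
vanishes at \<open>\<one> \<otimes> \<one>\<close>, and is a 2-cocycle. That a generator has these properties
(\<open>generator_of_deformation\<close>) follows by differentiating \<open>M\<^sub>t = (\<delta> \<circ> M\<^sub>t) \<star> \<mu> = \<mu> \<star> (\<delta> \<circ> M\<^sub>t)\<close> and the
associativity law of \<open>M\<^sub>t\<close> at \<open>t = 0\<close>. Conversely (\<open>deformation_of_generator\<close>) the exponential of such an \<open>L\<close>
exists pointwise and turns the additive cocycle identity into the multiplicative one
\<open>(F \<circ> (\<mu> \<otimes> id)) \<star> (F \<otimes> \<delta>) = (F \<circ> (id \<otimes> \<mu>)) \<star> (\<delta> \<otimes> F)\<close>, because precomposition with a coalgebra
homomorphism commutes with exponentials and the two summands on each side of the additive identity commute.
This identity is associativity of \<open>\<mu> \<star> F\<close> (\<open>mult_conv_exp_assoc\<close>), while \<open>F\<^bsub>t+s\<^esub> = F\<^sub>t \<star> F\<^sub>s\<close> gives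
compatibility with the comultiplication.

Now let \<open>\<sigma> a = L (a\<^sub>1 \<otimes> S a\<^sub>2)\<close>. Evaluating \<open>L \<star> \<mu> = \<mu> \<star> L\<close> at \<open>a\<^sub>1 \<otimes> S a\<^sub>2\<close> gives
\<open>\<sigma>(a) \<one> = a\<^sub>1 \<sigma>(a\<^sub>2) S(a\<^sub>3)\<close>, and multiplying by one more leg from the right shows that \<open>\<sigma>\<close> is central
(\<open>antipode_functional_central\<close>). Hence \<open>\<partial>\<sigma>\<close> commutes with \<open>\<mu>\<close>; it is a cocycle and \<open>\<sigma> \<one> = 0\<close>, so \<open>L'\<close>
satisfies Wirth's conditions. The cocycle identity at \<open>a\<^sub>1, S a\<^sub>2, a\<^sub>3\<close> gives
\<open>L (S a\<^sub>1 \<otimes> a\<^sub>2) = \<sigma> a\<close> (\<open>antipode_functional_left_right\<close>). On both \<open>a\<^sub>1 \<otimes> S a\<^sub>2\<close> and \<open>S a\<^sub>1 \<otimes> a\<^sub>2\<close> the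
coboundary takes the value \<open>\<sigma> a + \<sigma> (S a) = 2 \<sigma> a\<close>, so \<open>L'\<close> vanishes on both. Since \<open>S\<close> reverses the
comultiplication, each convolution power of \<open>L'\<close> on such an element contains a factor of the same
form, hence vanishes too; what remains of \<open>F\<^sub>t\<close> is the counit (\<open>exp_antipode\<close>), and the antipode identities of
\<open>\<mu>\<close> carry over to \<open>\<mu> \<star> F\<^sub>t\<close> (\<open>antipode_mult_conv\<close>).\<close>

section \<open>Sweedler sums\<close>

text \<open>A Sweedler sum \<open>\<Sum> T x\<^sub>1 x\<^sub>2\<close> over the comultiplication \<open>D x\<close> is written
  \<open>tensor_lift (\<lambda>a b. T a b) (D x)\<close>. Evaluating \<^const>\<open>tensor_lift\<close> at a fixed tensor is a finite sum
  over a chosen representative. It therefore commutes with linear maps, with sums and with other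
  Sweedler sums even when the summand is not bilinear; bilinearity only matters when the tensor itself
  is rewritten.\<close>

lemma clinear_apply_tensor_lift:
  assumes "clinear \<phi>"
  shows "\<phi> (tensor_lift f t) = tensor_lift (\<lambda>a b. \<phi> (f a b)) t"
  by (simp add: tensor_lift_def free_lift_def clinear_sum[OF assms] clinear_scaleC[OF assms])

lemma tensor_lift_swap:
  "tensor_lift (\<lambda>a b. tensor_lift (\<lambda>c d. f a b c d) u) t =
   tensor_lift (\<lambda>c d. tensor_lift (\<lambda>a b. f a b c d) t) u"
  unfolding tensor_lift_def free_lift_def complex_vector.scale_sum_right
  by (subst sum.swap) (simp add: scaleC_scaleC mult.commute)

lemma tensor_lift_plus:
  "tensor_lift (\<lambda>a b. f a b + g a b) t = tensor_lift f t + tensor_lift g t"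
  by (simp add: tensor_lift_def free_lift_def scaleC_add_right sum.distrib)

lemma tensor_lift_scaleC:
  "tensor_lift (\<lambda>a b. c *\<^sub>C f a b) t = c *\<^sub>C tensor_lift f t"
  by (simp add: tensor_lift_def free_lift_def complex_vector.scale_sum_right scaleC_scaleC mult.commute)

lemma tensor_lift_mult:
  fixes f :: "'a::complex_vector \<Rightarrow> 'b::complex_vector \<Rightarrow> complex"
  shows "tensor_lift (\<lambda>a b. c * f a b) t = c * tensor_lift f t"
    "tensor_lift (\<lambda>a b. f a b * c) t = tensor_lift f t * c"
  using tensor_lift_scaleC[of c f t] by (simp_all add: scaleC_complex_def mult.commute)

lemma tensor_lift_scaleC_left:
  "tensor_lift (\<lambda>a b. f a b *\<^sub>C v) t = tensor_lift f t *\<^sub>C v"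
  by (simp add: tensor_lift_def free_lift_def scaleC_complex_def complex_vector.scale_sum_left scaleC_scaleC)

lemma tensor_lift_sum:
  "tensor_lift (\<lambda>a b. \<Sum>i\<in>I. f i a b) t = (\<Sum>i\<in>I. tensor_lift (f i) t)"
  unfolding tensor_lift_def free_lift_def complex_vector.scale_sum_right by (rule sum.swap)

lemma cbilinearI:
  "(\<And>x. clinear (\<lambda>y. f x y)) \<Longrightarrow> (\<And>y. clinear (\<lambda>x. f x y)) \<Longrightarrow> cbilinear f"
  by (simp add: cbilinear_def)

lemma clinear_ident: "clinear (\<lambda>x. x)"
  by (simp add: clinear_iff)

lemma clinear_plus: "clinear f \<Longrightarrow> clinear g \<Longrightarrow> clinear (\<lambda>x. f x + g x)"
  by (simp add: clinear_iff scaleC_add_right)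

lemma clinear_minus: "clinear f \<Longrightarrow> clinear g \<Longrightarrow> clinear (\<lambda>x. f x - g x)"
  by (simp add: clinear_iff complex_vector.scale_right_diff_distrib)

lemma clinear_scale_right: "clinear f \<Longrightarrow> clinear (\<lambda>x. c *\<^sub>C f x)"
  by (simp add: clinear_iff scaleC_add_right scaleC_scaleC mult.commute)

lemma clinear_scale_left: "clinear f \<Longrightarrow> clinear (\<lambda>x. f x *\<^sub>C v)"
  by (simp add: clinear_iff scaleC_add_left scaleC_scaleC scaleC_complex_def)

lemma clinear_mult_right: "clinear f \<Longrightarrow> clinear (\<lambda>x. c * f x)" for f :: "_ \<Rightarrow> complex"
  by (simp add: clinear_iff scaleC_complex_def algebra_simps)

lemma clinear_mult_left: "clinear f \<Longrightarrow> clinear (\<lambda>x. f x * c)" for f :: "_ \<Rightarrow> complex"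
  by (simp add: clinear_iff scaleC_complex_def algebra_simps)

lemma clinear_pure_right: "clinear f \<Longrightarrow> clinear (\<lambda>x. v \<otimes> f x)"
  by (simp add: clinear_iff tensor_pure_simps)

lemma clinear_pure_left: "clinear f \<Longrightarrow> clinear (\<lambda>x. f x \<otimes> v)"
  by (simp add: clinear_iff tensor_pure_simps)

lemma clinear_lift_param:
  assumes "\<And>a b. clinear (\<lambda>x. f x a b)"
  shows "clinear (\<lambda>x. tensor_lift (f x) t)"
proof -
  have "f (x + y) = (\<lambda>a b. f x a b + f y a b)" "f (c *\<^sub>C x) = (\<lambda>a b. c *\<^sub>C f x a b)" for x y c
    using assms by (simp_all add: fun_eq_iff clinear_iff)
  then show ?thesis by (simp add: clinear_iff tensor_lift_plus tensor_lift_scaleC)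
qed

lemma clinear_lift_arg:
  "clinear g \<Longrightarrow> cbilinear f \<Longrightarrow> clinear (\<lambda>x. tensor_lift f (g x))"
  by (rule clinear_compose[OF clinear_tensor_lift])

lemma clinear_map: "clinear f \<Longrightarrow> clinear g \<Longrightarrow> clinear h \<Longrightarrow> clinear (\<lambda>x. tensor_map f g (h x))"
  by (rule clinear_compose[OF clinear_tensor_map])

text \<open>Introduction rules that break up linearity goals for expressions built from linear maps, scalar
  multiples, products, tensors and Sweedler sums.\<close>

lemmas clin = clinear_ident clinear_plus clinear_minus clinear_scale_right clinear_scale_left
  clinear_mult_right clinear_mult_left clinear_pure_right clinear_pure_left
  clinear_lift_param clinear_lift_arg clinear_map cbilinearI
  clinear_compose[OF clinear_tensor_assoc] clinear_compose[OF clinear_tensor_interchange]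

lemma clinear_as_tensor_lift: "clinear \<phi> \<Longrightarrow> \<phi> t = tensor_lift (\<lambda>a b. \<phi> (a \<otimes> b)) t"
  by (rule fun_cong[OF tensor_lift_unique]) (simp_all add: clinear_tensor_lift clin clinear_compose[of \<phi>])

lemma tensor_lift_tensor_map:
  assumes "cbilinear f" "clinear g" "clinear h"
  shows "tensor_lift f (tensor_map g h t) = tensor_lift (\<lambda>a b. f (g a) (h b)) t"
proof -
  have "clinear (\<lambda>t. tensor_lift f (tensor_map g h t))"
    by (intro clin assms)
  then show ?thesis by (subst clinear_as_tensor_lift) (simp_all add: assms)
qed

lemma coalgebra_linear:
  assumes "coalgebra D d" shows "clinear D" "clinear d"
  using assms by (simp_all add: coalgebra_def)

text \<open>Coassociativity in the form needed for calculations: a trilinear expression may be summed over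
  the legs of either iterated comultiplication. Lifting \<open>T\<close> to the threefold tensor product reduces this
  to the equation between tensors.\<close>

lemma coalgebra_coassoc:
  assumes co: "coalgebra D d"
    and T: "\<And>b c. clinear (\<lambda>a. T a b c)" "\<And>a c. clinear (\<lambda>b. T a b c)" "\<And>a b. clinear (\<lambda>c. T a b c)"
  shows "tensor_lift (\<lambda>p c. tensor_lift (\<lambda>a b. T a b c) (D p)) (D x) =
         tensor_lift (\<lambda>a q. tensor_lift (\<lambda>b c. T a b c) (D q)) (D x)"
proof -
  note D = coalgebra_linear(1)[OF co]
  note lin = clin clinear_compose[OF D] T
  define \<Phi> where "\<Phi> = tensor_lift (\<lambda>a q. tensor_lift (\<lambda>b c. T a b c) q)"
  have \<Phi>: "clinear \<Phi>" unfolding \<Phi>_def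
    by (rule clinear_tensor_lift) (intro lin)
  have l: "\<Phi> (tensor_assoc (z \<otimes> c)) = tensor_lift (\<lambda>a b. T a b c) z" for z c
  proof -
    have "clinear (\<lambda>z. \<Phi> (tensor_assoc (z \<otimes> c)))"
      by (intro lin clinear_compose[OF \<Phi>])
    then show ?thesis
    proof (subst clinear_as_tensor_lift[of "\<lambda>z. \<Phi> (tensor_assoc (z \<otimes> c))"], assumption)
      show "tensor_lift (\<lambda>a b. \<Phi> (tensor_assoc ((a \<otimes> b) \<otimes> c))) z = tensor_lift (\<lambda>a b. T a b c) z"
        unfolding tensor_assoc_pure \<Phi>_def
        by (subst tensor_lift_pure, intro lin, subst tensor_lift_pure, intro lin, rule refl)
    qed
  qed
  have "tensor_assoc (tensor_map D id (D x)) = tensor_map id D (D x)"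
    using co by (metis coalgebra_def comp_apply)
  then have "\<Phi> (tensor_assoc (tensor_map D id (D x))) = \<Phi> (tensor_map id D (D x))"
    by simp
  moreover have "\<Phi> (tensor_assoc (tensor_map D id (D x))) =
      tensor_lift (\<lambda>p c. tensor_lift (\<lambda>a b. T a b c) (D p)) (D x)"
  proof -
    have "clinear (\<lambda>t. \<Phi> (tensor_assoc (tensor_map D id t)))"
      by (intro lin D clinear_compose[OF \<Phi>] clin[unfolded id_def[symmetric]])
    from clinear_as_tensor_lift[OF this] show ?thesis
      by (simp add: D l complex_vector.linear_id)
  qed
  moreover have "\<Phi> (tensor_map id D (D x)) =
      tensor_lift (\<lambda>a q. tensor_lift (\<lambda>b c. T a b c) (D q)) (D x)"
    unfolding \<Phi>_def
    by (subst tensor_lift_tensor_map, intro lin) (simp_all add: D complex_vector.linear_id)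
  ultimately show ?thesis by simp
qed

lemma coalgebra_counit:
  assumes co: "coalgebra D d" and f: "clinear f"
  shows "tensor_lift (\<lambda>a b. d a *\<^sub>C f b) (D x) = f x" (is ?left)
    and "tensor_lift (\<lambda>a b. d b *\<^sub>C f a) (D x) = f x" (is ?right)
proof -
  have "tensor_lift (\<lambda>x y. d x *\<^sub>C y) (D x) = x" "tensor_lift (\<lambda>x y. d y *\<^sub>C x) (D x) = x"
    using co by (metis coalgebra_def comp_apply id_apply)+
  from this[THEN arg_cong[of _ _ f]] show ?left ?right
    by (simp_all add: clinear_apply_tensor_lift[OF f] clinear_scaleC[OF f])
qed

lemma coalgebra_counit_complex:
  fixes f :: "'c::complex_vector \<Rightarrow> complex"
  assumes "coalgebra D d" "clinear f"
  shows "tensor_lift (\<lambda>a b. d a * f b) (D x) = f x" "tensor_lift (\<lambda>a b. d b * f a) (D x) = f x"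
  using coalgebra_counit[OF assms] by (simp_all add: scaleC_complex_def)

section \<open>The tensor product of two coalgebras\<close>

definition tcomult ::
  "('a::complex_vector \<Rightarrow> ('a, 'a) tensor) \<Rightarrow> ('b::complex_vector \<Rightarrow> ('b, 'b) tensor) \<Rightarrow>
     ('a, 'b) tensor \<Rightarrow> (('a, 'b) tensor, ('a, 'b) tensor) tensor" where
  "tcomult D E = tensor_interchange \<circ> tensor_map D E"

definition tcounit :: "('a::complex_vector \<Rightarrow> complex) \<Rightarrow> ('b::complex_vector \<Rightarrow> complex) \<Rightarrow>
     ('a, 'b) tensor \<Rightarrow> complex" where
  "tcounit d e = tensor_lift (\<lambda>a b. d a * e b)"

lemma clinear_tcomult: "clinear D \<Longrightarrow> clinear E \<Longrightarrow> clinear (tcomult D E)"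
  unfolding tcomult_def comp_def by (intro clin)

lemma clinear_tcounit: "clinear d \<Longrightarrow> clinear e \<Longrightarrow> clinear (tcounit d e)"
  unfolding tcounit_def by (intro clinear_tensor_lift clin)

lemma tcounit_pure: "clinear d \<Longrightarrow> clinear e \<Longrightarrow> tcounit d e (a \<otimes> b) = d a * e b"
  unfolding tcounit_def by (subst tensor_lift_pure) (intro clin, auto)

text \<open>All computations on a tensor product of coalgebras reduce to its factors by this rule.\<close>

lemma tensor_lift_tcomult:
  assumes D: "clinear D" and E: "clinear E" and f: "cbilinear f"
  shows "tensor_lift f (tcomult D E (a \<otimes> b)) =
    tensor_lift (\<lambda>a1 a2. tensor_lift (\<lambda>b1 b2. f (a1 \<otimes> b1) (a2 \<otimes> b2)) (E b)) (D a)"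
proof -
  note f' = f[unfolded cbilinear_def, THEN conjunct1, rule_format] f[unfolded cbilinear_def, THEN conjunct2, rule_format]
  note lin = clin clinear_compose[OF f'(1)] clinear_compose[OF f'(2)]
  have 1: "clinear (\<lambda>u. tensor_lift f (tensor_interchange (u \<otimes> v)))" for v
    by (intro lin f)
  have 2: "clinear (\<lambda>v. tensor_lift f (tensor_interchange (u \<otimes> v)))" for u
    by (intro lin f)
  have "tensor_lift f (tensor_interchange (u \<otimes> v)) =
     tensor_lift (\<lambda>a1 a2. tensor_lift (\<lambda>b1 b2. f (a1 \<otimes> b1) (a2 \<otimes> b2)) v) u" for u v
    by (subst clinear_as_tensor_lift[OF 1], subst clinear_as_tensor_lift[OF 2]) (simp add: f)
  then show ?thesis by (simp add: tcomult_def D E)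
qed

lemma coalgebraI:
  assumes D: "clinear D" and d: "clinear d"
    and ca: "\<And>x. tensor_lift (\<lambda>p c. tensor_lift (\<lambda>a b. a \<otimes> (b \<otimes> c)) (D p)) (D x) =
         tensor_lift (\<lambda>a q. tensor_lift (\<lambda>b c. a \<otimes> (b \<otimes> c)) (D q)) (D x)"
    and cl: "\<And>x. tensor_lift (\<lambda>a b. d a *\<^sub>C b) (D x) = x"
    and cr: "\<And>x. tensor_lift (\<lambda>a b. d b *\<^sub>C a) (D x) = x"
  shows "coalgebra D (d :: 'a::complex_vector \<Rightarrow> complex)"
proof -
  note lin = clin D complex_vector.linear_id clinear_compose[OF D]
  have "tensor_assoc (tensor_map D id (D x)) = tensor_map id D (D x)" for x
  proof -
    have 1: "clinear (\<lambda>t. tensor_assoc (tensor_map D id t))" by (intro lin)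
    have "clinear (\<lambda>z :: ('a, 'a) tensor. tensor_assoc (z \<otimes> c))" for c :: 'a by (intro lin)
    from clinear_as_tensor_lift[OF this]
    have 2: "tensor_assoc (D p \<otimes> c) = tensor_lift (\<lambda>a b. a \<otimes> (b \<otimes> c)) (D p)" for p and c :: 'a by simp
    have "clinear (\<lambda>z :: ('a, 'a) tensor. a \<otimes> z)" for a :: 'a by (intro lin)
    from clinear_as_tensor_lift[OF this]
    have 3: "a \<otimes> D q = tensor_lift (\<lambda>b c. a \<otimes> (b \<otimes> c)) (D q)" for a :: 'a and q .
    have 4: "clinear (tensor_map id D)" by (intro clinear_tensor_map lin)
    show ?thesis
      using ca[of x] by (simp add: clinear_as_tensor_lift[OF 1, of "D x"]
          clinear_as_tensor_lift[OF 4, of "D x"] D complex_vector.linear_id 2 3)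
  qed
  then show ?thesis by (simp add: coalgebra_def D d fun_eq_iff cl cr)
qed

text \<open>Linearity reduces all three axioms to pure tensors. There both iterated comultiplications become
  fourfold sums, and coassociativity of the factors can be applied after exchanging the independent sums.\<close>

lemma coalgebra_tensor:
  assumes co: "coalgebra D d" "coalgebra E e"
  shows "coalgebra (tcomult D E) (tcounit d e)"
proof -
  note l = co[THEN coalgebra_linear(1)] co[THEN coalgebra_linear(2)]
  note L = clinear_tcomult[OF l(1,2)] clinear_tcounit[OF l(3,4)]
  note lin = clin clinear_compose[OF l(1)] clinear_compose[OF l(2)] clinear_compose[OF l(3)] clinear_compose[OF l(4)]
     L clinear_compose[OF L(1)] clinear_compose[OF L(2)]
  note tc = tensor_lift_tcomult[OF l(1,2)]
  show ?thesis
  proof (rule coalgebraI[OF L])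
    fix x :: "('a, 'b) tensor"
    have 1: "clinear (\<lambda>x. tensor_lift (\<lambda>p c. tensor_lift (\<lambda>a b. a \<otimes> b \<otimes> c) (tcomult D E p)) (tcomult D E x))"
     and 2: "clinear (\<lambda>x. tensor_lift (\<lambda>a q. tensor_lift (\<lambda>b c. a \<otimes> b \<otimes> c) (tcomult D E q)) (tcomult D E x))"
      by (intro lin)+
    show "tensor_lift (\<lambda>p c. tensor_lift (\<lambda>a b. a \<otimes> b \<otimes> c) (tcomult D E p)) (tcomult D E x) =
         tensor_lift (\<lambda>a q. tensor_lift (\<lambda>b c. a \<otimes> b \<otimes> c) (tcomult D E q)) (tcomult D E x)"
    proof (rule fun_cong[OF tensor_lift_unique[OF 1 2]])
      fix a b
      let ?T = "\<lambda>a1 a2 a3 b1 b2 b3. (a1 \<otimes> b1) \<otimes> (a2 \<otimes> b2) \<otimes> (a3 \<otimes> b3)"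
      have e1: "tensor_lift (\<lambda>q b3. tensor_lift (\<lambda>b1 b2. ?T a1 a2 a3 b1 b2 b3) (E q)) (E b) =
          tensor_lift (\<lambda>b1 q. tensor_lift (\<lambda>b2 b3. ?T a1 a2 a3 b1 b2 b3) (E q)) (E b)" for a1 a2 a3 :: 'a
        by (rule coalgebra_coassoc[OF co(2)]; intro lin)
      have "tensor_lift (\<lambda>p c. tensor_lift (\<lambda>a b. a \<otimes> b \<otimes> c) (tcomult D E p)) (tcomult D E (a \<otimes> b)) =
         tensor_lift (\<lambda>p a3. tensor_lift (\<lambda>q b3. tensor_lift (\<lambda>a1 a2. tensor_lift (\<lambda>b1 b2.
            ?T a1 a2 a3 b1 b2 b3) (E q)) (D p)) (E b)) (D a)"
        by (subst tc, intro lin, subst tc, intro lin, rule refl)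
      also have "\<dots> = tensor_lift (\<lambda>p a3. tensor_lift (\<lambda>a1 a2. tensor_lift (\<lambda>q b3. tensor_lift (\<lambda>b1 b2.
            ?T a1 a2 a3 b1 b2 b3) (E q)) (E b)) (D p)) (D a)"
        by (subst (2) tensor_lift_swap) (rule refl)
      also have "\<dots> = tensor_lift (\<lambda>p a3. tensor_lift (\<lambda>a1 a2. tensor_lift (\<lambda>b1 q. tensor_lift (\<lambda>b2 b3.
            ?T a1 a2 a3 b1 b2 b3) (E q)) (E b)) (D p)) (D a)"
        by (simp only: e1)
      also have "\<dots> = tensor_lift (\<lambda>a1 p. tensor_lift (\<lambda>a2 a3. tensor_lift (\<lambda>b1 q. tensor_lift (\<lambda>b2 b3.
            ?T a1 a2 a3 b1 b2 b3) (E q)) (E b)) (D p)) (D a)"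
        by (rule coalgebra_coassoc[OF co(1)]; intro lin)
      also have "\<dots> = tensor_lift (\<lambda>a1 p. tensor_lift (\<lambda>b1 q. tensor_lift (\<lambda>a2 a3. tensor_lift (\<lambda>b2 b3.
            ?T a1 a2 a3 b1 b2 b3) (E q)) (D p)) (E b)) (D a)"
        by (subst (2) tensor_lift_swap) (rule refl)
      also have "\<dots> = tensor_lift (\<lambda>a q. tensor_lift (\<lambda>b c. a \<otimes> b \<otimes> c) (tcomult D E q)) (tcomult D E (a \<otimes> b))"
        by (subst tc, intro lin, subst tc, intro lin, rule refl)
      finally show "tensor_lift (\<lambda>p c. tensor_lift (\<lambda>a b. a \<otimes> b \<otimes> c) (tcomult D E p)) (tcomult D E (a \<otimes> b)) =
         tensor_lift (\<lambda>a q. tensor_lift (\<lambda>b c. a \<otimes> b \<otimes> c) (tcomult D E q)) (tcomult D E (a \<otimes> b))" .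
    qed
    have 3: "clinear (\<lambda>x. tensor_lift (\<lambda>a b. tcounit d e a *\<^sub>C b) (tcomult D E x))"
     and 4: "clinear (\<lambda>x. tensor_lift (\<lambda>a b. tcounit d e b *\<^sub>C a) (tcomult D E x))"
      by (intro lin)+
    show "tensor_lift (\<lambda>a b. tcounit d e a *\<^sub>C b) (tcomult D E x) = x"
    proof (rule fun_cong[OF tensor_lift_unique[OF 3 clinear_ident]])
      fix a b
      have c1: "tensor_lift (\<lambda>b1 b2. e b1 *\<^sub>C (a2 \<otimes> b2)) (E b) = a2 \<otimes> b" for a2 :: 'a
        by (rule coalgebra_counit(1)[OF co(2)]; intro lin)
      have "tensor_lift (\<lambda>a b. tcounit d e a *\<^sub>C b) (tcomult D E (a \<otimes> b)) =
         tensor_lift (\<lambda>a1 a2. d a1 *\<^sub>C tensor_lift (\<lambda>b1 b2. e b1 *\<^sub>C (a2 \<otimes> b2)) (E b)) (D a)"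
        by (subst tc, intro lin) (simp only: tcounit_pure[OF l(3,4)] scaleC_scaleC[symmetric] tensor_lift_scaleC)
      also have "\<dots> = a \<otimes> b"
        unfolding c1
        by (rule coalgebra_counit(1)[OF co(1)]; intro lin)
      finally show "tensor_lift (\<lambda>a b. tcounit d e a *\<^sub>C b) (tcomult D E (a \<otimes> b)) = a \<otimes> b" .
    qed
    show "tensor_lift (\<lambda>a b. tcounit d e b *\<^sub>C a) (tcomult D E x) = x"
    proof (rule fun_cong[OF tensor_lift_unique[OF 4 clinear_ident]])
      fix a b
      have c2: "tensor_lift (\<lambda>b1 b2. e b2 *\<^sub>C (a1 \<otimes> b1)) (E b) = a1 \<otimes> b" for a1 :: 'a
        by (rule coalgebra_counit(2)[OF co(2)]; intro lin)
      have "tensor_lift (\<lambda>a b. tcounit d e b *\<^sub>C a) (tcomult D E (a \<otimes> b)) =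
         tensor_lift (\<lambda>a1 a2. d a2 *\<^sub>C tensor_lift (\<lambda>b1 b2. e b2 *\<^sub>C (a1 \<otimes> b1)) (E b)) (D a)"
        by (subst tc, intro lin) (simp only: tcounit_pure[OF l(3,4)] scaleC_scaleC[symmetric] tensor_lift_scaleC)
      also have "\<dots> = a \<otimes> b"
        unfolding c2
        by (rule coalgebra_counit(2)[OF co(1)]; intro lin)
      finally show "tensor_lift (\<lambda>a b. tcounit d e b *\<^sub>C a) (tcomult D E (a \<otimes> b)) = a \<otimes> b" .
    qed
  qed
qed

section \<open>The convolution algebra of a coalgebra\<close>

definition convol ::
  "('c::complex_vector \<Rightarrow> ('c, 'c) tensor) \<Rightarrow> ('c \<Rightarrow> complex) \<Rightarrow> ('c \<Rightarrow> complex) \<Rightarrow> 'c \<Rightarrow> complex" where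
  "convol D f g = (\<lambda>x. tensor_lift (\<lambda>a b. f a * g b) (D x))"

primrec convol_power ::
  "('c::complex_vector \<Rightarrow> ('c, 'c) tensor) \<Rightarrow> ('c \<Rightarrow> complex) \<Rightarrow> ('c \<Rightarrow> complex) \<Rightarrow> nat \<Rightarrow> 'c \<Rightarrow> complex" where
  "convol_power D d A 0 = d"
| "convol_power D d A (Suc n) = convol D A (convol_power D d A n)"

definition convol_exp ::
  "('c::complex_vector \<Rightarrow> ('c, 'c) tensor) \<Rightarrow> ('c \<Rightarrow> complex) \<Rightarrow> ('c \<Rightarrow> complex) \<Rightarrow> 'c \<Rightarrow> complex" where
  "convol_exp D d A x = suminf (\<lambda>n. convol_power D d A n x / fact n)"

lemma tensor_lift_sums:
  fixes f :: "nat \<Rightarrow> 'a::complex_vector \<Rightarrow> 'b::complex_vector \<Rightarrow> complex"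
  assumes "\<And>a b. (\<lambda>n. f n a b) sums g a b"
  shows "(\<lambda>n. tensor_lift (f n) t) sums tensor_lift g t"
  unfolding tensor_lift_def free_lift_def scaleC_complex_def
  by (intro sums_sum sums_mult assms)

lemma in_span_image_lessThan:
  assumes "y \<in> complex_vector.span (v ` {..<m::nat})"
  shows "\<exists>c. y = (\<Sum>k<m. c k *\<^sub>C v k)"
  using assms
proof (induction m arbitrary: y)
  case (Suc m)
  then obtain k where "y - k *\<^sub>C v m \<in> complex_vector.span (v ` {..<m})"
    by (auto simp: lessThan_Suc complex_vector.span_insert)
  with Suc.IH obtain c where c: "y - k *\<^sub>C v m = (\<Sum>k<m. c k *\<^sub>C v k)" by blast
  then have "y = (\<Sum>j<Suc m. (c(m := k)) j *\<^sub>C v j)"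
    by (simp add: algebra_simps)
  then show ?case by blast
qed simp

text \<open>Otherwise each \<open>v m\<close> would be linearly independent of its predecessors, and more of them than
  there are elements of \<open>P\<close> would be independent inside the span of \<open>P\<close>.\<close>

lemma sequence_dependent_if_in_finite_span:
  fixes v :: "nat \<Rightarrow> 'a::complex_vector"
  assumes "finite P" "\<And>n. v n \<in> complex_vector.span P"
  shows "\<exists>m c. v m = (\<Sum>k<m. c k *\<^sub>C v k)"
proof (rule ccontr)
  assume contr: "\<not> ?thesis"
  have new: "v m \<notin> complex_vector.span (v ` {..<m})" for m
    using contr in_span_image_lessThan by blast
  have "complex_vector.independent (v ` {..<m}) \<and> card (v ` {..<m}) = m" for m
  proof (induction m)
    case (Suc m)
    have "v m \<notin> v ` {..<m}" using new[of m] complex_vector.span_base[of "v m"] by metis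
    moreover have "complex_vector.independent (insert (v m) (v ` {..<m}))"
      using complex_vector.independent_insertI[OF new] Suc.IH by metis
    ultimately show ?case
      using Suc.IH by (simp add: lessThan_Suc)
  qed (simp add: complex_vector.independent_empty)
  from this[of "Suc (card P)"] show False
    using complex_vector.independent_span_bound[OF assms(1), of "v ` {..<Suc (card P)}"] assms(2) by auto
qed

text \<open>With \<open>C = 1 + \<Sum> |c\<^sub>k|\<close> each step of the recurrence enlarges the bound by at most the factor \<open>C\<close>;
  the first \<open>m\<close> values are absorbed into \<open>K\<close>.\<close>

lemma linear_recurrence_exponential_bound:
  fixes u :: "nat \<Rightarrow> complex"
  assumes rec: "\<And>n. u (n + m) = (\<Sum>k<m. c k * u (n + k))"
  shows "\<exists>K C. \<forall>n. norm (u n) \<le> K * C ^ n"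
proof -
  define C where "C = 1 + (\<Sum>k<m. norm (c k))"
  define K where "K = (\<Sum>k<m. norm (u k))"
  have C: "1 \<le> C" by (simp add: C_def sum_nonneg)
  have K: "0 \<le> K" by (simp add: K_def sum_nonneg)
  have "norm (u n) \<le> K * C ^ n" for n
  proof (induction n rule: less_induct)
    case (less n)
    show ?case
    proof (cases "n < m")
      case True
      then have "norm (u n) \<le> K * 1" unfolding K_def mult_1_right by (intro member_le_sum) auto
      also have "\<dots> \<le> K * C ^ n" using C K by (intro mult_left_mono) auto
      finally show ?thesis .
    next
      case False
      show ?thesis
      proof (cases "m = 0")
        case True
        then show ?thesis using rec[of n] K C by simp
      next
        case m: False
        define j where "j = n - m"
        have n: "n = j + m" using False by (simp add: j_def)
        have bd: "norm (u (j + k)) \<le> K * C ^ (n - 1)" if "k < m" for k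
        proof -
          have "norm (u (j + k)) \<le> K * C ^ (j + k)" using less[of "j + k"] that n by simp
          also have "\<dots> \<le> K * C ^ (n - 1)" using C K that n by (intro mult_left_mono power_increasing) auto
          finally show ?thesis .
        qed
        have "norm (u n) \<le> (\<Sum>k<m. norm (c k) * (K * C ^ (n - 1)))"
          unfolding n rec
          by (rule sum_norm_le) (use bd n in \<open>simp add: norm_mult mult_left_mono\<close>)
        also have "\<dots> \<le> C * (K * C ^ (n - 1))"
          unfolding sum_distrib_right[symmetric] using C K by (intro mult_right_mono) (auto simp: C_def)
        also have "\<dots> = K * C ^ n"
          using power_Suc[of C "n - 1"] m n by simp
        finally show ?thesis .
      qed
    qed
  qed
  then show ?thesis by blast
qed

locale coalg =
  fixes D :: "'c::complex_vector \<Rightarrow> ('c, 'c) tensor" and d :: "'c \<Rightarrow> complex"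
  assumes coalgebra: "coalgebra D d"
begin

lemmas linear_comult = coalgebra_linear(1)[OF coalgebra]
lemmas linear_counit = coalgebra_linear(2)[OF coalgebra]
lemmas coassoc = coalgebra_coassoc[OF coalgebra]
lemmas counit = coalgebra_counit[OF coalgebra]
lemmas counit_complex = coalgebra_counit_complex[OF coalgebra]

lemmas lin = clin linear_comult linear_counit
  clinear_compose[OF linear_comult] clinear_compose[OF linear_counit]

abbreviation cv (infixl "\<star>" 70) where "f \<star> g \<equiv> convol D f g"
abbreviation pw where "pw \<equiv> convol_power D d"
abbreviation ex where "ex \<equiv> convol_exp D d"

lemma convol_linear:
  assumes "clinear f" "clinear g"
  shows "clinear (f \<star> g)"
  unfolding convol_def by (intro lin assms)

lemma convol_assoc:
  assumes "clinear f" "clinear g" "clinear h"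
  shows "(f \<star> g) \<star> h = f \<star> (g \<star> h)"
proof
  fix x
  note lin = lin assms clinear_compose[OF assms(1)] clinear_compose[OF assms(2)] clinear_compose[OF assms(3)]
  have "((f \<star> g) \<star> h) x = tensor_lift (\<lambda>p c. tensor_lift (\<lambda>a b. f a * g b * h c) (D p)) (D x)"
    by (simp add: convol_def tensor_lift_mult)
  also have "\<dots> = tensor_lift (\<lambda>a q. tensor_lift (\<lambda>b c. f a * g b * h c) (D q)) (D x)"
    by (rule coassoc; intro lin)
  also have "\<dots> = (f \<star> (g \<star> h)) x"
    by (simp add: convol_def tensor_lift_mult mult.assoc)
  finally show "((f \<star> g) \<star> h) x = (f \<star> (g \<star> h)) x" .
qed

lemma convol_counit:
  assumes "clinear f" shows "d \<star> f = f" "f \<star> d = f"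
  using counit_complex[OF assms] by (simp_all add: convol_def fun_eq_iff mult.commute)

lemma convol_add:
  "(\<lambda>x. f x + g x) \<star> h = (\<lambda>x. (f \<star> h) x + (g \<star> h) x)"
  "h \<star> (\<lambda>x. f x + g x) = (\<lambda>x. (h \<star> f) x + (h \<star> g) x)"
  by (simp_all add: convol_def fun_eq_iff distrib_left distrib_right tensor_lift_plus)

lemma convol_scale:
  "(\<lambda>x. c * f x) \<star> h = (\<lambda>x. c * (f \<star> h) x)"
  "h \<star> (\<lambda>x. c * f x) = (\<lambda>x. c * (h \<star> f) x)"
  by (simp_all add: convol_def fun_eq_iff tensor_lift_mult(1)[symmetric] mult_ac)

lemma convol_sum:
  "h \<star> (\<lambda>x. \<Sum>i\<in>I. f i x) = (\<lambda>x. \<Sum>i\<in>I. (h \<star> f i) x)"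
  by (simp add: convol_def fun_eq_iff sum_distrib_left tensor_lift_sum)

lemma convol_power_linear: "clinear A \<Longrightarrow> clinear (pw A n)"
  by (induction n) (simp_all add: linear_counit convol_linear)

lemma convol_power_commute:
  assumes A: "clinear A" and B: "clinear B" and AB: "A \<star> B = B \<star> A"
  shows "pw A n \<star> B = B \<star> pw A n"
proof (induction n)
  case 0
  then show ?case by (simp add: convol_counit B)
next
  case (Suc n)
  then show ?case
    by (metis convol_assoc convol_power.simps(2) A B AB convol_power_linear)
qed

lemma convol_power_scale: "pw (\<lambda>x. c * A x) n x = c ^ n * pw A n x"
proof (induction n arbitrary: x)
  case (Suc n)
  then have "pw (\<lambda>x. c * A x) n = (\<lambda>x. c ^ n * pw A n x)" by blast
  then show ?case by (simp add: convol_scale mult_ac)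
qed simp

text \<open>The elements \<open>v\<^sub>n = x\<^sub>1 A\<^bsup>\<star>n\<^esup>(x\<^sub>2)\<close> are the iterates of the linear map \<open>R y = y\<^sub>1 A(y\<^sub>2)\<close> at
  \<open>x\<close>. All of them lie in the span of the finitely many left legs of one representative of \<open>D x\<close>, so they
  satisfy a linear recurrence, and so do their counits \<open>A\<^bsup>\<star>n\<^esup>(x)\<close>. This replaces the theorem that every
  element lies in a finite-dimensional subcoalgebra.\<close>

lemma convol_power_bound:
  assumes A: "clinear A"
  shows "\<exists>K C. \<forall>n. norm (pw A n x) \<le> K * C ^ n"
proof -
  define R where "R y = tensor_lift (\<lambda>a b. A b *\<^sub>C a) (D y)" for y
  define v where "v n = tensor_lift (\<lambda>a b. pw A n b *\<^sub>C a) (D x)" for n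
  note lin = lin A clinear_compose[OF A] convol_power_linear[OF A] clinear_compose[OF convol_power_linear[OF A]]
  have R: "clinear R" unfolding R_def by (intro lin)
  have Rv: "R (v n) = v (Suc n)" for n
  proof -
    have "R (v n) = tensor_lift (\<lambda>p c. tensor_lift (\<lambda>a b. pw A n c *\<^sub>C A b *\<^sub>C a) (D p)) (D x)"
      unfolding v_def clinear_apply_tensor_lift[OF R] clinear_scaleC[OF R]
      unfolding R_def tensor_lift_scaleC by (rule refl)
    also have "\<dots> = tensor_lift (\<lambda>a q. tensor_lift (\<lambda>b c. pw A n c *\<^sub>C A b *\<^sub>C a) (D q)) (D x)"
      by (rule coassoc; intro lin)
    also have "\<dots> = v (Suc n)"
      by (simp add: v_def convol_def scaleC_scaleC tensor_lift_scaleC_left mult.commute)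
    finally show ?thesis .
  qed
  have dv: "d (v n) = pw A n x" for n
  proof -
    have "d (v n) = tensor_lift (\<lambda>a b. d a * pw A n b) (D x)"
      unfolding v_def
      by (simp add: clinear_apply_tensor_lift[OF linear_counit] clinear_scaleC[OF linear_counit]
        scaleC_complex_def mult.commute)
    then show ?thesis using counit_complex(1)[OF convol_power_linear[OF A]] by simp
  qed
  define P where "P = fst ` Poly_Mapping.keys (rep_tensor (D x))"
  have "v n \<in> complex_vector.span P" for n
    unfolding v_def tensor_lift_def free_lift_def P_def
    by (intro complex_vector.span_sum complex_vector.span_scale complex_vector.span_base) auto
  then obtain m c where mc: "v m = (\<Sum>k<m. c k *\<^sub>C v k)"
    using sequence_dependent_if_in_finite_span[of P v] by (auto simp: P_def)
  have "v (n + m) = (\<Sum>k<m. c k *\<^sub>C v (n + k))" for n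
  proof (induction n)
    case (Suc n)
    have "v (Suc n + m) = R (v (n + m))" by (simp add: Rv)
    also have "\<dots> = (\<Sum>k<m. c k *\<^sub>C v (Suc n + k))"
      unfolding Suc by (simp add: clinear_sum[OF R] clinear_scaleC[OF R] Rv)
    finally show ?case .
  qed (simp add: mc)
  then have "d (v (n + m)) = (\<Sum>k<m. c k * d (v (n + k)))" for n
    by (simp add: clinear_sum[OF linear_counit] clinear_scaleC[OF linear_counit] scaleC_complex_def)
  then show ?thesis unfolding dv by (rule linear_recurrence_exponential_bound)
qed

lemma convol_exp_abs_summable:
  assumes A: "clinear A"
  shows "summable (\<lambda>n. norm (pw A n x / fact n))"
proof -
  obtain K C where KC: "\<And>n. norm (pw A n x) \<le> K * C ^ n"
    using convol_power_bound[OF A, of x] by blast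
  show ?thesis
  proof (rule summable_comparison_test')
    show "summable (\<lambda>n. K * (inverse (fact n) * C ^ n))"
      by (intro summable_mult summable_exp)
    fix n
    have "norm (norm (pw A n x / fact n)) = norm (pw A n x) / fact n" by (simp add: norm_divide)
    also have "\<dots> \<le> K * C ^ n / fact n" by (intro divide_right_mono KC) simp
    finally show "norm (norm (pw A n x / fact n)) \<le> K * (inverse (fact n) * C ^ n)"
      by (simp add: divide_inverse mult_ac)
  qed
qed

lemma convol_exp_sums: "clinear A \<Longrightarrow> (\<lambda>n. pw A n x / fact n) sums ex A x"
  unfolding convol_exp_def by (rule summable_sums, rule summable_norm_cancel, rule convol_exp_abs_summable)

lemma convol_exp_linear:
  assumes "clinear A" shows "clinear (ex A)"
  unfolding clinear_iff
proof (intro conjI allI)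
  note s = convol_exp_sums[OF assms] and l = convol_power_linear[OF assms]
  fix x y c
  have "(\<lambda>n. pw A n (x + y) / fact n) = (\<lambda>n. pw A n x / fact n + pw A n y / fact n)"
    by (simp only: clinear_add[OF l] add_divide_distrib)
  then show "ex A (x + y) = ex A x + ex A y"
    using sums_unique2[OF s[of "x + y"]] sums_add[OF s s, of x y] by simp
  have "(\<lambda>n. pw A n (c *\<^sub>C x) / fact n) = (\<lambda>n. c * (pw A n x / fact n))"
    by (simp only: clinear_scaleC[OF l] scaleC_complex_def times_divide_eq_right)
  then show "ex A (c *\<^sub>C x) = c *\<^sub>C ex A x"
    using sums_unique2[OF s[of "c *\<^sub>C x"]] sums_mult[OF s, of c x] by (simp add: scaleC_complex_def)
qed

text \<open>Only finitely many pairs of legs of \<open>x\<close> occur, so convolving with \<open>B\<close> commutes with the series.\<close>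

lemma convol_exp_commute:
  assumes A: "clinear A" and B: "clinear B" and AB: "A \<star> B = B \<star> A"
  shows "ex A \<star> B = B \<star> ex A"
proof
  fix x
  note s = convol_exp_sums[OF A]
  have "(\<lambda>n. ((\<lambda>x. 1 / fact n * pw A n x) \<star> B) x) sums (ex A \<star> B) x"
    using tensor_lift_sums[of "\<lambda>n a b. pw A n a / fact n * B b" "\<lambda>a b. ex A a * B b", OF sums_mult2[OF s]]
    by (simp add: convol_def)
  moreover have "(\<lambda>n. (B \<star> (\<lambda>x. 1 / fact n * pw A n x)) x) sums (B \<star> ex A) x"
    using tensor_lift_sums[of "\<lambda>n a b. B a * (pw A n b / fact n)" "\<lambda>a b. B a * ex A b", OF sums_mult[OF s]]
    by (simp add: convol_def)
  moreover have "(\<lambda>x. 1 / fact n * pw A n x) \<star> B = B \<star> (\<lambda>x. 1 / fact n * pw A n x)" for n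
    by (simp only: convol_scale convol_power_commute[OF A B AB])
  ultimately show "(ex A \<star> B) x = (B \<star> ex A) x"
    by (simp only: sums_iff)
qed

text \<open>The binomial theorem with divided powers, as for commuting elements of a Banach algebra:
  \<open>n + 1\<close> times the claim for \<open>n + 1\<close> is the claim for \<open>n\<close> convolved with \<open>A + B\<close>.\<close>

lemma convol_power_add_commuting:
  assumes A: "clinear A" and B: "clinear B" and AB: "A \<star> B = B \<star> A"
  defines "P \<equiv> \<lambda>A n x. pw A n x / fact n"
  shows "P (\<lambda>x. A x + B x) n = (\<lambda>x. \<Sum>i\<le>n. (P A i \<star> P B (n - i)) x)"
proof (induction n)
  case 0
  show ?case by (simp add: P_def convol_counit linear_counit)
next
  case (Suc n)
  have P: "P A n = (\<lambda>x. 1 / fact n * pw A n x)" for A n by (simp add: P_def)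
  have Plin: "clinear (P A n)" if "clinear A" for A n
    unfolding P by (intro lin convol_power_linear that)
  have PS: "A \<star> P A n = (\<lambda>x. of_nat (Suc n) * P A (Suc n) x)" for A n
  proof -
    have "1 / fact n * y = of_nat (Suc n) * (1 / fact (Suc n) * y)" for y :: complex
      by (simp del: of_nat_Suc)
    then show ?thesis by (simp only: P convol_scale convol_power.simps)
  qed
  have comm: "P A n \<star> B = B \<star> P A n" for n
    by (simp only: P convol_scale convol_power_commute[OF A B AB])
  let ?S = "\<lambda>x. A x + B x"
  have S: "clinear ?S" by (intro lin A B)
  show ?case
  proof
    fix x
    have "of_nat (Suc n) * P ?S (Suc n) x = (?S \<star> P ?S n) x"
      by (simp only: PS)
    also have "\<dots> = (\<Sum>i\<le>n. (A \<star> (P A i \<star> P B (n - i))) x) + (\<Sum>i\<le>n. (B \<star> (P A i \<star> P B (n - i))) x)"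
      unfolding Suc by (simp add: convol_add convol_sum)
    also have "(\<Sum>i\<le>n. (A \<star> (P A i \<star> P B (n - i))) x) =
        (\<Sum>i\<le>n. of_nat (Suc i) * (P A (Suc i) \<star> P B (n - i)) x)"
      by (simp add: convol_assoc[symmetric] A Plin B PS convol_scale del: of_nat_Suc)
    also have "\<dots> = (\<Sum>i\<le>Suc n. of_nat i * (P A i \<star> P B (Suc n - i)) x)"
      by (subst sum.atMost_Suc_shift) simp
    also have "(\<Sum>i\<le>n. (B \<star> (P A i \<star> P B (n - i))) x) =
        (\<Sum>i\<le>n. of_nat (Suc n - i) * (P A i \<star> P B (Suc n - i)) x)"
    proof (rule sum.cong[OF refl])
      fix i assume "i \<in> {..n}"
      then have i: "Suc n - i = Suc (n - i)" by auto
      have "B \<star> (P A i \<star> P B (n - i)) = P A i \<star> (B \<star> P B (n - i))"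
        by (simp add: convol_assoc[symmetric] A B Plin comm)
      then show "(B \<star> (P A i \<star> P B (n - i))) x = of_nat (Suc n - i) * (P A i \<star> P B (Suc n - i)) x"
        by (simp add: PS convol_scale i del: of_nat_Suc)
    qed
    also have "\<dots> = (\<Sum>i\<le>Suc n. of_nat (Suc n - i) * (P A i \<star> P B (Suc n - i)) x)"
      by simp
    also have "(\<Sum>i\<le>Suc n. of_nat i * (P A i \<star> P B (Suc n - i)) x) + \<dots> =
        (\<Sum>i\<le>Suc n. of_nat (Suc n) * (P A i \<star> P B (Suc n - i)) x)"
      unfolding sum.distrib[symmetric]
      by (rule sum.cong[OF refl]) (simp flip: distrib_right of_nat_add)
    also have "\<dots> = of_nat (Suc n) * (\<Sum>i\<le>Suc n. (P A i \<star> P B (Suc n - i)) x)"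
      by (simp only: sum_distrib_left)
    finally show "P ?S (Suc n) x = (\<Sum>i\<le>Suc n. (P A i \<star> P B (Suc n - i)) x)"
      by (simp only: mult_cancel_left of_nat_eq_0_iff nat.simps simp_thms)
  qed
qed

lemma convol_exp_add_commuting:
  assumes A: "clinear A" and B: "clinear B" and AB: "A \<star> B = B \<star> A"
  shows "ex (\<lambda>x. A x + B x) = ex A \<star> ex B"
proof
  fix x
  have S: "clinear (\<lambda>x. A x + B x)" by (intro lin A B)
  have "(\<lambda>n. \<Sum>i\<le>n. (pw A i a / fact i) * (pw B (n - i) b / fact (n - i))) sums (ex A a * ex B b)" for a b
    unfolding convol_exp_def by (intro Cauchy_product_sums convol_exp_abs_summable A B)
  from tensor_lift_sums[OF this, where t = "D x"]
  have "(\<lambda>n. pw (\<lambda>x. A x + B x) n x / fact n) sums (ex A \<star> ex B) x"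
    using convol_power_add_commuting[OF A B AB, THEN fun_cong, of _ x]
    by (simp add: convol_def tensor_lift_sum)
  with convol_exp_sums[OF S] show "ex (\<lambda>x. A x + B x) x = (ex A \<star> ex B) x"
    by (rule sums_unique2)
qed

lemma convol_exp_zero: "ex (\<lambda>x. 0) = d"
proof
  fix x
  have "(\<lambda>x. 0) \<star> h = (\<lambda>x. 0)" for h
    using convol_scale(1)[of 0 "\<lambda>x. 0" h] by simp
  then have "pw (\<lambda>x. 0) n x / fact n = (if n = 0 then d x else 0)" for n
    by (cases n) simp_all
  then have "(\<lambda>n. pw (\<lambda>x. 0) n x / fact n) sums d x"
    using sums_single[of 0 "\<lambda>n. d x"] by simp
  then show "ex (\<lambda>x. 0) x = d x" by (simp add: convol_exp_def sums_iff)
qed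

lemma convol_exp_derivative:
  assumes A: "clinear A"
  shows "((\<lambda>t. ex (\<lambda>x. of_real t * A x) x) has_vector_derivative A x) (at 0)"
proof -
  let ?c = "\<lambda>n. pw A n x / fact n"
  have *: "summable (\<lambda>n. ?c n * z ^ n)" for z
  proof -
    have "clinear (\<lambda>x. z * A x)" by (intro lin A)
    from convol_exp_sums[OF this, of x] show ?thesis
      by (simp add: convol_power_scale sums_iff mult_ac)
  qed
  have "((\<lambda>z. suminf (\<lambda>n. ?c n * z ^ n)) has_field_derivative suminf (\<lambda>n. diffs ?c n * 0 ^ n)) (at 0)"
    by (rule termdiffs_strong_converges_everywhere) (rule *)
  moreover have "suminf (\<lambda>n. diffs ?c n * 0 ^ n) = A x"
    by (subst suminf_finite[of "{0}"]) (auto simp: diffs_def convol_counit A)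
  ultimately have "((\<lambda>z. suminf (\<lambda>n. ?c n * z ^ n)) has_field_derivative A x) (at (of_real 0))" by simp
  moreover have "ex (\<lambda>x. z * A x) x = suminf (\<lambda>n. ?c n * z ^ n)" for z
    unfolding convol_exp_def convol_power_scale by (simp add: mult_ac)
  ultimately show ?thesis
    using has_vector_derivative_real_field by (simp only:)
qed

end


section \<open>Coalgebra homomorphisms\<close>

definition coalgebra_hom ::
  "('a::complex_vector \<Rightarrow> ('a, 'a) tensor) \<Rightarrow> ('a \<Rightarrow> complex) \<Rightarrow>
   ('b::complex_vector \<Rightarrow> ('b, 'b) tensor) \<Rightarrow> ('b \<Rightarrow> complex) \<Rightarrow> ('a \<Rightarrow> 'b) \<Rightarrow> bool" where
  "coalgebra_hom D d D' d' \<phi> \<longleftrightarrow>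
     clinear \<phi> \<and> (\<forall>x. D' (\<phi> x) = tensor_map \<phi> \<phi> (D x)) \<and> (\<forall>x. d' (\<phi> x) = d x)"

lemma tensor_lift_hom:
  assumes "coalgebra_hom D d D' d' \<phi>" "cbilinear f"
  shows "tensor_lift f (D' (\<phi> x)) = tensor_lift (\<lambda>a b. f (\<phi> a) (\<phi> b)) (D x)"
  using assms by (simp add: coalgebra_hom_def tensor_lift_tensor_map)

lemma clinear_id: "clinear id"
  by (rule complex_vector.linear_id)

lemma coalgebra_hom_id: "coalgebra_hom D d D d id"
proof -
  have "tensor_map id id t = t" for t :: "('a, 'a) tensor"
    by (subst clinear_as_tensor_lift[OF clinear_tensor_map[OF clinear_id clinear_id]])
       (simp add: clinear_id clinear_as_tensor_lift[OF clinear_ident, symmetric])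
  then show ?thesis by (simp add: coalgebra_hom_def clinear_id)
qed

lemma convol_hom:
  assumes h: "coalgebra_hom D d D' d' \<phi>" and f: "clinear f" and g: "clinear g"
  shows "convol D' f g (\<phi> x) = convol D (\<lambda>x. f (\<phi> x)) (\<lambda>x. g (\<phi> x)) x"
  unfolding convol_def by (rule tensor_lift_hom[OF h]) (intro clin f g)

lemma convol_power_hom:
  assumes h: "coalgebra_hom D d D' d' \<phi>" and co: "coalgebra D' d'" and A: "clinear A"
  shows "convol_power D' d' A n (\<phi> x) = convol_power D d (\<lambda>x. A (\<phi> x)) n x"
proof -
  interpret coalg D' d' by unfold_locales (rule co)
  show ?thesis
    using h by (induction n arbitrary: x)
      (simp_all add: convol_hom[OF h A convol_power_linear[OF A]] coalgebra_hom_def)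
qed

text \<open>Exponentials on different coalgebras are compared through this functoriality: the factors
  \<open>F \<circ> (\<mu> \<otimes> id)\<close> and \<open>F \<otimes> \<delta>\<close> of the cocycle identity are exponentials on the threefold tensor product.\<close>

lemma convol_exp_hom:
  assumes h: "coalgebra_hom D d D' d' \<phi>" and co: "coalgebra D' d'" and A: "clinear A"
  shows "convol_exp D' d' A (\<phi> x) = convol_exp D d (\<lambda>x. A (\<phi> x)) x"
  by (simp add: convol_exp_def convol_power_hom[OF assms])

lemma coalgebra_homI:
  assumes \<phi>: "clinear \<phi>" and D: "clinear D" "clinear D'" "clinear d" "clinear d'"
    and comult: "\<And>a b. D' (\<phi> (a \<otimes> b)) = tensor_lift (\<lambda>p q. \<phi> p \<otimes> \<phi> q) (D (a \<otimes> b))"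
    and counit: "\<And>a b. d' (\<phi> (a \<otimes> b)) = d (a \<otimes> b)"
  shows "coalgebra_hom D d D' d' \<phi>"
proof -
  note lin = clin \<phi> clinear_compose[OF \<phi>] D clinear_compose[OF D(1)] clinear_compose[OF D(2)] clinear_compose[OF D(4)]
  have "(\<lambda>x. D' (\<phi> x)) = (\<lambda>x. tensor_map \<phi> \<phi> (D x))"
  proof (rule tensor_lift_unique)
    show "clinear (\<lambda>x. D' (\<phi> x))" "clinear (\<lambda>x. tensor_map \<phi> \<phi> (D x))" by (intro lin)+
  qed (simp add: comult tensor_map_def)
  moreover have "(\<lambda>x. d' (\<phi> x)) = d"
  proof (rule tensor_lift_unique)
    show "clinear (\<lambda>x. d' (\<phi> x))" by (intro lin)
  qed (simp_all add: counit D)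
  ultimately show ?thesis by (simp add: coalgebra_hom_def \<phi> fun_eq_iff)
qed

lemma tcomult_pure:
  assumes "clinear D" "clinear E"
  shows "tcomult D E (a \<otimes> b) = tensor_lift (\<lambda>a1 a2. tensor_lift (\<lambda>b1 b2. (a1 \<otimes> b1) \<otimes> (a2 \<otimes> b2)) (E b)) (D a)"
  by (subst clinear_as_tensor_lift[OF clinear_ident]) (rule tensor_lift_tcomult[OF assms cbilinear_tensor_pure])

lemma coalgebra_hom_tensor_map:
  assumes h: "coalgebra_hom D d D' d' \<phi>" "coalgebra_hom E e E' e' \<psi>"
    and co: "coalgebra D d" "coalgebra D' d'" "coalgebra E e" "coalgebra E' e'"
  shows "coalgebra_hom (tcomult D E) (tcounit d e) (tcomult D' E') (tcounit d' e') (tensor_map \<phi> \<psi>)"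
proof -
  note D = co[THEN coalgebra_linear(1)]
  note d = co[THEN coalgebra_linear(2)]
  have \<phi>: "clinear \<phi>" and \<psi>: "clinear \<psi>" using h by (simp_all add: coalgebra_hom_def)
  note lin = clin \<phi> \<psi> clinear_compose[OF \<phi>] clinear_compose[OF \<psi>]
  show ?thesis
  proof (rule coalgebra_homI)
    fix a b
    have "tcomult D' E' (tensor_map \<phi> \<psi> (a \<otimes> b)) =
       tensor_lift (\<lambda>a1 a2. tensor_lift (\<lambda>b1 b2. (a1 \<otimes> b1) \<otimes> (a2 \<otimes> b2)) (E' (\<psi> b))) (D' (\<phi> a))"
      by (simp add: \<phi> \<psi> tcomult_pure D)
    also have "\<dots> = tensor_lift (\<lambda>a1 a2. tensor_lift (\<lambda>b1 b2. (\<phi> a1 \<otimes> b1) \<otimes> (\<phi> a2 \<otimes> b2)) (E' (\<psi> b))) (D a)"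
      by (rule tensor_lift_hom[OF h(1)]) (intro lin)
    also have "(\<lambda>a1 a2. tensor_lift (\<lambda>b1 b2. (\<phi> a1 \<otimes> b1) \<otimes> (\<phi> a2 \<otimes> b2)) (E' (\<psi> b))) =
        (\<lambda>a1 a2. tensor_lift (\<lambda>b1 b2. (\<phi> a1 \<otimes> \<psi> b1) \<otimes> (\<phi> a2 \<otimes> \<psi> b2)) (E b))"
      by (intro ext tensor_lift_hom[OF h(2)]) (intro lin)
    also have "tensor_lift \<dots> (D a) =
        tensor_lift (\<lambda>p q. tensor_map \<phi> \<psi> p \<otimes> tensor_map \<phi> \<psi> q) (tcomult D E (a \<otimes> b))"
      by (subst tensor_lift_tcomult) (simp_all add: D \<phi> \<psi> cbilinear_tensor_map clinear_tensor_map)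
    finally show "tcomult D' E' (tensor_map \<phi> \<psi> (a \<otimes> b)) =
       tensor_lift (\<lambda>p q. tensor_map \<phi> \<psi> p \<otimes> tensor_map \<phi> \<psi> q) (tcomult D E (a \<otimes> b))" .
    show "tcounit d' e' (tensor_map \<phi> \<psi> (a \<otimes> b)) = tcounit d e (a \<otimes> b)"
      using h by (simp add: \<phi> \<psi> tcounit_pure d coalgebra_hom_def)
  qed (intro clinear_tcomult clinear_tcounit clinear_tensor_map \<phi> \<psi> D d)+
qed

lemma coalgebra_hom_assoc:
  assumes co: "coalgebra D d" "coalgebra E e" "coalgebra F f"
  shows "coalgebra_hom (tcomult (tcomult D E) F) (tcounit (tcounit d e) f)
     (tcomult D (tcomult E F)) (tcounit d (tcounit e f)) tensor_assoc"
proof -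
  note D = co[THEN coalgebra_linear(1)]
  note d = co[THEN coalgebra_linear(2)]
  note lin = clin D d clinear_tcomult clinear_tcounit clinear_tensor_assoc
  show ?thesis
  proof (rule coalgebra_homI)
    fix x c
    have "(\<lambda>x. tcomult D (tcomult E F) (tensor_assoc (x \<otimes> c))) =
       (\<lambda>x. tensor_lift (\<lambda>p q. tensor_assoc p \<otimes> tensor_assoc q) (tcomult (tcomult D E) F (x \<otimes> c)))"
    proof (rule tensor_lift_unique)
      have 1: "clinear (tcomult D (tcomult E F))" by (intro lin)
      have 2: "clinear (tcomult (tcomult D E) F)" by (intro lin)
      show "clinear (\<lambda>x. tcomult D (tcomult E F) (tensor_assoc (x \<otimes> c)))"
        by (intro lin clinear_compose[OF 1])
      show "clinear (\<lambda>x. tensor_lift (\<lambda>p q. tensor_assoc p \<otimes> tensor_assoc q) (tcomult (tcomult D E) F (x \<otimes> c)))"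
        by (intro lin clinear_compose[OF 2])
      fix a b
      let ?R = "tensor_lift (\<lambda>a1 a2. tensor_lift (\<lambda>b1 b2. tensor_lift (\<lambda>c1 c2.
          (a1 \<otimes> (b1 \<otimes> c1)) \<otimes> (a2 \<otimes> (b2 \<otimes> c2))) (F c)) (E b)) (D a)"
      have "tcomult D (tcomult E F) (tensor_assoc ((a \<otimes> b) \<otimes> c)) = ?R"
        unfolding tensor_assoc_pure
        by (subst tcomult_pure, intro lin, intro lin, subst tensor_lift_tcomult, intro lin, intro lin, intro lin, rule refl)
      moreover have "tensor_lift (\<lambda>p q. tensor_assoc p \<otimes> tensor_assoc q) (tcomult (tcomult D E) F ((a \<otimes> b) \<otimes> c)) = ?R"
        by (subst tensor_lift_tcomult, intro lin, intro lin, intro lin, subst tensor_lift_tcomult, intro lin, intro lin, intro lin, simp)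
      ultimately show "tcomult D (tcomult E F) (tensor_assoc ((a \<otimes> b) \<otimes> c)) =
         tensor_lift (\<lambda>p q. tensor_assoc p \<otimes> tensor_assoc q) (tcomult (tcomult D E) F ((a \<otimes> b) \<otimes> c))" by simp
    qed
    then show "tcomult D (tcomult E F) (tensor_assoc (x \<otimes> c)) =
       tensor_lift (\<lambda>p q. tensor_assoc p \<otimes> tensor_assoc q) (tcomult (tcomult D E) F (x \<otimes> c))"
      by (rule fun_cong)
    have "(\<lambda>x. tcounit d (tcounit e f) (tensor_assoc (x \<otimes> c))) = (\<lambda>x. tcounit (tcounit d e) f (x \<otimes> c))"
    proof (rule tensor_lift_unique)
      have 1: "clinear (tcounit d (tcounit e f))" by (intro lin)
      have 2: "clinear (tcounit (tcounit d e) f)" by (intro lin)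
      show "clinear (\<lambda>x. tcounit d (tcounit e f) (tensor_assoc (x \<otimes> c)))"
        "clinear (\<lambda>x. tcounit (tcounit d e) f (x \<otimes> c))"
        by (intro lin clinear_compose[OF 1] clinear_compose[OF 2])+
    qed (simp add: tcounit_pure d clinear_tcounit)
    then show "tcounit d (tcounit e f) (tensor_assoc (x \<otimes> c)) = tcounit (tcounit d e) f (x \<otimes> c)"
      by (rule fun_cong)
  qed (intro lin)+
qed

lemma
  assumes co: "coalgebra D d" "coalgebra E e"
  shows coalgebra_hom_counit_right:
      "coalgebra_hom (tcomult D E) (tcounit d e) D d (tensor_lift (\<lambda>a b. e b *\<^sub>C a))" (is ?r)
    and coalgebra_hom_counit_left:
      "coalgebra_hom (tcomult D E) (tcounit d e) E e (tensor_lift (\<lambda>a b. d a *\<^sub>C b))" (is ?l)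
proof -
  note D = co[THEN coalgebra_linear(1)]
  note d = co[THEN coalgebra_linear(2)]
  note lin = clin D d clinear_tcomult clinear_tcounit
  have b: "cbilinear (\<lambda>a b. e b *\<^sub>C a)" "cbilinear (\<lambda>a b. d a *\<^sub>C b)" by (intro lin)+
  note l = b[THEN clinear_tensor_lift]
  show ?r
  proof (rule coalgebra_homI)
    fix a b
    have "tensor_lift (\<lambda>p q. tensor_lift (\<lambda>a b. e b *\<^sub>C a) p \<otimes> tensor_lift (\<lambda>a b. e b *\<^sub>C a) q) (tcomult D E (a \<otimes> b)) =
       tensor_lift (\<lambda>a1 a2. tensor_lift (\<lambda>b1 b2. e b1 *\<^sub>C e b2 *\<^sub>C (a1 \<otimes> a2)) (E b)) (D a)"
      by (subst tensor_lift_tcomult[OF D], rule cbilinear_tensor_map[OF l(1) l(1)])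
         (simp add: b tensor_pure_simps mult.commute)
    also have "\<dots> = tensor_lift (\<lambda>a1 a2. e b *\<^sub>C (a1 \<otimes> a2)) (D a)"
      by (subst coalgebra_counit(1)[OF co(2)]) (intro lin, rule refl)
    also have "\<dots> = e b *\<^sub>C D a"
      unfolding tensor_lift_scaleC clinear_as_tensor_lift[OF clinear_ident, symmetric] ..
    finally show "D (tensor_lift (\<lambda>a b. e b *\<^sub>C a) (a \<otimes> b)) =
       tensor_lift (\<lambda>p q. tensor_lift (\<lambda>a b. e b *\<^sub>C a) p \<otimes> tensor_lift (\<lambda>a b. e b *\<^sub>C a) q) (tcomult D E (a \<otimes> b))"
      by (simp add: b clinear_scaleC[OF D(1)])
    show "d (tensor_lift (\<lambda>a b. e b *\<^sub>C a) (a \<otimes> b)) = tcounit d e (a \<otimes> b)"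
      by (simp add: b clinear_scaleC[OF d(1)] scaleC_complex_def tcounit_pure[OF d])
  qed (intro lin l)+
  show ?l
  proof (rule coalgebra_homI)
    fix a b
    have "tensor_lift (\<lambda>p q. tensor_lift (\<lambda>a b. d a *\<^sub>C b) p \<otimes> tensor_lift (\<lambda>a b. d a *\<^sub>C b) q) (tcomult D E (a \<otimes> b)) =
       tensor_lift (\<lambda>b1 b2. tensor_lift (\<lambda>a1 a2. d a1 *\<^sub>C d a2 *\<^sub>C (b1 \<otimes> b2)) (D a)) (E b)"
      by (subst tensor_lift_swap, subst tensor_lift_tcomult[OF D], rule cbilinear_tensor_map[OF l(2) l(2)])
         (simp add: b tensor_pure_simps mult.commute)
    also have "\<dots> = tensor_lift (\<lambda>b1 b2. d a *\<^sub>C (b1 \<otimes> b2)) (E b)"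
      by (subst coalgebra_counit(1)[OF co(1)]) (intro lin, rule refl)
    also have "\<dots> = d a *\<^sub>C E b"
      unfolding tensor_lift_scaleC clinear_as_tensor_lift[OF clinear_ident, symmetric] ..
    finally show "E (tensor_lift (\<lambda>a b. d a *\<^sub>C b) (a \<otimes> b)) =
       tensor_lift (\<lambda>p q. tensor_lift (\<lambda>a b. d a *\<^sub>C b) p \<otimes> tensor_lift (\<lambda>a b. d a *\<^sub>C b) q) (tcomult D E (a \<otimes> b))"
      by (simp add: b clinear_scaleC[OF D(2)])
    show "e (tensor_lift (\<lambda>a b. d a *\<^sub>C b) (a \<otimes> b)) = tcounit d e (a \<otimes> b)"
      by (simp add: b clinear_scaleC[OF d(2)] scaleC_complex_def tcounit_pure[OF d])
  qed (intro lin l)+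
qed

section \<open>Bialgebras and the antipode\<close>

text \<open>Both sides are the sum of \<open>T x\<^sub>1 x\<^sub>2 x\<^sub>3 x\<^sub>4\<close>. The right-hand bracketing keeps the two
  middle legs together, which is where an antipode or a centrality identity can be applied.\<close>

lemma coalgebra_coassoc4:
  assumes co: "coalgebra D d"
    and T: "\<And>b c e. clinear (\<lambda>a. T a b c e)" "\<And>a c e. clinear (\<lambda>b. T a b c e)"
      "\<And>a b e. clinear (\<lambda>c. T a b c e)" "\<And>a b c. clinear (\<lambda>e. T a b c e)"
  shows "tensor_lift (\<lambda>p q. tensor_lift (\<lambda>a b. tensor_lift (\<lambda>c e. T a b c e) (D q)) (D p)) (D x) =
         tensor_lift (\<lambda>a r. tensor_lift (\<lambda>m e. tensor_lift (\<lambda>b c. T a b c e) (D m)) (D r)) (D x)"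
proof -
  note lin = clin T clinear_compose[OF coalgebra_linear(1)[OF co]]
  have "tensor_lift (\<lambda>p q. tensor_lift (\<lambda>a b. tensor_lift (\<lambda>c e. T a b c e) (D q)) (D p)) (D x) =
    tensor_lift (\<lambda>a r. tensor_lift (\<lambda>b q. tensor_lift (\<lambda>c e. T a b c e) (D q)) (D r)) (D x)"
    by (rule coalgebra_coassoc[OF co]; intro lin)
  moreover have "tensor_lift (\<lambda>b q. tensor_lift (\<lambda>c e. T a b c e) (D q)) (D r) =
      tensor_lift (\<lambda>m e. tensor_lift (\<lambda>b c. T a b c e) (D m)) (D r)" for a r
    by (rule coalgebra_coassoc[OF co, symmetric]; intro lin)
  ultimately show ?thesis by (simp only:)
qed

text \<open>A left inverse and a right inverse in a monoid agree; here the monoid consists of the linear maps from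
  a coalgebra to an algebra under convolution.\<close>

lemma convolution_inverse_unique:
  assumes co: "coalgebra D d" and alg: "unital_algebra m u"
    and lins: "clinear f" "clinear g" "clinear h"
    and fg: "\<And>x. tensor_lift (\<lambda>a b. m (f a \<otimes> g b)) (D x) = d x *\<^sub>C u"
    and gh: "\<And>x. tensor_lift (\<lambda>a b. m (g a \<otimes> h b)) (D x) = d x *\<^sub>C u"
  shows "f x = h x"
proof -
  have m: "clinear m" and assoc: "m (m (a \<otimes> b) \<otimes> c) = m (a \<otimes> m (b \<otimes> c))"
    and unit: "m (u \<otimes> a) = a" "m (a \<otimes> u) = a" for a b c
    using alg by (simp_all add: unital_algebra_def)
  note lin = clin lins clinear_compose[OF m] clinear_compose[OF lins(1)]
    clinear_compose[OF lins(2)] clinear_compose[OF lins(3)]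
  have "f x = tensor_lift (\<lambda>a q. d q *\<^sub>C f a) (D x)"
    by (rule coalgebra_counit(2)[OF co lins(1), symmetric])
  also have "\<dots> = tensor_lift (\<lambda>a q. m (f a \<otimes> (d q *\<^sub>C u))) (D x)"
    by (simp add: tensor_pure_simps clinear_scaleC[OF m] unit)
  also have "\<dots> = tensor_lift (\<lambda>a q. tensor_lift (\<lambda>b c. m (f a \<otimes> m (g b \<otimes> h c))) (D q)) (D x)"
  proof -
    have "clinear (\<lambda>y. m (f a \<otimes> y))" for a by (intro lin)
    then show ?thesis by (simp only: gh[symmetric] clinear_apply_tensor_lift[of "\<lambda>y. m (f _ \<otimes> y)"])
  qed
  also have "\<dots> = tensor_lift (\<lambda>p c. tensor_lift (\<lambda>a b. m (m (f a \<otimes> g b) \<otimes> h c)) (D p)) (D x)"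
    unfolding assoc by (rule coalgebra_coassoc[OF co, symmetric]; intro lin)
  also have "\<dots> = tensor_lift (\<lambda>p c. m ((d p *\<^sub>C u) \<otimes> h c)) (D x)"
  proof -
    have "clinear (\<lambda>y. m (y \<otimes> h c))" for c by (intro lin)
    then show ?thesis by (simp only: fg[symmetric] clinear_apply_tensor_lift[of "\<lambda>y. m (y \<otimes> h _)"])
  qed
  also have "\<dots> = tensor_lift (\<lambda>p c. d p *\<^sub>C h c) (D x)"
    by (simp add: tensor_pure_simps clinear_scaleC[OF m] unit)
  also have "\<dots> = h x" by (rule coalgebra_counit(1)[OF co lins(3)])
  finally show ?thesis .
qed

definition tensor_mult ::
  "(('a::complex_vector, 'a) tensor \<Rightarrow> 'a) \<Rightarrow> (('a, 'a) tensor, ('a, 'a) tensor) tensor \<Rightarrow> ('a, 'a) tensor" where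
  "tensor_mult m t = tensor_map m m (tensor_interchange t)"

lemma unital_algebra_tensor:
  assumes "unital_algebra m u"
  shows "unital_algebra (tensor_mult m) (u \<otimes> u)"
proof -
  have m: "clinear m" and assoc: "m (m (a \<otimes> b) \<otimes> c) = m (a \<otimes> m (b \<otimes> c))"
    and unit: "m (u \<otimes> a) = a" "m (a \<otimes> u) = a" for a b c
    using assms by (simp_all add: unital_algebra_def)
  have mm: "clinear (tensor_mult m)"
    unfolding tensor_mult_def by (intro clin m)
  have pure: "tensor_mult m ((a \<otimes> b) \<otimes> (c \<otimes> d)) = m (a \<otimes> c) \<otimes> m (b \<otimes> d)" for a b c d
    by (simp add: tensor_mult_def m)
  note add = tensor_pure_simps clinear_add[OF mm]
  have u: "tensor_mult m ((u \<otimes> u) \<otimes> x) = x" "tensor_mult m (x \<otimes> (u \<otimes> u)) = x" for x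
    by (induction x rule: tensor_induct) (simp_all add: pure unit add)
  have "tensor_mult m (tensor_mult m (x \<otimes> y) \<otimes> z) = tensor_mult m (x \<otimes> tensor_mult m (y \<otimes> z))" for x y z
  proof (induction x rule: tensor_induct)
    case (pure a b)
    show ?case
    proof (induction y rule: tensor_induct)
      case (pure c d)
      show ?case
        by (induction z rule: tensor_induct) (simp_all add: \<open>\<And>a b c d. tensor_mult m ((a \<otimes> b) \<otimes> (c \<otimes> d)) = _\<close> assoc add)
    qed (simp add: add)
  qed (simp add: add)
  then show ?thesis by (simp add: unital_algebra_def mm u)
qed

text \<open>An identity in \<open>\<B>\<close>, which carries no topology, can thus be differentiated after applying
  an arbitrary functional.\<close>

lemma functionals_separate:
  fixes x y :: "'a::complex_vector"
  assumes "\<And>\<phi> :: 'a \<Rightarrow> complex. clinear \<phi> \<Longrightarrow> \<phi> x = \<phi> y"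
  shows "x = y"
proof (rule ccontr)
  assume "x \<noteq> y"
  then have "complex_vector.independent {x - y}"
    by (simp add: complex_vector.independent_insert complex_vector.independent_empty)
  moreover have "vector_space_pair (scaleC :: complex \<Rightarrow> 'a \<Rightarrow> 'a) (scaleC :: complex \<Rightarrow> complex \<Rightarrow> complex)"
    by unfold_locales
  ultimately obtain g where "clinear g" "g (x - y) = (1 :: complex)"
    using vector_space_pair.linear_independent_extend[of scaleC scaleC "{x - y}" "\<lambda>_. 1 :: complex"] by auto
  then show False using assms[of g] by (simp add: clinear_diff)
qed

locale bialg =
  fixes H :: "'b::complex_vector bialg"
  assumes bialgebra: "bialgebra H"
begin

abbreviation \<Delta> where "\<Delta> \<equiv> comult H"
abbreviation \<delta> where "\<delta> \<equiv> counit H"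
abbreviation \<mu> where "\<mu> \<equiv> mult H"
abbreviation \<Delta>2 where "\<Delta>2 \<equiv> comult2 H"
abbreviation \<delta>2 where "\<delta>2 \<equiv> counit2 H"
abbreviation unit_H ("\<one>") where "\<one> \<equiv> unit_elt H"
abbreviation prod_H (infixl "\<odot>" 73) where "a \<odot> b \<equiv> mult H (a \<otimes> b)"

lemma algebra: "unital_algebra \<mu> \<one>" and coalg1: "coalgebra \<Delta> \<delta>"
  using bialgebra by (simp_all add: bialgebra_def)

lemma mult_assoc: "a \<odot> b \<odot> c = a \<odot> (b \<odot> c)" and unit_mult: "\<one> \<odot> a = a" "a \<odot> \<one> = a"
  using algebra by (simp_all add: unital_algebra_def)

lemma comult2_eq: "\<Delta>2 = tcomult \<Delta> \<Delta>" and counit2_eq: "\<delta>2 = tcounit \<delta> \<delta>"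
  by (simp_all add: comult2_def tcomult_def counit2_def tcounit_def)

lemma coalg2: "coalgebra \<Delta>2 \<delta>2"
  unfolding comult2_eq counit2_eq by (rule coalgebra_tensor[OF coalg1 coalg1])

lemma coalg_locale2: "coalg \<Delta>2 \<delta>2"
  by (rule coalg.intro[OF coalg2])

lemma lin_mult: "clinear \<mu>"
  using algebra by (simp add: unital_algebra_def)

lemmas lins = lin_mult coalgebra_linear[OF coalg1] coalgebra_linear[OF coalg2]
lemmas hlin = clin lins lins[THEN clinear_compose]

lemmas counit = coalgebra_counit[OF coalg1]
lemmas counit_c = coalgebra_counit_complex[OF coalg1]
lemmas coassoc = coalgebra_coassoc[OF coalg1]
lemmas coassoc4 = coalgebra_coassoc4[OF coalg1]

lemma lift_comult2:
  "cbilinear f \<Longrightarrow> tensor_lift f (\<Delta>2 (a \<otimes> b)) =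
    tensor_lift (\<lambda>a1 a2. tensor_lift (\<lambda>b1 b2. f (a1 \<otimes> b1) (a2 \<otimes> b2)) (\<Delta> b)) (\<Delta> a)"
  unfolding comult2_eq by (intro tensor_lift_tcomult lins)

lemma counit2_pure: "\<delta>2 (a \<otimes> b) = \<delta> a * \<delta> b"
  by (simp add: counit2_eq tcounit_pure lins)

lemma comult_unit: "\<Delta> \<one> = \<one> \<otimes> \<one>" and counit_unit: "\<delta> \<one> = 1"
  using bialgebra by (simp_all add: bialgebra_def)

lemma counit_mult: "\<delta> (\<mu> x) = \<delta>2 x" and comult_mult: "\<Delta> (\<mu> x) = tensor_map \<mu> \<mu> (\<Delta>2 x)"
  using bialgebra by (auto simp: bialgebra_def fun_eq_iff)

lemma mult_hom: "coalgebra_hom \<Delta>2 \<delta>2 \<Delta> \<delta> \<mu>"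
  by (simp add: coalgebra_hom_def lins counit_mult comult_mult)

lemmas lift_comult_mult = tensor_lift_hom[OF mult_hom]

lemma lift_comult_unit: "cbilinear f \<Longrightarrow> tensor_lift f (\<Delta> \<one>) = f \<one> \<one>"
  by (simp add: comult_unit)

end

locale hopf = bialg H for H :: "'b::complex_vector bialg" +
  fixes S :: "'b \<Rightarrow> 'b"
  assumes is_antipode: "is_antipode H (mult H) S"
begin

lemma lin_S: "clinear S"
  using is_antipode by (simp add: is_antipode_def)

lemmas slin = hlin lin_S clinear_compose[OF lin_S]

lemma antipode:
  "tensor_lift (\<lambda>a b. S a \<odot> b) (\<Delta> x) = \<delta> x *\<^sub>C \<one>"
  "tensor_lift (\<lambda>a b. a \<odot> S b) (\<Delta> x) = \<delta> x *\<^sub>C \<one>"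
proof -
  have "\<mu> (tensor_map S id (\<Delta> x)) = \<delta> x *\<^sub>C \<one>" "\<mu> (tensor_map id S (\<Delta> x)) = \<delta> x *\<^sub>C \<one>"
    using is_antipode by (auto simp: is_antipode_def unit_counit_def fun_eq_iff)
  then show "tensor_lift (\<lambda>a b. S a \<odot> b) (\<Delta> x) = \<delta> x *\<^sub>C \<one>"
    "tensor_lift (\<lambda>a b. a \<odot> S b) (\<Delta> x) = \<delta> x *\<^sub>C \<one>"
    by (simp_all add: tensor_map_def clinear_apply_tensor_lift[OF lin_mult])
qed

lemma antipode_apply:
  assumes "clinear f"
  shows "tensor_lift (\<lambda>a b. f (S a \<odot> b)) (\<Delta> x) = \<delta> x *\<^sub>C f \<one>"
    "tensor_lift (\<lambda>a b. f (a \<odot> S b)) (\<Delta> x) = \<delta> x *\<^sub>C f \<one>"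
  using antipode[of x, THEN arg_cong[of _ _ f]]
  by (simp_all add: clinear_apply_tensor_lift[OF assms] clinear_scaleC[OF assms])

lemma antipode_unit: "S \<one> = \<one>"
proof -
  have "tensor_lift (\<lambda>a b. S a \<odot> b) (\<Delta> \<one>) = S \<one> \<odot> \<one>"
    by (rule lift_comult_unit) (intro slin)
  then show ?thesis by (simp add: antipode counit_unit unit_mult scaleC_one)
qed

lemma counit_antipode: "\<delta> (S x) = \<delta> x"
proof -
  have "\<delta> (S x) = tensor_lift (\<lambda>a b. \<delta> b * \<delta> (S a)) (\<Delta> x)"
    by (rule counit_c(2)[symmetric]) (intro slin)
  also have "\<dots> = tensor_lift (\<lambda>a b. \<delta> (S a \<odot> b)) (\<Delta> x)"
    by (simp add: counit_mult counit2_pure mult.commute)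
  also have "\<dots> = \<delta> x"
    by (simp add: antipode_apply lins counit_unit scaleC_complex_def)
  finally show ?thesis .
qed

text \<open>The antipode reverses the comultiplication: both sides are convolution inverses of \<open>\<Delta>\<close> among
  the maps from \<open>\<B>\<close> to the algebra \<open>\<B> \<otimes> \<B>\<close>.\<close>

lemma comult_antipode: "\<Delta> (S x) = tensor_lift (\<lambda>a b. S b \<otimes> S a) (\<Delta> x)"
proof (rule convolution_inverse_unique[OF coalg1 unital_algebra_tensor[OF algebra]])
  let ?m = "tensor_mult \<mu>" and ?h = "\<lambda>x. tensor_lift (\<lambda>a b. S b \<otimes> S a) (\<Delta> x)"
  show "clinear (\<lambda>x. \<Delta> (S x))" "clinear \<Delta>" "clinear ?h" by (intro slin)+
  have pure: "?m ((a \<otimes> b) \<otimes> (c \<otimes> d)) = (a \<odot> c) \<otimes> (b \<odot> d)" for a b c d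
    by (simp add: tensor_mult_def lin_mult)
  have m: "clinear ?m" unfolding tensor_mult_def by (intro slin)
  fix x
  have "?m (\<Delta> a \<otimes> \<Delta> b) = \<Delta> (a \<odot> b)" for a b
    by (simp add: tensor_mult_def comult_mult comult2_def lins)
  then show "tensor_lift (\<lambda>a b. ?m (\<Delta> (S a) \<otimes> \<Delta> b)) (\<Delta> x) = \<delta> x *\<^sub>C (\<one> \<otimes> \<one>)"
    by (simp add: antipode_apply lins comult_unit)
  have mh: "?m (\<Delta> p \<otimes> ?h q) = tensor_lift (\<lambda>a b. tensor_lift (\<lambda>c d. (a \<odot> S d) \<otimes> (b \<odot> S c)) (\<Delta> q)) (\<Delta> p)" for p q
  proof -
    have 1: "clinear (\<lambda>y. ?m (z \<otimes> y))" and 2: "clinear (\<lambda>y. ?m (y \<otimes> z))" for z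
      by (intro slin clinear_compose[OF m])+
    show ?thesis
      by (simp only: clinear_apply_tensor_lift[OF 1] clinear_as_tensor_lift[OF 2, of "\<Delta> p"] pure)
         (rule tensor_lift_swap)
  qed
  have "tensor_lift (\<lambda>p q. ?m (\<Delta> p \<otimes> ?h q)) (\<Delta> x) =
    tensor_lift (\<lambda>a r. tensor_lift (\<lambda>m d. tensor_lift (\<lambda>b c. (a \<odot> S d) \<otimes> (b \<odot> S c)) (\<Delta> m)) (\<Delta> r)) (\<Delta> x)"
    unfolding mh by (rule coassoc4; intro slin)
  moreover have "tensor_lift (\<lambda>b c. (a \<odot> S d) \<otimes> (b \<odot> S c)) (\<Delta> m) = \<delta> m *\<^sub>C ((a \<odot> S d) \<otimes> \<one>)" for a m d
    by (rule antipode_apply(2)) (intro slin)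
  moreover have "tensor_lift (\<lambda>m d. \<delta> m *\<^sub>C ((a \<odot> S d) \<otimes> \<one>)) (\<Delta> r) = (a \<odot> S r) \<otimes> \<one>" for a r
    by (rule counit(1)) (intro slin)
  moreover have "tensor_lift (\<lambda>a r. (a \<odot> S r) \<otimes> \<one>) (\<Delta> x) = \<delta> x *\<^sub>C (\<one> \<otimes> \<one>)"
    by (rule antipode_apply(2)) (intro slin)
  ultimately show "tensor_lift (\<lambda>p q. ?m (\<Delta> p \<otimes> ?h q)) (\<Delta> x) = \<delta> x *\<^sub>C (\<one> \<otimes> \<one>)"
    by (simp only:)
qed

lemma lift_comult_antipode:
  "cbilinear f \<Longrightarrow> tensor_lift f (\<Delta> (S x)) = tensor_lift (\<lambda>a b. f (S b) (S a)) (\<Delta> x)"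
  by (simp add: comult_antipode clinear_apply_tensor_lift[OF clinear_tensor_lift])

text \<open>The legs of \<open>x\<^sub>1 \<otimes> S x\<^sub>2\<close> are \<open>x\<^sub>1 \<otimes> S x\<^sub>4\<close> and \<open>x\<^sub>2 \<otimes> S x\<^sub>3\<close>: the second has
  the shape of the original element, so a functional applied to it is summed as over the original element itself.\<close>

lemma comult2_antipode_right:
  assumes f: "\<And>x. clinear (f x)" "\<And>y. clinear (\<lambda>x. f x y)"
  shows "tensor_lift (\<lambda>p q. tensor_lift f (\<Delta>2 (p \<otimes> S q))) (\<Delta> x) =
    tensor_lift (\<lambda>a r. tensor_lift (\<lambda>m d. tensor_lift (\<lambda>b c.
      f (a \<otimes> S d) (b \<otimes> S c)) (\<Delta> m)) (\<Delta> r)) (\<Delta> x)"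
proof -
  note lin = slin f clinear_compose[OF f(1)] clinear_compose[OF f(2)]
  have "tensor_lift f (\<Delta>2 (p \<otimes> S q)) =
      tensor_lift (\<lambda>a b. tensor_lift (\<lambda>c d. f (a \<otimes> S d) (b \<otimes> S c)) (\<Delta> q)) (\<Delta> p)" for p q
    by (subst lift_comult2, intro lin, subst lift_comult_antipode, intro lin, rule refl)
  then show ?thesis by (simp only:) (rule coassoc4; intro lin)
qed

text \<open>Here the legs are \<open>S x\<^sub>2 \<otimes> x\<^sub>3\<close> and \<open>S x\<^sub>1 \<otimes> x\<^sub>4\<close>, so it is the first one that has the
  original shape.\<close>

lemma comult2_antipode_left:
  assumes f: "\<And>x. clinear (f x)" "\<And>y. clinear (\<lambda>x. f x y)"
  shows "tensor_lift (\<lambda>p q. tensor_lift f (\<Delta>2 (S p \<otimes> q))) (\<Delta> x) =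
    tensor_lift (\<lambda>a r. tensor_lift (\<lambda>m d. tensor_lift (\<lambda>b c.
      f (S b \<otimes> c) (S a \<otimes> d)) (\<Delta> m)) (\<Delta> r)) (\<Delta> x)"
proof -
  note lin = slin f clinear_compose[OF f(1)] clinear_compose[OF f(2)]
  have "tensor_lift f (\<Delta>2 (S p \<otimes> q)) =
      tensor_lift (\<lambda>a b. tensor_lift (\<lambda>c d. f (S b \<otimes> c) (S a \<otimes> d)) (\<Delta> q)) (\<Delta> p)" for p q
    by (subst lift_comult2, intro lin, subst lift_comult_antipode, intro lin, rule refl)
  then show ?thesis by (simp only:) (rule coassoc4; intro lin)
qed

end

section \<open>Generators satisfy Wirth's conditions\<close>

lemma has_vector_derivative_unique_at_0:
  fixes a b :: complex
  assumes "(f has_vector_derivative a) (at 0 within {0..})" "(g has_vector_derivative b) (at 0 within {0..})"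
    and "\<And>t. t \<ge> (0 :: real) \<Longrightarrow> f t = g t"
  shows "a = b"
proof -
  have "(f has_vector_derivative b) (at 0 within {0..})"
    by (rule has_vector_derivative_transform[OF _ _ assms(2)]) (simp_all add: assms(3))
  moreover have "at (0 :: real) within {0..} \<noteq> bot"
    using trivial_limit_at_right_real[of "0 :: real"] by (metis at_within_Ici_at_right)
  ultimately show ?thesis using assms(1) vector_derivative_unique_within by blast
qed

lemma has_vector_derivative_tensor_lift:
  fixes f :: "real \<Rightarrow> 'a::complex_vector \<Rightarrow> 'b::complex_vector \<Rightarrow> complex"
  assumes "\<And>a b. ((\<lambda>t. f t a b) has_vector_derivative f' a b) F"
  shows "((\<lambda>t. tensor_lift (f t) x) has_vector_derivative tensor_lift f' x) F"
  unfolding tensor_lift_def free_lift_def scaleC_complex_def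
  by (intro has_vector_derivative_sum has_vector_derivative_mult_right assms)

context bialg
begin

text \<open>The condition \<open>L \<star> \<mu> = \<mu> \<star> L\<close>.\<close>

definition central :: "(('b, 'b) tensor \<Rightarrow> complex) \<Rightarrow> bool" where
  "central L \<longleftrightarrow> (\<forall>x. tensor_lift (\<lambda>p q. L p *\<^sub>C \<mu> q) (\<Delta>2 x) = tensor_lift (\<lambda>p q. L q *\<^sub>C \<mu> p) (\<Delta>2 x))"

lemma centralD:
  assumes "central L" "clinear g"
  shows "tensor_lift (\<lambda>p q. L p *\<^sub>C g (\<mu> q)) (\<Delta>2 x) = tensor_lift (\<lambda>p q. L q *\<^sub>C g (\<mu> p)) (\<Delta>2 x)"
  using assms(1)[unfolded central_def, THEN spec, of x, THEN arg_cong[of _ _ g]]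
  by (simp add: clinear_apply_tensor_lift[OF assms(2)] clinear_scaleC[OF assms(2)])

lemma centralI:
  assumes "\<And>x \<phi>. clinear \<phi> \<Longrightarrow> convol \<Delta>2 L (\<lambda>p. \<phi> (\<mu> p)) x = convol \<Delta>2 (\<lambda>p. \<phi> (\<mu> p)) L x"
  shows "central L"
  unfolding central_def
proof (rule allI, rule functionals_separate)
  fix x and \<phi> :: "'b \<Rightarrow> complex" assume \<phi>: "clinear \<phi>"
  show "\<phi> (tensor_lift (\<lambda>p q. L p *\<^sub>C \<mu> q) (\<Delta>2 x)) = \<phi> (tensor_lift (\<lambda>p q. L q *\<^sub>C \<mu> p) (\<Delta>2 x))"
    using assms[OF \<phi>, of x]
    by (simp add: convol_def clinear_apply_tensor_lift[OF \<phi>] clinear_scaleC[OF \<phi>] scaleC_complex_def mult.commute)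
qed

lemma central_convol:
  assumes "central L" "clinear \<phi>"
  shows "convol \<Delta>2 L (\<lambda>p. \<phi> (\<mu> p)) = convol \<Delta>2 (\<lambda>p. \<phi> (\<mu> p)) L"
  using centralD[OF assms] by (simp add: convol_def scaleC_complex_def mult.commute fun_eq_iff)

definition cocycle :: "(('b, 'b) tensor \<Rightarrow> complex) \<Rightarrow> bool" where
  "cocycle L \<longleftrightarrow> (\<forall>a b c. \<delta> a * L (b \<otimes> c) + L (a \<otimes> (b \<odot> c)) = L ((a \<odot> b) \<otimes> c) + L (a \<otimes> b) * \<delta> c)"

text \<open>Wirth's description of the generators of additive deformations, used in place of the derivative
  \<^const>\<open>has_generator\<close>; the equivalence is \<open>generator_of_deformation\<close> and \<open>deformation_of_generator\<close>.\<close>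

definition generator :: "(('b, 'b) tensor \<Rightarrow> complex) \<Rightarrow> bool" where
  "generator L \<longleftrightarrow> clinear L \<and> central L \<and> L (\<one> \<otimes> \<one>) = 0 \<and> cocycle L"

text \<open>Apply the counit to either leg of \<open>\<Delta> \<circ> M\<^bsub>t+0\<^esub>\<close> or \<open>\<Delta> \<circ> M\<^bsub>0+t\<^esub>\<close>, where \<open>M\<^sub>0 = \<mu>\<close>.\<close>

lemma deformation_as_convolution:
  assumes M: "additive_deformation H M" and t: "t \<ge> 0"
  shows "M t x = tensor_lift (\<lambda>p q. \<delta> (M t p) *\<^sub>C \<mu> q) (\<Delta>2 x)"
    and "M t x = tensor_lift (\<lambda>p q. \<delta> (M t q) *\<^sub>C \<mu> p) (\<Delta>2 x)"
proof -
  have lin: "clinear (M t)" and M0: "M 0 = \<mu>"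
    and comm: "\<Delta> (M (r + s) x) = tensor_map (M r) (M s) (\<Delta>2 x)" if "r \<ge> 0" "s \<ge> 0" for r s
    using M t that by (auto simp: additive_deformation_def unital_algebra_def fun_eq_iff)
  have "M t x = tensor_lift (\<lambda>a b. \<delta> a *\<^sub>C b) (tensor_map (M t) \<mu> (\<Delta>2 x))"
    using comm[of t 0] counit(1)[OF clinear_ident, of "M t x"] t by (simp add: M0)
  also have "\<dots> = tensor_lift (\<lambda>p q. \<delta> (M t p) *\<^sub>C \<mu> q) (\<Delta>2 x)"
    by (rule tensor_lift_tensor_map; intro hlin lin) (rule t order_refl)+
  finally show "M t x = tensor_lift (\<lambda>p q. \<delta> (M t p) *\<^sub>C \<mu> q) (\<Delta>2 x)" .
  have "M t x = tensor_lift (\<lambda>a b. \<delta> b *\<^sub>C a) (tensor_map \<mu> (M t) (\<Delta>2 x))"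
    using comm[of 0 t] counit(2)[OF clinear_ident, of "M t x"] t by (simp add: M0)
  also have "\<dots> = tensor_lift (\<lambda>p q. \<delta> (M t q) *\<^sub>C \<mu> p) (\<Delta>2 x)"
    by (rule tensor_lift_tensor_map; intro hlin lin) (rule t order_refl)+
  finally show "M t x = tensor_lift (\<lambda>p q. \<delta> (M t q) *\<^sub>C \<mu> p) (\<Delta>2 x)" .
qed

text \<open>Each condition is the derivative at \<open>t = 0\<close> of an identity for \<open>w\<^sub>t = \<delta> \<circ> M\<^sub>t\<close>: linearity, the
  unit law, the two convolution formulas for \<open>M\<^sub>t\<close>, and associativity.\<close>

lemma generator_of_deformation:
  assumes M: "additive_deformation H M" and L: "has_generator H M L"
  shows "generator L"
proof -
  define w where "w t x = \<delta> (M t x)" for t x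
  have D: "((\<lambda>t. w t x) has_vector_derivative L x) (at 0 within {0..})" for x
    using L by (simp add: has_generator_def w_def)
  note uniq = has_vector_derivative_unique_at_0
  have alg: "unital_algebra (M t) \<one>" if "t \<ge> 0" for t
    using M that by (simp add: additive_deformation_def)
  then have Mlin: "clinear (M t)" and assoc: "M t (M t (a \<otimes> b) \<otimes> c) = M t (a \<otimes> M t (b \<otimes> c))"
    and unit: "M t (\<one> \<otimes> \<one>) = \<one>" if "t \<ge> 0" for t a b c
    using that by (simp_all add: unital_algebra_def)
  have wlin: "clinear (w t)" if "t \<ge> 0" for t
    unfolding w_def using Mlin[OF that] by (intro hlin)
  have w0: "w 0 x = \<delta>2 x" for x
    using M by (simp add: w_def additive_deformation_def counit_mult)
  note conv = deformation_as_convolution[OF M, folded w_def]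
  have Llin: "clinear L"
    unfolding clinear_iff
  proof (intro conjI allI)
    fix x y c
    show "L (x + y) = L x + L y"
      by (rule uniq[OF D has_vector_derivative_add[OF D D]]) (simp add: clinear_add[OF wlin])
    show "L (c *\<^sub>C x) = c *\<^sub>C L x"
      unfolding scaleC_complex_def
      by (rule uniq[OF D has_vector_derivative_mult_right[OF D]])
         (simp add: clinear_scaleC[OF wlin] scaleC_complex_def)
  qed
  have "L (\<one> \<otimes> \<one>) = 0"
    by (rule uniq[OF D has_vector_derivative_const]) (simp add: w_def unit counit_unit)
  moreover have "central L"
  proof (rule centralI)
    fix x and \<phi> :: "'b \<Rightarrow> complex" assume \<phi>: "clinear \<phi>"
    show "convol \<Delta>2 L (\<lambda>p. \<phi> (\<mu> p)) x = convol \<Delta>2 (\<lambda>p. \<phi> (\<mu> p)) L x"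
      unfolding convol_def
    proof (rule uniq)
      show "((\<lambda>t. tensor_lift (\<lambda>p q. w t p * \<phi> (\<mu> q)) (\<Delta>2 x)) has_vector_derivative
          tensor_lift (\<lambda>p q. L p * \<phi> (\<mu> q)) (\<Delta>2 x)) (at 0 within {0..})"
        by (intro has_vector_derivative_tensor_lift has_vector_derivative_mult_left D)
      show "((\<lambda>t. tensor_lift (\<lambda>p q. \<phi> (\<mu> p) * w t q) (\<Delta>2 x)) has_vector_derivative
          tensor_lift (\<lambda>p q. \<phi> (\<mu> p) * L q) (\<Delta>2 x)) (at 0 within {0..})"
        by (intro has_vector_derivative_tensor_lift has_vector_derivative_mult_right D)
      show "tensor_lift (\<lambda>p q. w t p * \<phi> (\<mu> q)) (\<Delta>2 x) = tensor_lift (\<lambda>p q. \<phi> (\<mu> p) * w t q) (\<Delta>2 x)"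
        if "t \<ge> 0" for t
        using conv[OF that, of x, THEN arg_cong[of _ _ \<phi>]]
        by (simp add: clinear_apply_tensor_lift[OF \<phi>] clinear_scaleC[OF \<phi>] scaleC_complex_def mult.commute)
    qed
  qed
  moreover have "cocycle L"
    unfolding cocycle_def
  proof (intro allI, rule uniq)
    fix a b c
    have g1: "clinear (\<lambda>z. L (\<mu> z \<otimes> c))" and g2: "clinear (\<lambda>z. L (a \<otimes> \<mu> z))"
      by (intro hlin clinear_compose[OF Llin])+
    \<comment> \<open>These are \<open>w\<^sub>t(a \<otimes> M\<^sub>t(b \<otimes> c))\<close> and \<open>w\<^sub>t(M\<^sub>t(a \<otimes> b) \<otimes> c)\<close>, written as convolutions so that the product rule applies.\<close>
    let ?f = "\<lambda>t. tensor_lift (\<lambda>p q. w t p * w t (a \<otimes> \<mu> q)) (\<Delta>2 (b \<otimes> c))"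
    let ?g = "\<lambda>t. tensor_lift (\<lambda>p q. w t p * w t (\<mu> q \<otimes> c)) (\<Delta>2 (a \<otimes> b))"
    have "(?f has_vector_derivative
       tensor_lift (\<lambda>p q. w 0 p * L (a \<otimes> \<mu> q) + L p * w 0 (a \<otimes> \<mu> q)) (\<Delta>2 (b \<otimes> c))) (at 0 within {0..})"
      by (intro has_vector_derivative_tensor_lift has_vector_derivative_mult D)
    moreover have "tensor_lift (\<lambda>p q. w 0 p * L (a \<otimes> \<mu> q) + L p * w 0 (a \<otimes> \<mu> q)) (\<Delta>2 (b \<otimes> c)) =
      L (a \<otimes> (b \<odot> c)) + \<delta> a * L (b \<otimes> c)"
    proof -
      have "tensor_lift (\<lambda>p q. L p * w 0 (a \<otimes> \<mu> q)) (\<Delta>2 (b \<otimes> c)) =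
          tensor_lift (\<lambda>p q. \<delta> a * (\<delta>2 q * L p)) (\<Delta>2 (b \<otimes> c))"
        by (simp add: w0 counit2_pure counit_mult mult_ac)
      then show ?thesis
        by (simp add: tensor_lift_plus w0 coalgebra_counit_complex[OF coalg2] g2 Llin tensor_lift_mult(1)[of "\<delta> a"])
    qed
    ultimately show "(?f has_vector_derivative \<delta> a * L (b \<otimes> c) + L (a \<otimes> (b \<odot> c))) (at 0 within {0..})"
      by (simp only: add.commute)
    have "(?g has_vector_derivative
       tensor_lift (\<lambda>p q. w 0 p * L (\<mu> q \<otimes> c) + L p * w 0 (\<mu> q \<otimes> c)) (\<Delta>2 (a \<otimes> b))) (at 0 within {0..})"
      by (intro has_vector_derivative_tensor_lift has_vector_derivative_mult D)
    moreover have "tensor_lift (\<lambda>p q. w 0 p * L (\<mu> q \<otimes> c) + L p * w 0 (\<mu> q \<otimes> c)) (\<Delta>2 (a \<otimes> b)) =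
      L ((a \<odot> b) \<otimes> c) + L (a \<otimes> b) * \<delta> c"
    proof -
      have "tensor_lift (\<lambda>p q. L p * w 0 (\<mu> q \<otimes> c)) (\<Delta>2 (a \<otimes> b)) =
          tensor_lift (\<lambda>p q. (\<delta>2 q * L p) * \<delta> c) (\<Delta>2 (a \<otimes> b))"
        by (simp add: w0 counit2_pure counit_mult mult_ac)
      then show ?thesis
        by (simp add: tensor_lift_plus w0 coalgebra_counit_complex[OF coalg2] g1 Llin tensor_lift_mult(2))
    qed
    ultimately show "(?g has_vector_derivative L ((a \<odot> b) \<otimes> c) + L (a \<otimes> b) * \<delta> c) (at 0 within {0..})"
      by (simp only:)
    show "?f t = ?g t" if t: "t \<ge> 0" for t
    proof -
      have 1: "clinear (\<lambda>y. w t (y \<otimes> c))" and 2: "clinear (\<lambda>y. w t (a \<otimes> y))"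
        by (intro hlin clinear_compose[OF wlin[OF t]])+
      have "?f t = w t (a \<otimes> M t (b \<otimes> c))"
        by (subst conv(1)[OF t]) (simp add: clinear_apply_tensor_lift[OF 2] clinear_scaleC[OF 2] scaleC_complex_def)
      also have "\<dots> = w t (M t (a \<otimes> b) \<otimes> c)" by (simp add: w_def assoc t)
      also have "\<dots> = ?g t"
        by (subst conv(1)[OF t]) (simp add: clinear_apply_tensor_lift[OF 1] clinear_scaleC[OF 1] scaleC_complex_def)
      finally show ?thesis .
    qed
  qed
  ultimately show ?thesis by (simp add: generator_def Llin)
qed

lemma cocycle_unit:
  assumes "generator L"
  shows "L (\<one> \<otimes> a) = 0" "L (a \<otimes> \<one>) = 0"
proof -
  have "\<delta> x * L (y \<otimes> z) + L (x \<otimes> (y \<odot> z)) = L ((x \<odot> y) \<otimes> z) + L (x \<otimes> y) * \<delta> z" "L (\<one> \<otimes> \<one>) = 0" for x y z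
    using assms by (simp_all add: generator_def cocycle_def)
  from this(1)[of \<one> \<one> a] this(1)[of a \<one> \<one>] this(2)
  show "L (\<one> \<otimes> a) = 0" "L (a \<otimes> \<one>) = 0" by (simp_all add: unit_mult counit_unit)
qed

section \<open>Every generator integrates to an additive deformation\<close>

text \<open>Reduces statements about \<open>e\<^sub>\<star>\<^bsup>tL\<^esup>\<close> to the case \<open>t = 1\<close>.\<close>

lemma generator_scale:
  assumes "generator L"
  shows "generator (\<lambda>x. c * L x)"
proof -
  have "central (\<lambda>x. c * L x)"
    using assms unfolding generator_def central_def scaleC_scaleC[symmetric] tensor_lift_scaleC by simp
  moreover have "clinear (\<lambda>x. c * L x)"
    using assms by (intro clin) (simp add: generator_def)
  moreover have "cocycle (\<lambda>x. c * L x)"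
    unfolding cocycle_def
  proof (intro allI)
    fix a b d
    have "\<delta> a * L (b \<otimes> d) + L (a \<otimes> (b \<odot> d)) = L ((a \<odot> b) \<otimes> d) + L (a \<otimes> b) * \<delta> d"
      using assms by (simp add: generator_def cocycle_def)
    from arg_cong[OF this, of "(*) c"]
    show "\<delta> a * (c * L (b \<otimes> d)) + c * L (a \<otimes> (b \<odot> d)) = c * L ((a \<odot> b) \<otimes> d) + c * L (a \<otimes> b) * \<delta> d"
      by (simp add: algebra_simps)
  qed
  ultimately show ?thesis using assms by (simp add: generator_def)
qed

lemma conv_power_eq: "conv_power H L n = convol_power \<Delta>2 \<delta>2 L n"
  by (induction n) (simp_all add: conv_def convol_def comp_def)

lemma conv_exp_eq: "conv_exp H t L = convol_exp \<Delta>2 \<delta>2 (\<lambda>x. of_real t * L x)"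
  by (simp add: conv_exp_def convol_exp_def fun_eq_iff conv_power_eq
      coalg.convol_power_scale[OF coalg_locale2])

lemma mult_conv_eq: "mult_conv H F x = tensor_lift (\<lambda>p q. F q *\<^sub>C \<mu> p) (\<Delta>2 x)"
  by (simp add: mult_conv_def)

lemma mult_conv_linear:
  assumes "clinear F" shows "clinear (mult_conv H F)"
  unfolding mult_conv_def comp_def by (intro hlin assms)

lemma central_exp:
  assumes L: "generator L"
  shows "central (convol_exp \<Delta>2 \<delta>2 L)"
proof (rule centralI)
  fix x and \<phi> :: "'b \<Rightarrow> complex" assume \<phi>: "clinear \<phi>"
  have "convol \<Delta>2 L (\<lambda>p. \<phi> (\<mu> p)) = convol \<Delta>2 (\<lambda>p. \<phi> (\<mu> p)) L"
    using L \<phi> central_convol by (simp add: generator_def)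
  moreover have "clinear L" "clinear (\<lambda>p. \<phi> (\<mu> p))"
    using L by (auto simp: generator_def intro: clinear_compose[OF \<phi>] lins)
  ultimately show "convol \<Delta>2 (convol_exp \<Delta>2 \<delta>2 L) (\<lambda>p. \<phi> (\<mu> p)) x = convol \<Delta>2 (\<lambda>p. \<phi> (\<mu> p)) (convol_exp \<Delta>2 \<delta>2 L) x"
    using coalg.convol_exp_commute[OF coalg_locale2] by simp
qed

text \<open>The map \<open>a \<mapsto> \<one> \<otimes> a\<close> is a coalgebra homomorphism because \<open>\<one>\<close> is group-like, and it pulls \<open>L\<close> back
  to \<open>0\<close>, whose exponential is the counit.\<close>

lemma exp_unit:
  assumes L: "generator L"
  shows "convol_exp \<Delta>2 \<delta>2 L (\<one> \<otimes> a) = \<delta> a" "convol_exp \<Delta>2 \<delta>2 L (a \<otimes> \<one>) = \<delta> a"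
proof -
  have Llin: "clinear L" using L by (simp add: generator_def)
  have r: "\<Delta>2 (\<one> \<otimes> a) = tensor_map (\<lambda>a. \<one> \<otimes> a) (\<lambda>a. \<one> \<otimes> a) (\<Delta> a)" for a
    unfolding comult2_eq tcomult_pure[OF lins(2,2)] tensor_map_def
    by (rule lift_comult_unit) (intro hlin)
  have l: "\<Delta>2 (a \<otimes> \<one>) = tensor_map (\<lambda>a. a \<otimes> \<one>) (\<lambda>a. a \<otimes> \<one>) (\<Delta> a)" for a
    unfolding comult2_eq tcomult_pure[OF lins(2,2)] tensor_map_def
    by (subst tensor_lift_swap, rule lift_comult_unit) (intro hlin)
  have "coalgebra_hom \<Delta> \<delta> \<Delta>2 \<delta>2 (\<lambda>a. \<one> \<otimes> a)" "coalgebra_hom \<Delta> \<delta> \<Delta>2 \<delta>2 (\<lambda>a. a \<otimes> \<one>)"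
    unfolding coalgebra_hom_def by (auto simp: counit2_pure counit_unit r l intro!: hlin)
  from this[THEN convol_exp_hom[OF _ coalg2 Llin]]
  show "convol_exp \<Delta>2 \<delta>2 L (\<one> \<otimes> a) = \<delta> a" "convol_exp \<Delta>2 \<delta>2 L (a \<otimes> \<one>) = \<delta> a"
    by (simp_all add: cocycle_unit[OF L] coalg.convol_exp_zero[OF coalg.intro[OF coalg1]])
qed

lemma mult_conv_unit:
  assumes F: "clinear F" and r: "\<And>a. F (\<one> \<otimes> a) = \<delta> a" and l: "\<And>a. F (a \<otimes> \<one>) = \<delta> a"
  shows "mult_conv H F (\<one> \<otimes> a) = a" "mult_conv H F (a \<otimes> \<one>) = a"
proof -
  note lin = hlin F clinear_compose[OF F]
  have "mult_conv H F (\<one> \<otimes> a) = tensor_lift (\<lambda>b c. F (\<one> \<otimes> c) *\<^sub>C (\<one> \<odot> b)) (\<Delta> a)"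
    unfolding mult_conv_eq
    by (subst lift_comult2, intro lin, subst lift_comult_unit, intro lin, rule refl)
  then show "mult_conv H F (\<one> \<otimes> a) = a"
    by (simp add: unit_mult r counit clinear_ident)
  have "mult_conv H F (a \<otimes> \<one>) = tensor_lift (\<lambda>b c. F (c \<otimes> \<one>) *\<^sub>C (b \<odot> \<one>)) (\<Delta> a)"
    unfolding mult_conv_eq
    by (subst lift_comult2, intro lin, subst tensor_lift_swap, subst lift_comult_unit, intro lin, rule refl)
  then show "mult_conv H F (a \<otimes> \<one>) = a"
    by (simp add: unit_mult l counit clinear_ident)
qed

end

context bialg
begin

text \<open>The two bracketings \<open>(\<B> \<otimes> \<B>) \<otimes> \<B>\<close> (left) and \<open>\<B> \<otimes> (\<B> \<otimes> \<B>)\<close> (right) of the threefold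
  tensor product as coalgebras, with the homomorphisms to \<open>\<B> \<otimes> \<B>\<close> that multiply two factors or drop one
  factor by its counit.\<close>

abbreviation "\<Delta>L \<equiv> tcomult \<Delta>2 \<Delta>"
abbreviation "\<delta>L \<equiv> tcounit \<delta>2 \<delta>"
abbreviation "\<Delta>R \<equiv> tcomult \<Delta> \<Delta>2"
abbreviation "\<delta>R \<equiv> tcounit \<delta> \<delta>2"

abbreviation "multL \<equiv> tensor_map \<mu> id"
abbreviation "multR \<equiv> tensor_map id \<mu>"
abbreviation "projL \<equiv> tensor_lift (\<lambda>p c. \<delta> c *\<^sub>C p)"
abbreviation "projR \<equiv> tensor_lift (\<lambda>a q. \<delta> a *\<^sub>C q)"

lemma coalgL: "coalgebra \<Delta>L \<delta>L" and coalgR: "coalgebra \<Delta>R \<delta>R"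
  by (rule coalgebra_tensor[OF coalg2 coalg1] coalgebra_tensor[OF coalg1 coalg2])+

lemma multL_hom: "coalgebra_hom \<Delta>L \<delta>L \<Delta>2 \<delta>2 multL"
  using coalgebra_hom_tensor_map[OF mult_hom coalgebra_hom_id coalg2 coalg1 coalg1 coalg1]
  by (simp only: comult2_eq counit2_eq)

lemma multR_hom: "coalgebra_hom \<Delta>R \<delta>R \<Delta>2 \<delta>2 multR"
  using coalgebra_hom_tensor_map[OF coalgebra_hom_id mult_hom coalg1 coalg1 coalg2 coalg1]
  by (simp only: comult2_eq counit2_eq)

lemma projL_hom: "coalgebra_hom \<Delta>L \<delta>L \<Delta>2 \<delta>2 projL"
  by (rule coalgebra_hom_counit_right[OF coalg2 coalg1])

lemma projR_hom: "coalgebra_hom \<Delta>R \<delta>R \<Delta>2 \<delta>2 projR"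
  by (rule coalgebra_hom_counit_left[OF coalg1 coalg2])

lemma assoc_hom: "coalgebra_hom \<Delta>L \<delta>L \<Delta>R \<delta>R tensor_assoc"
  using coalgebra_hom_assoc[OF coalg1 coalg1 coalg1] by (simp only: comult2_eq counit2_eq)

lemma lin_proj: "clinear projL" "clinear projR" and lin_multLR: "clinear multL" "clinear multR"
  by (intro clinear_tensor_lift clinear_tensor_map clinear_id hlin)+

lemma proj_pure: "projL (p \<otimes> c) = \<delta> c *\<^sub>C p" "projR (a \<otimes> q) = \<delta> a *\<^sub>C q"
  by (subst tensor_lift_pure, intro hlin, rule refl)+

lemma mult_pure: "multL (p \<otimes> c) = \<mu> p \<otimes> c" "multR (a \<otimes> q) = a \<otimes> \<mu> q"
  by (simp_all add: lins clinear_id)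

lemmas llin = hlin lin_proj lin_multLR lin_proj[THEN clinear_compose] lin_multLR[THEN clinear_compose]
  coalgebra_linear[OF coalgL] coalgebra_linear[OF coalgR]
  coalgebra_linear[OF coalgL, THEN clinear_compose] coalgebra_linear[OF coalgR, THEN clinear_compose]

lemma lift_comultL:
  "cbilinear f \<Longrightarrow> tensor_lift f (\<Delta>L (p \<otimes> c)) =
    tensor_lift (\<lambda>p1 p2. tensor_lift (\<lambda>c1 c2. f (p1 \<otimes> c1) (p2 \<otimes> c2)) (\<Delta> c)) (\<Delta>2 p)"
  by (intro tensor_lift_tcomult lins)

lemma lift_comultR:
  "cbilinear f \<Longrightarrow> tensor_lift f (\<Delta>R (a \<otimes> q)) =
    tensor_lift (\<lambda>a1 a2. tensor_lift (\<lambda>q1 q2. f (a1 \<otimes> q1) (a2 \<otimes> q2)) (\<Delta>2 q)) (\<Delta> a)"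
  by (intro tensor_lift_tcomult lins)

lemma convolL_pure:
  assumes F: "clinear F" and G: "clinear G"
  shows "convol \<Delta>L (\<lambda>w. F (multL w)) (\<lambda>w. G (projL w)) (p \<otimes> c) =
      tensor_lift (\<lambda>p1 p2. F (\<mu> p1 \<otimes> c) * G p2) (\<Delta>2 p)"
    and "convol \<Delta>L (\<lambda>w. G (projL w)) (\<lambda>w. F (multL w)) (p \<otimes> c) =
      tensor_lift (\<lambda>p1 p2. G p1 * F (\<mu> p2 \<otimes> c)) (\<Delta>2 p)"
proof -
  note lin = llin F G clinear_compose[OF F] clinear_compose[OF G]
  have 1: "tensor_lift (\<lambda>c1 c2. \<delta> c2 * F (x \<otimes> c1)) (\<Delta> c) = F (x \<otimes> c)"
    "tensor_lift (\<lambda>c1 c2. \<delta> c1 * F (x \<otimes> c2)) (\<Delta> c) = F (x \<otimes> c)" for x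
    by (rule counit_c; intro lin)+
  have "convol \<Delta>L (\<lambda>w. F (multL w)) (\<lambda>w. G (projL w)) (p \<otimes> c) =
     tensor_lift (\<lambda>p1 p2. tensor_lift (\<lambda>c1 c2. \<delta> c2 * F (\<mu> p1 \<otimes> c1)) (\<Delta> c) * G p2) (\<Delta>2 p)"
    unfolding convol_def tensor_lift_mult(2)[symmetric]
    by (subst lift_comultL, intro lin) (simp add: mult_pure proj_pure clinear_scaleC[OF G] scaleC_complex_def mult_ac)
  then show "convol \<Delta>L (\<lambda>w. F (multL w)) (\<lambda>w. G (projL w)) (p \<otimes> c) =
      tensor_lift (\<lambda>p1 p2. F (\<mu> p1 \<otimes> c) * G p2) (\<Delta>2 p)" by (simp only: 1)
  have "convol \<Delta>L (\<lambda>w. G (projL w)) (\<lambda>w. F (multL w)) (p \<otimes> c) =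
     tensor_lift (\<lambda>p1 p2. G p1 * tensor_lift (\<lambda>c1 c2. \<delta> c1 * F (\<mu> p2 \<otimes> c2)) (\<Delta> c)) (\<Delta>2 p)"
    unfolding convol_def tensor_lift_mult(1)[symmetric]
    by (subst lift_comultL, intro lin) (simp add: mult_pure proj_pure clinear_scaleC[OF G] scaleC_complex_def mult_ac)
  then show "convol \<Delta>L (\<lambda>w. G (projL w)) (\<lambda>w. F (multL w)) (p \<otimes> c) =
      tensor_lift (\<lambda>p1 p2. G p1 * F (\<mu> p2 \<otimes> c)) (\<Delta>2 p)" by (simp only: 1)
qed

lemma convolR_pure:
  assumes F: "clinear F" and G: "clinear G"
  shows "convol \<Delta>R (\<lambda>w. F (multR w)) (\<lambda>w. G (projR w)) (a \<otimes> q) =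
      tensor_lift (\<lambda>q1 q2. F (a \<otimes> \<mu> q1) * G q2) (\<Delta>2 q)"
    and "convol \<Delta>R (\<lambda>w. G (projR w)) (\<lambda>w. F (multR w)) (a \<otimes> q) =
      tensor_lift (\<lambda>q1 q2. G q1 * F (a \<otimes> \<mu> q2)) (\<Delta>2 q)"
proof -
  note lin = llin F G clinear_compose[OF F] clinear_compose[OF G]
  have 1: "tensor_lift (\<lambda>a1 a2. \<delta> a2 * F (a1 \<otimes> x)) (\<Delta> a) = F (a \<otimes> x)"
    "tensor_lift (\<lambda>a1 a2. \<delta> a1 * F (a2 \<otimes> x)) (\<Delta> a) = F (a \<otimes> x)" for x
    by (rule counit_c; intro lin)+
  have "convol \<Delta>R (\<lambda>w. F (multR w)) (\<lambda>w. G (projR w)) (a \<otimes> q) =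
     tensor_lift (\<lambda>q1 q2. tensor_lift (\<lambda>a1 a2. \<delta> a2 * F (a1 \<otimes> \<mu> q1)) (\<Delta> a) * G q2) (\<Delta>2 q)"
    unfolding convol_def tensor_lift_mult(2)[symmetric]
    by (subst lift_comultR, intro lin, subst tensor_lift_swap)
       (simp add: mult_pure proj_pure clinear_scaleC[OF G] scaleC_complex_def mult_ac)
  then show "convol \<Delta>R (\<lambda>w. F (multR w)) (\<lambda>w. G (projR w)) (a \<otimes> q) =
      tensor_lift (\<lambda>q1 q2. F (a \<otimes> \<mu> q1) * G q2) (\<Delta>2 q)" by (simp only: 1)
  have "convol \<Delta>R (\<lambda>w. G (projR w)) (\<lambda>w. F (multR w)) (a \<otimes> q) =
     tensor_lift (\<lambda>q1 q2. G q1 * tensor_lift (\<lambda>a1 a2. \<delta> a1 * F (a2 \<otimes> \<mu> q2)) (\<Delta> a)) (\<Delta>2 q)"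
    unfolding convol_def tensor_lift_mult(1)[symmetric]
    by (subst lift_comultR, intro lin, subst tensor_lift_swap)
       (simp add: mult_pure proj_pure clinear_scaleC[OF G] scaleC_complex_def mult_ac)
  then show "convol \<Delta>R (\<lambda>w. G (projR w)) (\<lambda>w. F (multR w)) (a \<otimes> q) =
      tensor_lift (\<lambda>q1 q2. G q1 * F (a \<otimes> \<mu> q2)) (\<Delta>2 q)" by (simp only: 1)
qed

text \<open>The product bracketed to the left is the threefold product convolved with
  \<open>(F \<circ> (\<mu> \<otimes> id)) \<star> (F \<otimes> \<delta>)\<close>.\<close>

lemma mult_conv_left_bracket:
  assumes F: "clinear F"
  shows "mult_conv H F (mult_conv H F p \<otimes> c) =
    tensor_lift (\<lambda>u v. convol \<Delta>L (\<lambda>w. F (multL w)) (\<lambda>w. F (projL w)) v *\<^sub>C \<mu> (multL u)) (\<Delta>L (p \<otimes> c))"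
proof -
  have M: "clinear (mult_conv H F)" by (rule mult_conv_linear[OF F])
  note lin = llin F M clinear_compose[OF F] clinear_compose[OF M]
  have "clinear (convol \<Delta>L (\<lambda>w. F (multL w)) (\<lambda>w. F (projL w)))"
    unfolding convol_def by (intro lin)
  note lin = lin clinear_compose[OF this]
  have 1: "clinear (\<lambda>y. mult_conv H F (y \<otimes> c))" by (intro lin)
  let ?T = "\<lambda>p1 u q. tensor_lift (\<lambda>c1 c2. F q *\<^sub>C F (\<mu> u \<otimes> c2) *\<^sub>C (\<mu> p1 \<odot> c1)) (\<Delta> c)"
  have "mult_conv H F (\<mu> u \<otimes> c) =
      tensor_lift (\<lambda>p1 p2. tensor_lift (\<lambda>c1 c2. F (\<mu> p2 \<otimes> c2) *\<^sub>C (\<mu> p1 \<odot> c1)) (\<Delta> c)) (\<Delta>2 u)" for u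
  proof -
    have "mult_conv H F (multL (u \<otimes> c)) = tensor_lift (\<lambda>r s. F (multL s) *\<^sub>C \<mu> (multL r)) (\<Delta>L (u \<otimes> c))"
      unfolding mult_conv_eq by (rule tensor_lift_hom[OF multL_hom]) (intro lin)
    then show ?thesis unfolding mult_pure
      by (subst (asm) lift_comultL, (intro lin)[1]) (simp add: mult_pure)
  qed
  then have "mult_conv H F (mult_conv H F p \<otimes> c) =
     tensor_lift (\<lambda>u q. tensor_lift (\<lambda>p1 p2. ?T p1 p2 q) (\<Delta>2 u)) (\<Delta>2 p)"
    unfolding mult_conv_eq[of F p]
    by (simp only: clinear_apply_tensor_lift[OF 1] clinear_scaleC[OF 1] tensor_lift_scaleC)
  also have "\<dots> = tensor_lift (\<lambda>p1 v. tensor_lift (\<lambda>p2 q. ?T p1 p2 q) (\<Delta>2 v)) (\<Delta>2 p)"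
    by (rule coalgebra_coassoc[OF coalg2]; intro lin)
  also have "\<dots> = tensor_lift (\<lambda>p1 v. tensor_lift (\<lambda>c1 c2.
      tensor_lift (\<lambda>p2 q. F (\<mu> p2 \<otimes> c2) * F q) (\<Delta>2 v) *\<^sub>C (\<mu> p1 \<odot> c1)) (\<Delta> c)) (\<Delta>2 p)"
  proof -
    have "tensor_lift (\<lambda>p2 q. ?T p1 p2 q) (\<Delta>2 v) = tensor_lift (\<lambda>c1 c2.
        tensor_lift (\<lambda>p2 q. F (\<mu> p2 \<otimes> c2) * F q) (\<Delta>2 v) *\<^sub>C (\<mu> p1 \<odot> c1)) (\<Delta> c)" for p1 v
      by (subst tensor_lift_swap) (simp add: tensor_lift_scaleC_left[symmetric] scaleC_scaleC mult.commute)
    then show ?thesis by (simp only:)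
  qed
  also have "\<dots> = tensor_lift (\<lambda>u v. convol \<Delta>L (\<lambda>w. F (multL w)) (\<lambda>w. F (projL w)) v *\<^sub>C \<mu> (multL u)) (\<Delta>L (p \<otimes> c))"
    by (subst lift_comultL, intro lin) (simp only: convolL_pure(1)[OF F F] mult_pure)
  finally show ?thesis .
qed

lemma mult_conv_right_bracket:
  assumes F: "clinear F"
  shows "mult_conv H F (a \<otimes> mult_conv H F q) =
    tensor_lift (\<lambda>u v. convol \<Delta>R (\<lambda>w. F (multR w)) (\<lambda>w. F (projR w)) v *\<^sub>C \<mu> (multR u)) (\<Delta>R (a \<otimes> q))"
proof -
  have M: "clinear (mult_conv H F)" by (rule mult_conv_linear[OF F])
  note lin = llin F M clinear_compose[OF F] clinear_compose[OF M]
  have "clinear (convol \<Delta>R (\<lambda>w. F (multR w)) (\<lambda>w. F (projR w)))"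
    unfolding convol_def by (intro lin)
  note lin = lin clinear_compose[OF this]
  have 1: "clinear (\<lambda>y. mult_conv H F (a \<otimes> y))" by (intro lin)
  let ?T = "\<lambda>q1 u v. tensor_lift (\<lambda>a1 a2. F v *\<^sub>C F (a2 \<otimes> \<mu> u) *\<^sub>C (a1 \<odot> \<mu> q1)) (\<Delta> a)"
  have "mult_conv H F (a \<otimes> \<mu> u) =
      tensor_lift (\<lambda>q1 q2. tensor_lift (\<lambda>a1 a2. F (a2 \<otimes> \<mu> q2) *\<^sub>C (a1 \<odot> \<mu> q1)) (\<Delta> a)) (\<Delta>2 u)" for u
  proof -
    have "mult_conv H F (multR (a \<otimes> u)) = tensor_lift (\<lambda>r s. F (multR s) *\<^sub>C \<mu> (multR r)) (\<Delta>R (a \<otimes> u))"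
      unfolding mult_conv_eq by (rule tensor_lift_hom[OF multR_hom]) (intro lin)
    then show ?thesis unfolding mult_pure
      by (subst tensor_lift_swap, subst (asm) lift_comultR, (intro lin)[1]) (simp add: mult_pure)
  qed
  then have "mult_conv H F (a \<otimes> mult_conv H F q) =
     tensor_lift (\<lambda>u v. tensor_lift (\<lambda>q1 q2. ?T q1 q2 v) (\<Delta>2 u)) (\<Delta>2 q)"
    unfolding mult_conv_eq[of F q]
    by (simp only: clinear_apply_tensor_lift[OF 1] clinear_scaleC[OF 1] tensor_lift_scaleC)
  also have "\<dots> = tensor_lift (\<lambda>q1 v. tensor_lift (\<lambda>q2 v. ?T q1 q2 v) (\<Delta>2 v)) (\<Delta>2 q)"
    by (rule coalgebra_coassoc[OF coalg2]; intro lin)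
  also have "\<dots> = tensor_lift (\<lambda>a1 a2. tensor_lift (\<lambda>q1 v.
      tensor_lift (\<lambda>q2 v. F (a2 \<otimes> \<mu> q2) * F v) (\<Delta>2 v) *\<^sub>C (a1 \<odot> \<mu> q1)) (\<Delta>2 q)) (\<Delta> a)"
  proof -
    have "tensor_lift (\<lambda>q2 v. ?T q1 q2 v) (\<Delta>2 u) = tensor_lift (\<lambda>a1 a2.
        tensor_lift (\<lambda>q2 v. F (a2 \<otimes> \<mu> q2) * F v) (\<Delta>2 u) *\<^sub>C (a1 \<odot> \<mu> q1)) (\<Delta> a)" for q1 u
      by (subst tensor_lift_swap) (simp add: tensor_lift_scaleC_left[symmetric] scaleC_scaleC mult.commute)
    then show ?thesis by (simp only:) (rule tensor_lift_swap)
  qed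
  also have "\<dots> = tensor_lift (\<lambda>u v. convol \<Delta>R (\<lambda>w. F (multR w)) (\<lambda>w. F (projR w)) v *\<^sub>C \<mu> (multR u)) (\<Delta>R (a \<otimes> q))"
    by (subst lift_comultR, intro lin) (simp only: convolR_pure(1)[OF F F] mult_pure)
  finally show ?thesis .
qed

text \<open>The multiplicative cocycle identity. On each bracketing the two functionals built from \<open>L\<close>
  commute because \<open>L\<close> is central, so the convolution of their exponentials is the exponential of their sum;
  the two sums agree by the cocycle condition, up to the associator, which is a coalgebra homomorphism.\<close>

lemma exp_cocycle:
  assumes L: "generator L"
  defines "F \<equiv> convol_exp \<Delta>2 \<delta>2 L"
  shows "convol \<Delta>L (\<lambda>w. F (multL w)) (\<lambda>w. F (projL w)) x =
    convol \<Delta>R (\<lambda>w. F (multR w)) (\<lambda>w. F (projR w)) (tensor_assoc x)"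
proof -
  have Llin: "clinear L" and cent: "central L" using L by (simp_all add: generator_def)
  note lin = llin Llin clinear_compose[OF Llin]
  let ?A = "\<lambda>w. L (multL w)" and ?B = "\<lambda>w. L (projL w)"
  let ?A' = "\<lambda>w. L (multR w)" and ?B' = "\<lambda>w. L (projR w)"
  have AB: "clinear ?A" "clinear ?B" and AB': "clinear ?A'" "clinear ?B'" by (intro lin)+
  interpret L: coalg \<Delta>L \<delta>L by (rule coalg.intro[OF coalgL])
  interpret R: coalg \<Delta>R \<delta>R by (rule coalg.intro[OF coalgR])
  have "convol \<Delta>L ?A ?B = convol \<Delta>L ?B ?A"
  proof (rule tensor_lift_unique[OF L.convol_linear L.convol_linear]; (rule AB)?)
    fix p c
    have "clinear (\<lambda>y. L (y \<otimes> c))" by (intro lin)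
    from centralD[OF cent this, of p]
    show "convol \<Delta>L ?A ?B (p \<otimes> c) = convol \<Delta>L ?B ?A (p \<otimes> c)"
      by (simp add: convolL_pure[OF Llin Llin] scaleC_complex_def mult.commute)
  qed
  from L.convol_exp_add_commuting[OF AB this]
  have l: "convol \<Delta>L (\<lambda>w. F (multL w)) (\<lambda>w. F (projL w)) = convol_exp \<Delta>L \<delta>L (\<lambda>w. ?A w + ?B w)"
    by (simp add: F_def convol_exp_hom[OF multL_hom coalg2 Llin] convol_exp_hom[OF projL_hom coalg2 Llin])
  have "convol \<Delta>R ?A' ?B' = convol \<Delta>R ?B' ?A'"
  proof (rule tensor_lift_unique[OF R.convol_linear R.convol_linear]; (rule AB')?)
    fix a q
    have "clinear (\<lambda>y. L (a \<otimes> y))" by (intro lin)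
    from centralD[OF cent this, of q]
    show "convol \<Delta>R ?A' ?B' (a \<otimes> q) = convol \<Delta>R ?B' ?A' (a \<otimes> q)"
      by (simp add: convolR_pure[OF Llin Llin] scaleC_complex_def mult.commute)
  qed
  from R.convol_exp_add_commuting[OF AB' this]
  have r: "convol \<Delta>R (\<lambda>w. F (multR w)) (\<lambda>w. F (projR w)) = convol_exp \<Delta>R \<delta>R (\<lambda>w. ?A' w + ?B' w)"
    by (simp add: F_def convol_exp_hom[OF multR_hom coalg2 Llin] convol_exp_hom[OF projR_hom coalg2 Llin])
  have "(\<lambda>w. ?A w + ?B w) = (\<lambda>w. ?A' (tensor_assoc w) + ?B' (tensor_assoc w))"
  proof (rule tensor_lift_unique)
    fix p c
    have "(\<lambda>p. ?A (p \<otimes> c) + ?B (p \<otimes> c)) =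
        (\<lambda>p. ?A' (tensor_assoc (p \<otimes> c)) + ?B' (tensor_assoc (p \<otimes> c)))"
    proof (rule tensor_lift_unique)
      fix a b
      have "\<delta> a * L (b \<otimes> c) + L (a \<otimes> (b \<odot> c)) = L ((a \<odot> b) \<otimes> c) + L (a \<otimes> b) * \<delta> c"
        using L by (simp add: generator_def cocycle_def)
      then show "?A ((a \<otimes> b) \<otimes> c) + ?B ((a \<otimes> b) \<otimes> c) =
          ?A' (tensor_assoc ((a \<otimes> b) \<otimes> c)) + ?B' (tensor_assoc ((a \<otimes> b) \<otimes> c))"
        unfolding tensor_assoc_pure mult_pure proj_pure clinear_scaleC[OF Llin] scaleC_complex_def
        by (simp add: algebra_simps)
    qed (intro lin)+
    then show "?A (p \<otimes> c) + ?B (p \<otimes> c) = ?A' (tensor_assoc (p \<otimes> c)) + ?B' (tensor_assoc (p \<otimes> c))"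
      by (rule fun_cong)
  qed (intro lin)+
  then show ?thesis
    unfolding l r by (subst convol_exp_hom[OF assoc_hom coalgR], intro lin) simp
qed

lemma mult_conv_exp_assoc:
  assumes L: "generator L"
  defines "M \<equiv> mult_conv H (convol_exp \<Delta>2 \<delta>2 L)"
  shows "M (M (a \<otimes> b) \<otimes> c) = M (a \<otimes> M (b \<otimes> c))"
proof -
  let ?F = "convol_exp \<Delta>2 \<delta>2 L"
  have F: "clinear ?F" using L coalg.convol_exp_linear[OF coalg_locale2] by (simp add: generator_def)
  let ?KR = "convol \<Delta>R (\<lambda>w. ?F (multR w)) (\<lambda>w. ?F (projR w))"
  note lin = llin F clinear_compose[OF F]
  have "clinear ?KR"
    unfolding convol_def by (intro lin)
  note lin = lin clinear_compose[OF this]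
  have "(\<lambda>u. \<mu> (multR (tensor_assoc u))) = (\<lambda>u. \<mu> (multL u))"
  proof (rule tensor_lift_unique)
    fix p c
    have "(\<lambda>p. \<mu> (multR (tensor_assoc (p \<otimes> c)))) = (\<lambda>p. \<mu> (multL (p \<otimes> c)))"
      by (rule tensor_lift_unique, intro lin, intro lin) (simp add: mult_pure mult_assoc)
    then show "\<mu> (multR (tensor_assoc (p \<otimes> c))) = \<mu> (multL (p \<otimes> c))" by (rule fun_cong)
  qed (intro lin)+
  then have "\<mu> (multR (tensor_assoc u)) = \<mu> (multL u)" for u by (rule fun_cong)
  then have "M (M (a \<otimes> b) \<otimes> c) = tensor_lift (\<lambda>u v. ?KR (tensor_assoc v) *\<^sub>C \<mu> (multR (tensor_assoc u))) (\<Delta>L ((a \<otimes> b) \<otimes> c))"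
    unfolding M_def mult_conv_left_bracket[OF F] by (simp only: exp_cocycle[OF L])
  also have "\<dots> = tensor_lift (\<lambda>u v. ?KR v *\<^sub>C \<mu> (multR u)) (\<Delta>R (tensor_assoc ((a \<otimes> b) \<otimes> c)))"
    by (rule tensor_lift_hom[OF assoc_hom, symmetric]) (intro lin)
  also have "\<dots> = M (a \<otimes> M (b \<otimes> c))"
    unfolding M_def mult_conv_right_bracket[OF F] tensor_assoc_pure ..
  finally show ?thesis .
qed

text \<open>Both sides are fourfold sums over \<open>x\<close>; they differ by exchanging \<open>F\<close> and \<open>\<mu>\<close> on the two middle
  legs, which is centrality of \<open>F\<close>.\<close>

lemma comult_mult_conv:
  assumes F: "clinear F" "central F" and G: "clinear G"
  shows "\<Delta> (mult_conv H (convol \<Delta>2 F G) x) = tensor_map (mult_conv H F) (mult_conv H G) (\<Delta>2 x)"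
proof -
  note lin = hlin F(1) G clinear_compose[OF F(1)] clinear_compose[OF G]
  let ?U = "\<lambda>p q r s. F r *\<^sub>C G s *\<^sub>C (\<mu> p \<otimes> \<mu> q)"
  let ?V = "\<lambda>p q r s. F q *\<^sub>C G s *\<^sub>C (\<mu> p \<otimes> \<mu> r)"
  have "\<Delta> (mult_conv H (convol \<Delta>2 F G) x) =
      tensor_lift (\<lambda>p q. convol \<Delta>2 F G q *\<^sub>C \<Delta> (\<mu> p)) (\<Delta>2 x)"
    by (simp add: mult_conv_eq clinear_apply_tensor_lift[OF lins(2)] clinear_scaleC[OF lins(2)])
  also have "\<dots> = tensor_lift (\<lambda>u v. tensor_lift (\<lambda>p q. tensor_lift (\<lambda>r s. ?U p q r s) (\<Delta>2 v)) (\<Delta>2 u)) (\<Delta>2 x)"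
    by (simp add: comult_mult tensor_map_def convol_def tensor_lift_scaleC[symmetric] scaleC_scaleC
        tensor_lift_scaleC_left[symmetric])
  also have "\<dots> = tensor_lift (\<lambda>p w. tensor_lift (\<lambda>m s. tensor_lift (\<lambda>q r. ?U p q r s) (\<Delta>2 m)) (\<Delta>2 w)) (\<Delta>2 x)"
    by (rule coalgebra_coassoc4[OF coalg2]; intro lin)
  also have "\<dots> = tensor_lift (\<lambda>p w. tensor_lift (\<lambda>m s. tensor_lift (\<lambda>q r. ?V p q r s) (\<Delta>2 m)) (\<Delta>2 w)) (\<Delta>2 x)"
  proof -
    have "clinear (\<lambda>y. G s *\<^sub>C (\<mu> p \<otimes> y))" for p s by (intro lin)
    from centralD[OF F(2) this, symmetric] show ?thesis by (simp only:)
  qed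
  also have "\<dots> = tensor_lift (\<lambda>u v. tensor_lift (\<lambda>p q. tensor_lift (\<lambda>r s. ?V p q r s) (\<Delta>2 v)) (\<Delta>2 u)) (\<Delta>2 x)"
    by (rule coalgebra_coassoc4[OF coalg2, symmetric]; intro lin)
  also have "\<dots> = tensor_lift (\<lambda>u v. mult_conv H F u \<otimes> mult_conv H G v) (\<Delta>2 x)"
  proof -
    have 1: "clinear (\<lambda>y. y \<otimes> z)" and 2: "clinear (\<lambda>y. z \<otimes> y)" for z :: 'b by (intro clin)+
    show ?thesis
      unfolding mult_conv_eq clinear_apply_tensor_lift[OF 1]
      unfolding clinear_apply_tensor_lift[OF 2] by (simp add: tensor_pure_simps scaleC_scaleC mult.commute)
  qed
  finally show ?thesis by (simp add: tensor_map_def)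
qed

lemma deformation_of_generator:
  assumes L: "generator L"
  defines "M \<equiv> \<lambda>t. mult_conv H (conv_exp H t L)"
  shows "additive_deformation H M" "has_generator H M L"
proof -
  interpret coalg \<Delta>2 \<delta>2 by (rule coalg_locale2)
  have Llin: "clinear L" using L by (simp add: generator_def)
  define F where "F t = convol_exp \<Delta>2 \<delta>2 (\<lambda>x. complex_of_real t * L x)" for t
  have M: "M t = mult_conv H (F t)" for t by (simp add: M_def F_def conv_exp_eq)
  have gen: "generator (\<lambda>x. complex_of_real t * L x)" for t by (rule generator_scale[OF L])
  then have glin: "clinear (\<lambda>x. complex_of_real t * L x)" for t by (simp add: generator_def)
  have F: "clinear (F t)" for t unfolding F_def by (rule convol_exp_linear[OF glin])
  have M0: "M 0 = \<mu>"
    by (simp add: M F_def convol_exp_zero fun_eq_iff mult_conv_eq coalgebra_counit[OF coalg2] lins)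
  have Fadd: "F (t + s) = convol \<Delta>2 (F t) (F s)" for t s
    unfolding F_def of_real_add distrib_right
    by (rule convol_exp_add_commuting[OF glin glin]) (simp add: convol_scale mult.left_commute)
  have comult: "\<Delta> \<circ> M (t + s) = tensor_map (M t) (M s) \<circ> \<Delta>2" for t s
    unfolding M Fadd using comult_mult_conv[OF F central_exp[OF gen, folded F_def] F] by (simp add: fun_eq_iff)
  have alg: "unital_algebra (M t) \<one>" for t
    using mult_conv_unit[OF F exp_unit[OF gen, folded F_def]] mult_conv_exp_assoc[OF gen, folded F_def]
    by (simp add: unital_algebra_def M mult_conv_linear F)
  have counitM: "\<delta> (M t x) = F t x" for t x
    unfolding M mult_conv_eq
    by (simp add: clinear_apply_tensor_lift[OF lins(3)] clinear_scaleC[OF lins(3)] scaleC_complex_def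
       counit_mult mult.commute coalgebra_counit_complex[OF coalg2] F)
  have der: "((\<lambda>t. F t x) has_vector_derivative L x) (at 0)" for x
    unfolding F_def by (rule convol_exp_derivative[OF Llin])
  show "has_generator H M L"
    unfolding has_generator_def counitM using der has_vector_derivative_at_within by blast
  have "((\<lambda>t. F t x) \<longlongrightarrow> \<delta>2 x) (at_right 0)" for x
  proof -
    have "isCont (\<lambda>t. F t x) 0" by (rule has_vector_derivative_continuous[OF der])
    then have "((\<lambda>t. F t x) \<longlongrightarrow> F 0 x) (at_right 0)"
      unfolding isCont_def by (rule filterlim_mono) (simp_all add: at_le)
    then show ?thesis by (simp add: F_def convol_exp_zero)
  qed
  then show "additive_deformation H M"
    by (simp add: additive_deformation_def alg M0 comult counitM)
qed

end

context bialg
begin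

section \<open>Subtracting a coboundary\<close>

text \<open>The condition \<open>\<sigma> \<star> id = id \<star> \<sigma>\<close>.\<close>

definition convolution_central :: "('b \<Rightarrow> complex) \<Rightarrow> bool" where
  "convolution_central \<sigma> \<longleftrightarrow>
     (\<forall>x. tensor_lift (\<lambda>a b. \<sigma> a *\<^sub>C b) (\<Delta> x) = tensor_lift (\<lambda>a b. \<sigma> b *\<^sub>C a) (\<Delta> x))"

lemma convolution_centralD:
  assumes "convolution_central \<sigma>" "clinear g"
  shows "tensor_lift (\<lambda>a b. \<sigma> a *\<^sub>C g b) (\<Delta> x) = tensor_lift (\<lambda>a b. \<sigma> b *\<^sub>C g a) (\<Delta> x)"
  using assms(1)[unfolded convolution_central_def, THEN spec, of x, THEN arg_cong[of _ _ g]]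
  by (simp add: clinear_apply_tensor_lift[OF assms(2)] clinear_scaleC[OF assms(2)])

lemma coboundary_pure:
  assumes \<sigma>: "clinear \<sigma>"
  shows "coboundary H \<sigma> (a \<otimes> b) = \<delta> a * \<sigma> b - \<sigma> (a \<odot> b) + \<sigma> a * \<delta> b"
  unfolding coboundary_def
  by (subst tensor_lift_pure) (intro hlin \<sigma> clinear_compose[OF \<sigma>], rule refl)

lemma coboundary_linear:
  assumes \<sigma>: "clinear \<sigma>" shows "clinear (coboundary H \<sigma>)"
  unfolding coboundary_def by (intro clinear_tensor_lift hlin \<sigma> clinear_compose[OF \<sigma>])

lemma central_add: "central L \<Longrightarrow> central L' \<Longrightarrow> central (\<lambda>x. L x + L' x)"
  by (simp add: central_def scaleC_add_left tensor_lift_plus)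

lemma central_scale: "central L \<Longrightarrow> central (\<lambda>x. c * L x)"
  unfolding central_def scaleC_scaleC[symmetric] tensor_lift_scaleC by simp

text \<open>Each of the three terms of \<open>\<partial>\<sigma>\<close> inherits centrality from \<open>\<sigma>\<close>, through the first factor, the
  second factor, or the coalgebra homomorphism \<open>\<mu>\<close>.\<close>

lemma central_coboundary:
  assumes \<sigma>: "clinear \<sigma>" and cent: "convolution_central \<sigma>"
  shows "central (coboundary H \<sigma>)"
proof -
  note lin = hlin \<sigma> clinear_compose[OF \<sigma>]
  let ?A = "tensor_lift (\<lambda>a b. \<delta> a * \<sigma> b)" and ?C = "tensor_lift (\<lambda>a b. \<sigma> a * \<delta> b)"
  have A: "clinear ?A" "?A (a \<otimes> b) = \<delta> a * \<sigma> b" and C: "clinear ?C" "?C (a \<otimes> b) = \<sigma> a * \<delta> b" for a b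
    by (intro clinear_tensor_lift tensor_lift_pure lin)+
  note lin = lin A(1) C(1) clinear_compose[OF A(1)] clinear_compose[OF C(1)]
  have "central ?A"
    unfolding central_def
  proof
    fix x
    have "(\<lambda>x. tensor_lift (\<lambda>p q. ?A p *\<^sub>C \<mu> q) (\<Delta>2 x)) = (\<lambda>x. tensor_lift (\<lambda>p q. ?A q *\<^sub>C \<mu> p) (\<Delta>2 x))"
    proof (rule tensor_lift_unique)
      fix a b
      have 1: "clinear (\<lambda>y. z \<odot> y)" for z by (intro lin)
      have "tensor_lift (\<lambda>p q. ?A p *\<^sub>C \<mu> q) (\<Delta>2 (a \<otimes> b)) =
          tensor_lift (\<lambda>a1 a2. \<delta> a1 *\<^sub>C tensor_lift (\<lambda>b1 b2. \<sigma> b1 *\<^sub>C (a2 \<odot> b2)) (\<Delta> b)) (\<Delta> a)"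
        by (subst lift_comult2, intro lin) (simp add: A scaleC_scaleC tensor_lift_scaleC[symmetric])
      also have "\<dots> = tensor_lift (\<lambda>b1 b2. \<sigma> b1 *\<^sub>C (a \<odot> b2)) (\<Delta> b)"
        by (rule counit(1)) (intro lin)
      also have "\<dots> = tensor_lift (\<lambda>b1 b2. \<sigma> b2 *\<^sub>C (a \<odot> b1)) (\<Delta> b)"
        by (rule convolution_centralD[OF cent 1])
      also have "\<dots> = tensor_lift (\<lambda>a1 a2. \<delta> a2 *\<^sub>C tensor_lift (\<lambda>b1 b2. \<sigma> b2 *\<^sub>C (a1 \<odot> b1)) (\<Delta> b)) (\<Delta> a)"
        by (rule counit(2)[symmetric]) (intro lin)
      also have "\<dots> = tensor_lift (\<lambda>p q. ?A q *\<^sub>C \<mu> p) (\<Delta>2 (a \<otimes> b))"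
        by (subst lift_comult2, intro lin) (simp add: A scaleC_scaleC tensor_lift_scaleC[symmetric])
      finally show "tensor_lift (\<lambda>p q. ?A p *\<^sub>C \<mu> q) (\<Delta>2 (a \<otimes> b)) = tensor_lift (\<lambda>p q. ?A q *\<^sub>C \<mu> p) (\<Delta>2 (a \<otimes> b))" .
    qed (intro lin)+
    then show "tensor_lift (\<lambda>p q. ?A p *\<^sub>C \<mu> q) (\<Delta>2 x) = tensor_lift (\<lambda>p q. ?A q *\<^sub>C \<mu> p) (\<Delta>2 x)"
      by (rule fun_cong)
  qed
  moreover have "central ?C"
    unfolding central_def
  proof
    fix x
    have "(\<lambda>x. tensor_lift (\<lambda>p q. ?C p *\<^sub>C \<mu> q) (\<Delta>2 x)) = (\<lambda>x. tensor_lift (\<lambda>p q. ?C q *\<^sub>C \<mu> p) (\<Delta>2 x))"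
    proof (rule tensor_lift_unique)
      fix a b
      have 1: "clinear (\<lambda>y. y \<odot> z)" for z by (intro lin)
      have "tensor_lift (\<lambda>p q. ?C p *\<^sub>C \<mu> q) (\<Delta>2 (a \<otimes> b)) =
          tensor_lift (\<lambda>b1 b2. \<delta> b1 *\<^sub>C tensor_lift (\<lambda>a1 a2. \<sigma> a1 *\<^sub>C (a2 \<odot> b2)) (\<Delta> a)) (\<Delta> b)"
        by (subst lift_comult2, intro lin, subst tensor_lift_swap)
           (simp add: C scaleC_scaleC tensor_lift_scaleC[symmetric] mult.commute)
      also have "\<dots> = tensor_lift (\<lambda>a1 a2. \<sigma> a1 *\<^sub>C (a2 \<odot> b)) (\<Delta> a)"
        by (rule counit(1)) (intro lin)
      also have "\<dots> = tensor_lift (\<lambda>a1 a2. \<sigma> a2 *\<^sub>C (a1 \<odot> b)) (\<Delta> a)"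
        by (rule convolution_centralD[OF cent 1])
      also have "\<dots> = tensor_lift (\<lambda>b1 b2. \<delta> b2 *\<^sub>C tensor_lift (\<lambda>a1 a2. \<sigma> a2 *\<^sub>C (a1 \<odot> b1)) (\<Delta> a)) (\<Delta> b)"
        by (rule counit(2)[symmetric]) (intro lin)
      also have "\<dots> = tensor_lift (\<lambda>p q. ?C q *\<^sub>C \<mu> p) (\<Delta>2 (a \<otimes> b))"
        by (rule sym, subst lift_comult2, intro lin, subst tensor_lift_swap)
           (simp add: C scaleC_scaleC tensor_lift_scaleC[symmetric] mult.commute)
      finally show "tensor_lift (\<lambda>p q. ?C p *\<^sub>C \<mu> q) (\<Delta>2 (a \<otimes> b)) = tensor_lift (\<lambda>p q. ?C q *\<^sub>C \<mu> p) (\<Delta>2 (a \<otimes> b))" .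
    qed (intro lin)+
    then show "tensor_lift (\<lambda>p q. ?C p *\<^sub>C \<mu> q) (\<Delta>2 x) = tensor_lift (\<lambda>p q. ?C q *\<^sub>C \<mu> p) (\<Delta>2 x)"
      by (rule fun_cong)
  qed
  moreover have "central (\<lambda>x. \<sigma> (\<mu> x))"
    unfolding central_def
  proof
    fix x
    have "tensor_lift (\<lambda>p q. \<sigma> (\<mu> p) *\<^sub>C \<mu> q) (\<Delta>2 x) = tensor_lift (\<lambda>a b. \<sigma> a *\<^sub>C b) (\<Delta> (\<mu> x))"
      by (rule lift_comult_mult[symmetric]) (intro lin)
    also have "\<dots> = tensor_lift (\<lambda>a b. \<sigma> b *\<^sub>C a) (\<Delta> (\<mu> x))"
      using cent by (simp add: convolution_central_def)
    also have "\<dots> = tensor_lift (\<lambda>p q. \<sigma> (\<mu> q) *\<^sub>C \<mu> p) (\<Delta>2 x)"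
      by (rule lift_comult_mult) (intro lin)
    finally show "tensor_lift (\<lambda>p q. \<sigma> (\<mu> p) *\<^sub>C \<mu> q) (\<Delta>2 x) = tensor_lift (\<lambda>p q. \<sigma> (\<mu> q) *\<^sub>C \<mu> p) (\<Delta>2 x)" .
  qed
  ultimately have "central (\<lambda>x. (?A x + (-1) * \<sigma> (\<mu> x)) + ?C x)"
    by (intro central_add central_scale)
  moreover have "coboundary H \<sigma> = (\<lambda>x. (?A x + (-1) * \<sigma> (\<mu> x)) + ?C x)"
    by (rule tensor_lift_unique[OF coboundary_linear[OF \<sigma>]], intro lin) (simp add: coboundary_pure \<sigma> A C)
  ultimately show ?thesis by simp
qed

lemma cocycle_coboundary:
  assumes "clinear \<sigma>" shows "cocycle (coboundary H \<sigma>)"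
  by (simp add: cocycle_def coboundary_pure[OF assms] counit_mult counit2_pure mult_assoc algebra_simps)

lemma generator_minus_coboundary:
  assumes L: "generator L" and \<sigma>: "clinear \<sigma>" "convolution_central \<sigma>" "\<sigma> \<one> = 0"
  shows "generator (\<lambda>x. L x - c * coboundary H \<sigma> x)"
proof -
  have Llin: "clinear L" and Lcent: "central L" and Lunit: "L (\<one> \<otimes> \<one>) = 0" and Lco: "cocycle L"
    using L by (simp_all add: generator_def)
  have "central (\<lambda>x. L x + (- c) * coboundary H \<sigma> x)"
    by (intro central_add central_scale Lcent central_coboundary \<sigma>)
  moreover have "clinear (\<lambda>x. L x - c * coboundary H \<sigma> x)"
    by (intro clin Llin coboundary_linear \<sigma>)
  moreover have "cocycle (\<lambda>x. L x - c * coboundary H \<sigma> x)"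
    unfolding cocycle_def
  proof (intro allI)
    fix x y z
    let ?d = "coboundary H \<sigma>"
    have "\<delta> x * L (y \<otimes> z) + L (x \<otimes> (y \<odot> z)) = L ((x \<odot> y) \<otimes> z) + L (x \<otimes> y) * \<delta> z"
      "\<delta> x * ?d (y \<otimes> z) + ?d (x \<otimes> (y \<odot> z)) = ?d ((x \<odot> y) \<otimes> z) + ?d (x \<otimes> y) * \<delta> z"
      using Lco cocycle_coboundary[OF \<sigma>(1)] by (simp_all add: cocycle_def)
    then show "\<delta> x * (L (y \<otimes> z) - c * ?d (y \<otimes> z)) + (L (x \<otimes> (y \<odot> z)) - c * ?d (x \<otimes> (y \<odot> z))) =
       L ((x \<odot> y) \<otimes> z) - c * ?d ((x \<odot> y) \<otimes> z) + (L (x \<otimes> y) - c * ?d (x \<otimes> y)) * \<delta> z"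
      by algebra
  qed
  moreover have "L (\<one> \<otimes> \<one>) - c * coboundary H \<sigma> (\<one> \<otimes> \<one>) = 0"
    by (simp add: Lunit coboundary_pure \<sigma> unit_mult)
  ultimately show ?thesis by (simp add: generator_def)
qed

end

section \<open>Constant antipodes\<close>

context hopf
begin

text \<open>Centrality of \<open>L\<close> at \<open>x\<^sub>1 \<otimes> S x\<^sub>2\<close> gives \<open>\<sigma>(x) \<one> = x\<^sub>1 \<sigma>(x\<^sub>2) S(x\<^sub>3)\<close>. Multiplying by a
  further leg from the right cancels \<open>S(x\<^sub>3)\<close> and leaves \<open>\<sigma>(x\<^sub>1) x\<^sub>2 = x\<^sub>1 \<sigma>(x\<^sub>2)\<close>.\<close>

lemma antipode_functional_central:
  assumes L: "generator L"
  defines "\<sigma> \<equiv> \<lambda>x. tensor_lift (\<lambda>a b. L (a \<otimes> S b)) (\<Delta> x)"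
  shows "convolution_central \<sigma>"
  unfolding convolution_central_def
proof
  fix x
  have Llin: "clinear L" and Lcent: "central L" using L by (simp_all add: generator_def)
  have \<sigma>: "clinear \<sigma>" unfolding \<sigma>_def by (intro slin clinear_compose[OF Llin])
  note lin = slin Llin clinear_compose[OF Llin] \<sigma> clinear_compose[OF \<sigma>]
  have key: "\<sigma> x *\<^sub>C \<one> = tensor_lift (\<lambda>a r. tensor_lift (\<lambda>m d. \<sigma> m *\<^sub>C (a \<odot> S d)) (\<Delta> r)) (\<Delta> x)" for x
  proof -
    have "\<sigma> x *\<^sub>C \<one> = tensor_lift (\<lambda>a r. L (a \<otimes> S r) *\<^sub>C \<one>) (\<Delta> x)"
      by (simp add: \<sigma>_def tensor_lift_scaleC_left)
    also have "\<dots> = tensor_lift (\<lambda>a r. tensor_lift (\<lambda>m d. \<delta> m *\<^sub>C L (a \<otimes> S d) *\<^sub>C \<one>) (\<Delta> r)) (\<Delta> x)"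
    proof -
      have "tensor_lift (\<lambda>m d. \<delta> m *\<^sub>C L (a \<otimes> S d) *\<^sub>C \<one>) (\<Delta> r) = L (a \<otimes> S r) *\<^sub>C \<one>" for a r
        by (rule counit(1)) (intro lin)
      then show ?thesis by (simp only:)
    qed
    also have "\<dots> = tensor_lift (\<lambda>a r. tensor_lift (\<lambda>m d. tensor_lift (\<lambda>b c.
        L (a \<otimes> S d) *\<^sub>C (b \<odot> S c)) (\<Delta> m)) (\<Delta> r)) (\<Delta> x)"
      by (simp add: tensor_lift_scaleC antipode scaleC_scaleC mult.commute)
    also have "\<dots> = tensor_lift (\<lambda>p q. tensor_lift (\<lambda>u v. L u *\<^sub>C \<mu> v) (\<Delta>2 (p \<otimes> S q))) (\<Delta> x)"
      by (rule comult2_antipode_right[symmetric]; intro lin)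
    also have "\<dots> = tensor_lift (\<lambda>p q. tensor_lift (\<lambda>u v. L v *\<^sub>C \<mu> u) (\<Delta>2 (p \<otimes> S q))) (\<Delta> x)"
      using Lcent by (simp only: central_def)
    also have "\<dots> = tensor_lift (\<lambda>a r. tensor_lift (\<lambda>m d. tensor_lift (\<lambda>b c.
        L (b \<otimes> S c) *\<^sub>C (a \<odot> S d)) (\<Delta> m)) (\<Delta> r)) (\<Delta> x)"
      by (rule comult2_antipode_right; intro lin)
    finally show ?thesis by (simp only: tensor_lift_scaleC_left \<sigma>_def)
  qed
  have mz: "clinear (\<lambda>y. y \<odot> z)" for z by (intro lin)
  have "tensor_lift (\<lambda>y z. \<sigma> y *\<^sub>C z) (\<Delta> x) = tensor_lift (\<lambda>y z. (\<sigma> y *\<^sub>C \<one>) \<odot> z) (\<Delta> x)"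
    by (simp add: clinear_scaleC[OF mz] unit_mult)
  also have "\<dots> = tensor_lift (\<lambda>y z. tensor_lift (\<lambda>a r. tensor_lift (\<lambda>m d. \<sigma> m *\<^sub>C (a \<odot> S d \<odot> z)) (\<Delta> r)) (\<Delta> y)) (\<Delta> x)"
    unfolding key clinear_apply_tensor_lift[OF mz] clinear_scaleC[OF mz] ..
  also have "\<dots> = tensor_lift (\<lambda>a w. tensor_lift (\<lambda>r z. tensor_lift (\<lambda>m d. \<sigma> m *\<^sub>C (a \<odot> S d \<odot> z)) (\<Delta> r)) (\<Delta> w)) (\<Delta> x)"
    by (rule coassoc; intro lin)
  also have "\<dots> = tensor_lift (\<lambda>a w. \<sigma> w *\<^sub>C a) (\<Delta> x)"
  proof -
    have "tensor_lift (\<lambda>r z. tensor_lift (\<lambda>m d. \<sigma> m *\<^sub>C (a \<odot> S d \<odot> z)) (\<Delta> r)) (\<Delta> w) = \<sigma> w *\<^sub>C a" for a w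
    proof -
      have "tensor_lift (\<lambda>r z. tensor_lift (\<lambda>m d. \<sigma> m *\<^sub>C (a \<odot> S d \<odot> z)) (\<Delta> r)) (\<Delta> w) =
          tensor_lift (\<lambda>m v. tensor_lift (\<lambda>d z. \<sigma> m *\<^sub>C (a \<odot> S d \<odot> z)) (\<Delta> v)) (\<Delta> w)"
        by (rule coassoc; intro lin)
      also have "\<dots> = tensor_lift (\<lambda>m v. \<delta> v *\<^sub>C \<sigma> m *\<^sub>C a) (\<Delta> w)"
      proof -
        have "clinear (\<lambda>y. a \<odot> y)" by (intro lin)
        from antipode_apply(1)[OF this]
        have "tensor_lift (\<lambda>d z. \<sigma> m *\<^sub>C (a \<odot> S d \<odot> z)) (\<Delta> v) = \<delta> v *\<^sub>C \<sigma> m *\<^sub>C a" for m v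
          by (simp add: tensor_lift_scaleC mult_assoc unit_mult scaleC_scaleC mult.commute)
        then show ?thesis by (simp only:)
      qed
      also have "\<dots> = \<sigma> w *\<^sub>C a" by (rule counit(2)) (intro lin)
      finally show ?thesis .
    qed
    then show ?thesis by (simp only:)
  qed
  finally show "tensor_lift (\<lambda>a b. \<sigma> a *\<^sub>C b) (\<Delta> x) = tensor_lift (\<lambda>a b. \<sigma> b *\<^sub>C a) (\<Delta> x)" .
qed

text \<open>The cocycle condition at \<open>x\<^sub>1, S x\<^sub>2, x\<^sub>3\<close>: in the two terms containing a product the antipode cancels,
  which leaves a value of \<open>L\<close> with the unit in one argument, that is \<open>0\<close>.\<close>

lemma antipode_functional_left_right:
  assumes L: "generator L"
  shows "tensor_lift (\<lambda>a b. L (S a \<otimes> b)) (\<Delta> x) = tensor_lift (\<lambda>a b. L (a \<otimes> S b)) (\<Delta> x)"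
proof -
  have Llin: "clinear L" and co: "\<delta> a * L (b \<otimes> c) + L (a \<otimes> (b \<odot> c)) = L ((a \<odot> b) \<otimes> c) + L (a \<otimes> b) * \<delta> c" for a b c
    using L by (simp_all add: generator_def cocycle_def)
  note lin = slin Llin clinear_compose[OF Llin]
  let ?T = "\<lambda>a b c. \<delta> a * L (S b \<otimes> c) + L (a \<otimes> (S b \<odot> c))"
  have "tensor_lift (\<lambda>a q. tensor_lift (\<lambda>b c. ?T a b c) (\<Delta> q)) (\<Delta> x) =
      tensor_lift (\<lambda>p c. tensor_lift (\<lambda>a b. ?T a b c) (\<Delta> p)) (\<Delta> x)"
    by (rule coassoc[symmetric]; intro lin)
  also have "\<dots> = tensor_lift (\<lambda>p c. \<delta> c * tensor_lift (\<lambda>a b. L (a \<otimes> S b)) (\<Delta> p)) (\<Delta> x)"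
  proof -
    have "clinear (\<lambda>y. L (y \<otimes> c))" for c by (intro lin)
    from antipode_apply(2)[OF this] show ?thesis
      by (simp add: co tensor_lift_plus tensor_lift_mult cocycle_unit[OF L] mult.commute)
  qed
  also have "\<dots> = tensor_lift (\<lambda>a b. L (a \<otimes> S b)) (\<Delta> x)"
    by (rule counit_c(2)) (intro lin)
  also have "tensor_lift (\<lambda>a q. tensor_lift (\<lambda>b c. ?T a b c) (\<Delta> q)) (\<Delta> x) =
      tensor_lift (\<lambda>a q. \<delta> a * tensor_lift (\<lambda>b c. L (S b \<otimes> c)) (\<Delta> q)) (\<Delta> x)"
  proof -
    have "clinear (\<lambda>y. L (a \<otimes> y))" for a by (intro lin)
    from antipode_apply(1)[OF this] show ?thesis
      by (simp add: tensor_lift_plus tensor_lift_mult cocycle_unit[OF L])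
  qed
  also have "\<dots> = tensor_lift (\<lambda>b c. L (S b \<otimes> c)) (\<Delta> x)"
    by (rule counit_c(1)) (intro lin)
  finally show ?thesis .
qed

text \<open>Splitting one factor \<open>L\<close> off the \<open>n\<close>-th power and reordering the legs, the two middle legs
  of \<open>x\<close> contribute exactly the sum assumed to vanish. So only the term \<open>n = 0\<close> of the exponential survives.\<close>

lemma exp_antipode:
  assumes L: "clinear L"
  defines "F \<equiv> convol_exp \<Delta>2 \<delta>2 L"
  shows "(\<And>x. tensor_lift (\<lambda>a b. L (a \<otimes> S b)) (\<Delta> x) = 0) \<Longrightarrow> tensor_lift (\<lambda>a b. F (a \<otimes> S b)) (\<Delta> x) = \<delta> x"
    and "(\<And>x. tensor_lift (\<lambda>a b. L (S a \<otimes> b)) (\<Delta> x) = 0) \<Longrightarrow> tensor_lift (\<lambda>a b. F (S a \<otimes> b)) (\<Delta> x) = \<delta> x"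
proof -
  let ?P = "convol_power \<Delta>2 \<delta>2 L"
  interpret coalg \<Delta>2 \<delta>2 by (rule coalg_locale2)
  have P: "clinear (?P n)" for n by (rule convol_power_linear[OF L])
  note lin = slin L clinear_compose[OF L] P clinear_compose[OF P]
  have d: "(\<lambda>n. (if n = 0 then \<delta> x else 0) / fact n) sums \<delta> x" for x
    using sums_single[of 0 "\<lambda>n. \<delta> x / fact n"] by (simp add: if_distrib[of "\<lambda>y. y / _"] cong: if_cong)
  {
    assume 0: "tensor_lift (\<lambda>a b. L (a \<otimes> S b)) (\<Delta> x) = 0" for x
    have "tensor_lift (\<lambda>a b. ?P n (a \<otimes> S b)) (\<Delta> x) = (if n = 0 then \<delta> x else 0)" for n x
    proof (cases n)
      case 0
      then show ?thesis
        using counit_c(1)[OF lins(3)] by (simp add: counit2_pure counit_antipode)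
    next
      case (Suc k)
      have "tensor_lift (\<lambda>a b. ?P n (a \<otimes> S b)) (\<Delta> x) =
         tensor_lift (\<lambda>a b. tensor_lift (\<lambda>p q. ?P k p * L q) (\<Delta>2 (a \<otimes> S b))) (\<Delta> x)"
        \<comment> \<open>The middle legs belong to the second convolution factor here, so \<open>L\<close> is split off on the right.\<close>
        using convol_power_commute[OF L L refl, of k] by (simp add: Suc convol_def fun_eq_iff)
      also have "\<dots> = tensor_lift (\<lambda>a r. tensor_lift (\<lambda>m d. tensor_lift (\<lambda>b c.
          ?P k (a \<otimes> S d) * L (b \<otimes> S c)) (\<Delta> m)) (\<Delta> r)) (\<Delta> x)"
        by (rule comult2_antipode_right; intro lin)
      also have "\<dots> = 0" by (simp add: tensor_lift_mult 0) (simp add: tensor_lift_def free_lift_def)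
      finally show ?thesis using Suc by simp
    qed
    then have "(\<lambda>n. tensor_lift (\<lambda>a b. ?P n (a \<otimes> S b) / fact n) (\<Delta> x)) sums \<delta> x"
      using d[of x] by (simp add: divide_inverse tensor_lift_mult)
    moreover have "(\<lambda>n. tensor_lift (\<lambda>a b. ?P n (a \<otimes> S b) / fact n) (\<Delta> x)) sums
        tensor_lift (\<lambda>a b. F (a \<otimes> S b)) (\<Delta> x)"
      unfolding F_def by (intro tensor_lift_sums convol_exp_sums L)
    ultimately show "tensor_lift (\<lambda>a b. F (a \<otimes> S b)) (\<Delta> x) = \<delta> x"
      using sums_unique2 by blast
  }
  {
    assume 0: "tensor_lift (\<lambda>a b. L (S a \<otimes> b)) (\<Delta> x) = 0" for x
    have "tensor_lift (\<lambda>a b. ?P n (S a \<otimes> b)) (\<Delta> x) = (if n = 0 then \<delta> x else 0)" for n x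
    proof (cases n)
      case 0
      then show ?thesis
        using counit_c(1)[OF lins(3)] by (simp add: counit2_pure counit_antipode)
    next
      case (Suc k)
      have "tensor_lift (\<lambda>a b. ?P n (S a \<otimes> b)) (\<Delta> x) =
         tensor_lift (\<lambda>a b. tensor_lift (\<lambda>p q. L p * ?P k q) (\<Delta>2 (S a \<otimes> b))) (\<Delta> x)"
        by (simp add: Suc convol_def)
      also have "\<dots> = tensor_lift (\<lambda>a r. tensor_lift (\<lambda>m d. tensor_lift (\<lambda>b c.
          L (S b \<otimes> c) * ?P k (S a \<otimes> d)) (\<Delta> m)) (\<Delta> r)) (\<Delta> x)"
        by (rule comult2_antipode_left; intro lin)
      also have "\<dots> = 0" by (simp add: tensor_lift_mult 0) (simp add: tensor_lift_def free_lift_def)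
      finally show ?thesis using Suc by simp
    qed
    then have "(\<lambda>n. tensor_lift (\<lambda>a b. ?P n (S a \<otimes> b) / fact n) (\<Delta> x)) sums \<delta> x"
      using d[of x] by (simp add: divide_inverse tensor_lift_mult)
    moreover have "(\<lambda>n. tensor_lift (\<lambda>a b. ?P n (S a \<otimes> b) / fact n) (\<Delta> x)) sums
        tensor_lift (\<lambda>a b. F (S a \<otimes> b)) (\<Delta> x)"
      unfolding F_def by (intro tensor_lift_sums convol_exp_sums L)
    ultimately show "tensor_lift (\<lambda>a b. F (S a \<otimes> b)) (\<Delta> x) = \<delta> x"
      using sums_unique2 by blast
  }
qed

text \<open>In one of the identities the antipode first cancels in \<open>\<mu>\<close> and then in \<open>F\<close>, in the other one the
  order is reversed.\<close>

lemma antipode_mult_conv: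
  assumes F: "clinear F"
    and r: "\<And>x. tensor_lift (\<lambda>a b. F (a \<otimes> S b)) (\<Delta> x) = \<delta> x"
    and l: "\<And>x. tensor_lift (\<lambda>a b. F (S a \<otimes> b)) (\<Delta> x) = \<delta> x"
  shows "is_antipode H (mult_conv H F) S"
proof -
  note lin = slin F clinear_compose[OF F]
  note M = mult_conv_linear[OF F]
  have id: "clinear id" by (rule clinear_id)
  have "mult_conv H F (tensor_map S id (\<Delta> x)) = \<delta> x *\<^sub>C \<one>" for x
  proof -
    have "mult_conv H F (tensor_map S id (\<Delta> x)) =
        tensor_lift (\<lambda>p q. tensor_lift (\<lambda>u v. F v *\<^sub>C \<mu> u) (\<Delta>2 (S p \<otimes> q))) (\<Delta> x)"
      unfolding tensor_map_def clinear_apply_tensor_lift[OF M] id_apply unfolding mult_conv_eq ..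
    also have "\<dots> = tensor_lift (\<lambda>a r. tensor_lift (\<lambda>m d. tensor_lift (\<lambda>b c.
          F (S a \<otimes> d) *\<^sub>C (S b \<odot> c)) (\<Delta> m)) (\<Delta> r)) (\<Delta> x)"
      by (rule comult2_antipode_left; intro lin)
    also have "\<dots> = tensor_lift (\<lambda>a r. tensor_lift (\<lambda>m d. \<delta> m *\<^sub>C F (S a \<otimes> d) *\<^sub>C \<one>) (\<Delta> r)) (\<Delta> x)"
      by (simp add: tensor_lift_scaleC antipode scaleC_scaleC mult.commute)
    also have "\<dots> = tensor_lift (\<lambda>a r. F (S a \<otimes> r) *\<^sub>C \<one>) (\<Delta> x)"
    proof -
      have "tensor_lift (\<lambda>m d. \<delta> m *\<^sub>C F (S a \<otimes> d) *\<^sub>C \<one>) (\<Delta> r) = F (S a \<otimes> r) *\<^sub>C \<one>" for a r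
        by (rule counit(1)) (intro lin)
      then show ?thesis by (simp only:)
    qed
    finally show ?thesis by (simp add: tensor_lift_scaleC_left l)
  qed
  moreover have "mult_conv H F (tensor_map id S (\<Delta> x)) = \<delta> x *\<^sub>C \<one>" for x
  proof -
    have "mult_conv H F (tensor_map id S (\<Delta> x)) =
        tensor_lift (\<lambda>p q. tensor_lift (\<lambda>u v. F v *\<^sub>C \<mu> u) (\<Delta>2 (p \<otimes> S q))) (\<Delta> x)"
      unfolding tensor_map_def clinear_apply_tensor_lift[OF M] id_apply unfolding mult_conv_eq ..
    also have "\<dots> = tensor_lift (\<lambda>a r. tensor_lift (\<lambda>m d. tensor_lift (\<lambda>b c.
          F (b \<otimes> S c) *\<^sub>C (a \<odot> S d)) (\<Delta> m)) (\<Delta> r)) (\<Delta> x)"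
      by (rule comult2_antipode_right; intro lin)
    also have "\<dots> = tensor_lift (\<lambda>a r. tensor_lift (\<lambda>m d. \<delta> m *\<^sub>C (a \<odot> S d)) (\<Delta> r)) (\<Delta> x)"
      by (simp only: tensor_lift_scaleC_left r)
    also have "\<dots> = tensor_lift (\<lambda>a r. a \<odot> S r) (\<Delta> x)"
    proof -
      have "tensor_lift (\<lambda>m d. \<delta> m *\<^sub>C (a \<odot> S d)) (\<Delta> r) = a \<odot> S r" for a r
        by (rule counit(1)) (intro lin)
      then show ?thesis by (simp only:)
    qed
    finally show ?thesis by (simp add: antipode)
  qed
  ultimately show ?thesis by (simp add: is_antipode_def lin_S fun_eq_iff unit_counit_def)
qed

end

theorem theorem7:
  fixes H :: "'b::complex_vector bialg"
    and S :: "'b \<Rightarrow> 'b"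
    and M :: "real \<Rightarrow> ('b, 'b) tensor \<Rightarrow> 'b"
    and L L' :: "('b, 'b) tensor \<Rightarrow> complex"
    and \<sigma> :: "'b \<Rightarrow> complex"
    and M' :: "real \<Rightarrow> ('b, 'b) tensor \<Rightarrow> 'b"
  assumes "hopf_algebra H S"
    and "additive_deformation H M"
    and "has_generator H M L"
    and "\<sigma> = L \<circ> tensor_map id S \<circ> comult H"
    and "\<sigma> = \<sigma> \<circ> S"
    and "L' = (\<lambda>x. L x - 1/2 * coboundary H \<sigma> x)"
    and "M' = (\<lambda>t. mult_conv H (conv_exp H t L'))"
  shows "hopf_deformation H M' \<and> has_generator H M' L' \<and>
    (\<forall>t. M' t \<circ> tensor_map S id \<circ> comult H = unit_counit H \<and>
         unit_counit H = M' t \<circ> tensor_map id S \<circ> comult H)"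
proof -
  interpret hopf H S
    using assms(1) by unfold_locales (simp_all add: hopf_algebra_def)
  have L: "generator L" by (rule generator_of_deformation[OF assms(2,3)])
  then have Llin: "clinear L" by (simp add: generator_def)
  have \<sigma>: "\<sigma> x = tensor_lift (\<lambda>a b. L (a \<otimes> S b)) (\<Delta> x)" for x
    by (simp add: assms(4) tensor_map_def clinear_apply_tensor_lift[OF Llin])
  have \<sigma>lin: "clinear \<sigma>"
    unfolding \<sigma>[abs_def] by (intro slin clinear_compose[OF Llin])
  have \<sigma>cent: "convolution_central \<sigma>"
    unfolding \<sigma>[abs_def] by (rule antipode_functional_central[OF L])
  have \<sigma>S: "\<sigma> (S x) = \<sigma> x" for x using fun_cong[OF assms(5), of x] by simp
  have \<sigma>1: "\<sigma> \<one> = 0"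
    unfolding \<sigma> by (subst lift_comult_unit, intro slin clinear_compose[OF Llin]) (simp add: antipode_unit cocycle_unit[OF L])
  have L': "generator L'"
    unfolding assms(6) by (rule generator_minus_coboundary[OF L \<sigma>lin \<sigma>cent \<sigma>1])
  then have L'lin: "clinear L'" by (simp add: generator_def)
  note def = deformation_of_generator[OF L', folded assms(7)]
  \<comment> \<open>The three coboundary terms, arranged so that each is collapsed by an antipode or counit identity.\<close>
  have L'pure: "L' (a \<otimes> b) = L (a \<otimes> b) + (1/2 * \<sigma> (a \<odot> b) - 1/2 * (\<delta> a * \<sigma> b + \<delta> b * \<sigma> a))" for a b
    by (simp add: assms(6) coboundary_pure[OF \<sigma>lin] field_simps)
  have minus: "tensor_lift (\<lambda>a b. f a b - g a b) t = tensor_lift f t - tensor_lift g t"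
    for f g :: "'b \<Rightarrow> 'b \<Rightarrow> complex" and t
    using tensor_lift_plus[of "\<lambda>a b. f a b - g a b" g t] by simp
  have s: "tensor_lift (\<lambda>a b. \<delta> a * \<sigma> b) (\<Delta> x) = \<sigma> x" "tensor_lift (\<lambda>a b. \<delta> b * \<sigma> a) (\<Delta> x) = \<sigma> x" for x
    by (rule counit_c[OF \<sigma>lin])+
  have r0: "tensor_lift (\<lambda>a b. L' (a \<otimes> S b)) (\<Delta> x) = 0" for x
    unfolding L'pure tensor_lift_plus minus tensor_lift_mult(1)
    by (simp add: antipode_apply \<sigma>lin \<sigma>1 counit_antipode \<sigma>S s \<sigma>[symmetric])
  have l0: "tensor_lift (\<lambda>a b. L' (S a \<otimes> b)) (\<Delta> x) = 0" for x
    unfolding L'pure tensor_lift_plus minus tensor_lift_mult(1)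
    by (simp add: antipode_apply \<sigma>lin \<sigma>1 counit_antipode \<sigma>S s
        antipode_functional_left_right[OF L] \<sigma>[symmetric])
  have anti: "is_antipode H (M' t) S" for t
  proof -
    have tL: "clinear (\<lambda>x. complex_of_real t * L' x)" by (intro clin L'lin)
    show ?thesis
      unfolding assms(7) conv_exp_eq
      by (intro antipode_mult_conv exp_antipode[OF tL] coalg.convol_exp_linear[OF coalg_locale2 tL])
         (simp_all add: tensor_lift_mult r0 l0)
  qed
  have "hopf_deformation H M'"
    unfolding hopf_deformation_def using def anti assms(7) by blast
  then show ?thesis using def anti by (simp add: is_antipode_def)
qed

end
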